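(* Let $\nu>0$ and $0<R_1<R_2$. There exists a constant $C_2(\nu,R_1,R_2)>0$, depending only on $\nu,R_1,R_2$, such that the following holds. Let $\omega_1,\omega_2\in\mathbb{R}$ and let $(v,p)$, $v=v^r\bm{e}_r+v^\theta\bm{e}_\theta+v^z\bm{e}_z$, be a smooth solution (smooth up to the boundary, not assumed axially symmetric) in $\Omega$ of the stationary Navier--Stokes equations in cylindrical coordinates $$\left\{\begin{aligned} (v\cdot\nabla)v^r-\frac{(v^\theta)^2}{r}+\partial_r p&=\nu\Big(\Delta-\frac1{r^2}\Big)v^r-\nu\frac{2}{r^2}\partial_\theta v^\theta,\\ (v\cdot\nabla)v^\theta+\frac{v^rv^\theta}{r}+\frac1r\partial_\theta p&=\nu\Big(\Delta-\frac1{r^2}\Big)v^\theta+\nu\frac{2}{r^2}\partial_\theta v^r,\\ (v\cdot\nabla)v^z+\partial_z p&=\nu\Delta v^z,\\ \frac1r\partial_r(rv^r)+\frac1r\partial_\theta v^\theta+\partial_z v^z&=0, \end{aligned}\right.$$ with the boundary conditions $$v^r(R_j,\theta,z)=v^z(R_j,\theta,z)=0\ (j=1,2),\qquad v^\theta(R_1,\theta,z)=R_1\omega_1,\qquad v^\theta(R_2,\theta,z)=R_2\omega_2$$ for all $\theta,z$. If $$\max\{R_1|\omega_1|,R_2|\omega_2|\}<C_2(\nu,R_1,R_2)\quad\text{and}\quad\|v\|_{L^\infty(\Omega)}<C_2(\nu,R_1,R_2),$$ then $\partial_\theta v\equiv0$ and $\partial_\theta p\equiv0$ in $\Omega$, that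 is, $(v,p)$ is axially symmetric.
   Context: $\Omega=\{(x_1,x_2,x_3)\in\mathbb{R}^3: R_1<\sqrt{x_1^2+x_2^2}<R_2\}$ is the region between two concentric cylinders. Cylindrical coordinates $(r,\theta,z)$ are used, with $\bm{e}_r=(\cos\theta,\sin\theta,0)$, $\bm{e}_\theta=(-\sin\theta,\cos\theta,0)$, $\bm{e}_z=(0,0,1)$; the components $v^r,v^\theta,v^z$ and $p$ are functions of $(r,\theta,z)$ that are $2\pi$-periodic in $\theta$. Notation: $$v\cdot\nabla=v^r\partial_r+\frac{v^\theta}{r}\partial_\theta+v^z\partial_z,\qquad \Delta=\partial_r^2+\frac1r\partial_r+\frac1{r^2}\partial_\theta^2+\partial_z^2.$$ $\partial_\theta v\equiv0$ means that the cylindrical components satisfy $\partial_\theta v^r=\partial_\theta v^\theta=\partial_\theta v^z\equiv0$. *)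

theory Defs
  imports "HOL-Analysis.Analysis" "HOL-Probability.Essential_Supremum"
begin

definition Omega :: "real \<Rightarrow> real \<Rightarrow> (real ^ 3) set" where
  "Omega R1 R2 = {x. R1 < sqrt ((x $ 1)\<^sup>2 + (x $ 2)\<^sup>2) \<and> sqrt ((x $ 1)\<^sup>2 + (x $ 2)\<^sup>2) < R2}"

definition e_r :: "real \<Rightarrow> real ^ 3" where
  "e_r \<theta> = vector [cos \<theta>, sin \<theta>, 0]"

definition e_theta :: "real \<Rightarrow> real ^ 3" where
  "e_theta \<theta> = vector [- sin \<theta>, cos \<theta>, 0]"

definition e_z :: "real ^ 3" where
  "e_z = vector [0, 0, 1]"

definition cyl :: "real \<Rightarrow> real \<Rightarrow> real \<Rightarrow> real ^ 3" where
  "cyl r \<theta> z = vector [r * cos \<theta>, r * sin \<theta>, z]"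

definition Linf_norm :: "(real ^ 3) set \<Rightarrow> (real ^ 3 \<Rightarrow> real ^ 3) \<Rightarrow> ereal" where
  "Linf_norm S v = esssup (lebesgue_on S) (\<lambda>x. ereal (norm (v x)))"

text \<open>
  Differentiability classes relative to a set \<open>S\<close>. All derivatives are taken within \<open>S\<close>, so for
  the closed slab used below (convex with nonempty interior, hence with unique derivatives)
  membership for all \<open>k\<close> means smoothness up to the boundary. The components
  \<open>\<lambda>x. f' x h\<close> of the derivative are again required to be in the class of one order less.
\<close>

primrec Ck_on :: "nat \<Rightarrow> 'a::real_normed_vector set \<Rightarrow> ('a \<Rightarrow> 'b::real_normed_vector) \<Rightarrow> bool" where
  "Ck_on 0 S f \<longleftrightarrow> continuous_on S f"
| "Ck_on (Suc k) S f \<longleftrightarrow>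
     (\<exists>f'. (\<forall>x\<in>S. (f has_derivative f' x) (at x within S)) \<and> (\<forall>h. Ck_on k S (\<lambda>x. f' x h)))"

definition smooth_on :: "'a::real_normed_vector set \<Rightarrow> ('a \<Rightarrow> 'b::real_normed_vector) \<Rightarrow> bool" where
  "smooth_on S f \<longleftrightarrow> (\<forall>k. Ck_on k S f)"

text \<open>
  Scalar functions on the closure of \<open>\<Omega>\<close> are given in cylindrical coordinates, as curried
  functions of \<open>r \<theta> z\<close>. Since \<open>R1 > 0\<close>, smoothness in these coordinates together with
  periodicity in \<open>\<theta>\<close> is smoothness on the closure of \<open>\<Omega>\<close>.
\<close>

type_synonym cyl_fun = "real \<Rightarrow> real \<Rightarrow> real \<Rightarrow> real"

definition smooth_up_to_boundary :: "real \<Rightarrow> real \<Rightarrow> cyl_fun \<Rightarrow> bool" where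
  "smooth_up_to_boundary R1 R2 f \<longleftrightarrow>
     smooth_on ({R1..R2} \<times> UNIV \<times> UNIV) (\<lambda>(r, \<theta>, z). f r \<theta> z)"

definition theta_periodic :: "real \<Rightarrow> real \<Rightarrow> cyl_fun \<Rightarrow> bool" where
  "theta_periodic R1 R2 f \<longleftrightarrow> (\<forall>r\<in>{R1..R2}. \<forall>\<theta> z. f r (\<theta> + 2 * pi) z = f r \<theta> z)"

definition d_r :: "cyl_fun \<Rightarrow> cyl_fun" where
  "d_r f = (\<lambda>r \<theta> z. deriv (\<lambda>s. f s \<theta> z) r)"

definition d_theta :: "cyl_fun \<Rightarrow> cyl_fun" where
  "d_theta f = (\<lambda>r \<theta> z. deriv (\<lambda>s. f r s z) \<theta>)"

definition d_z :: "cyl_fun \<Rightarrow> cyl_fun" where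
  "d_z f = (\<lambda>r \<theta> z. deriv (\<lambda>s. f r \<theta> s) z)"

definition advect :: "cyl_fun \<Rightarrow> cyl_fun \<Rightarrow> cyl_fun \<Rightarrow> cyl_fun \<Rightarrow> cyl_fun" where
  "advect vr vt vz f = (\<lambda>r \<theta> z.
     vr r \<theta> z * d_r f r \<theta> z + vt r \<theta> z / r * d_theta f r \<theta> z + vz r \<theta> z * d_z f r \<theta> z)"

definition laplace :: "cyl_fun \<Rightarrow> cyl_fun" where
  "laplace f = (\<lambda>r \<theta> z.
     d_r (d_r f) r \<theta> z + 1 / r * d_r f r \<theta> z + 1 / r\<^sup>2 * d_theta (d_theta f) r \<theta> z
     + d_z (d_z f) r \<theta> z)"

definition stationary_NS ::
    "real \<Rightarrow> real \<Rightarrow> real \<Rightarrow> cyl_fun \<Rightarrow> cyl_fun \<Rightarrow> cyl_fun \<Rightarrow> cyl_fun \<Rightarrow> bool" where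
  "stationary_NS \<nu> R1 R2 vr vt vz p \<longleftrightarrow> (\<forall>r \<theta> z. R1 < r \<and> r < R2 \<longrightarrow>
     advect vr vt vz vr r \<theta> z - (vt r \<theta> z)\<^sup>2 / r + d_r p r \<theta> z
       = \<nu> * (laplace vr r \<theta> z - 1 / r\<^sup>2 * vr r \<theta> z) - \<nu> * (2 / r\<^sup>2) * d_theta vt r \<theta> z \<and>
     advect vr vt vz vt r \<theta> z + vr r \<theta> z * vt r \<theta> z / r + 1 / r * d_theta p r \<theta> z
       = \<nu> * (laplace vt r \<theta> z - 1 / r\<^sup>2 * vt r \<theta> z) + \<nu> * (2 / r\<^sup>2) * d_theta vr r \<theta> z \<and>
     advect vr vt vz vz r \<theta> z + d_z p r \<theta> z = \<nu> * laplace vz r \<theta> z \<and>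
     1 / r * d_r (\<lambda>s \<phi> y. s * vr s \<phi> y) r \<theta> z + 1 / r * d_theta vt r \<theta> z + d_z vz r \<theta> z = 0)"

definition boundary_conditions ::
    "real \<Rightarrow> real \<Rightarrow> real \<Rightarrow> real \<Rightarrow> cyl_fun \<Rightarrow> cyl_fun \<Rightarrow> cyl_fun \<Rightarrow> bool" where
  "boundary_conditions R1 R2 \<omega>1 \<omega>2 vr vt vz \<longleftrightarrow> (\<forall>\<theta> z.
     vr R1 \<theta> z = 0 \<and> vr R2 \<theta> z = 0 \<and> vz R1 \<theta> z = 0 \<and> vz R2 \<theta> z = 0 \<and>
     vt R1 \<theta> z = R1 * \<omega>1 \<and> vt R2 \<theta> z = R2 * \<omega>2)"

definition has_cyl_components ::
    "real \<Rightarrow> real \<Rightarrow> (real ^ 3 \<Rightarrow> real ^ 3) \<Rightarrow> cyl_fun \<Rightarrow> cyl_fun \<Rightarrow> cyl_fun \<Rightarrow> bool" where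
  "has_cyl_components R1 R2 v vr vt vz \<longleftrightarrow> (\<forall>r \<theta> z. R1 < r \<and> r < R2 \<longrightarrow>
     v (cyl r \<theta> z) = vr r \<theta> z *\<^sub>R e_r \<theta> + vt r \<theta> z *\<^sub>R e_theta \<theta> + vz r \<theta> z *\<^sub>R e_z)"

end

(*
For an angle phi let u(r, theta, z) = v(r, theta + phi, z) - v(r, theta, z). It solves the Stokes system
with forcing -div f, where |f| <= C |v|_inf |u|, it vanishes on the cylinders, and it has mean zero in
theta.

The energy identity is localised to a window |z - a| <= l by testing with eta u plus a corrector
that restores incompressibility, so that the pressure, of which no bound is known as z tends to
infinity, never enters. The corrector is built from fluxes of u and their theta-primitives, and only u and
d_theta u occur in its gradient. This gives
  int |grad u|^2 (half window) <= K int |f|^2 + K / l^2 int (|u|^2 + |d_theta u|^2) (window).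
As no bound on the derivatives of v is assumed, u is first replaced by its averages over small
rotations: then d_theta u is bounded, the supremum over a of the local energies is finite, and for a
large fixed l the last term is absorbed by Poincare's inequality. Letting the averaging length
tend to 0 yields sup_a int |u|^2 <= K' |v|_inf^2 sup_a int |u|^2, hence u = 0 if v is small.
Finally d_theta p is independent of theta by the second equation, and p is periodic.
*)
theory Submission
  imports Defs
begin

text \<open>How the corrector is found: truncating by \<open>\<eta>\<close> creates the divergence
  \<eta>' u_z. The radial field -\<eta>' G / r, with G the flux between R1 and r, cancels it but
  need not vanish at R2. Replacing G by G - \<beta> q, with q the full flux and \<beta>(r) rising
  from 0 to 1, repairs this and leaves the divergence \<eta>' \<beta>' q / r, which the angular
  field -\<eta>' \<beta>' Q with d_theta Q = q removes. Q is periodic because u_z has mean zero in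
  theta, a property that differences of rotations have and v itself need not have. Incompressibility
  trades the z-derivatives of the fluxes for theta-derivatives, the only ones that averaging over
  rotations controls. Where smallness comes from: the energy estimate, the absorption and Poincare's
  inequality cost 4 M^2 * 16 M^2 / \<nu>^2, where M dominates the geometry, and the quadratic stress
  costs 12 K^2 when the components of v are bounded by K. With K = \<nu> / (40 M^2) the product is
  0.48, so a supremum s satisfies s <= s / 2.\<close>

declare One_nat_def [simp del]

subsection \<open>Partial derivatives and integrals over boxes\<close>

type_synonym pt = "real \<times> real \<times> real"

text \<open>The coordinates r, theta, z and the cylindrical components of a field are both numbered
  0, 1, 2, so that gradients become families indexed by \<open>d\<close> and \<open>i\<close> below
  3. The index \<open>1\<close> must survive simplification, hence \<open>One_nat_def\<close> is
  switched off.\<close>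

definition co :: "nat \<Rightarrow> pt \<Rightarrow> real" where
  "co d x = (if d = 0 then fst x else if d = 1 then fst (snd x) else snd (snd x))"

definition upd :: "nat \<Rightarrow> pt \<Rightarrow> real \<Rightarrow> pt" where
  "upd d x s = (if d = 0 then (s, snd x) else if d = 1 then (fst x, s, snd (snd x))
     else (fst x, fst (snd x), s))"

text \<open>The derivative is taken within \<open>X\<close>, hence is one-sided at the boundary of a box or slab.\<close>

definition pd :: "pt set \<Rightarrow> nat \<Rightarrow> (pt \<Rightarrow> real) \<Rightarrow> (pt \<Rightarrow> real) \<Rightarrow> bool" where
  "pd X d f f' \<longleftrightarrow> continuous_on X f \<and> continuous_on X f' \<and>
     (\<forall>x\<in>X. ((\<lambda>s. f (upd d x s)) has_real_derivative f' x) (at (co d x) within {s. upd d x s \<in> X}))"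

lemma upd_co [simp]: "upd d x (co d x) = x"
  by (simp add: upd_def co_def)

lemma co_upd [simp]: "d < 3 \<Longrightarrow> k < 3 \<Longrightarrow> co k (upd d x s) = (if k = d then s else co k x)"
  by (auto simp: upd_def co_def)

lemma continuous_on_co [continuous_intros]: "continuous_on X (co d)"
  unfolding co_def by (cases "d = 0"; cases "d = 1") (auto intro!: continuous_intros)

lemma pdD1: "pd X d f f' \<Longrightarrow> continuous_on X f" and pdD2: "pd X d f f' \<Longrightarrow> continuous_on X f'"
  by (auto simp: pd_def)

lemma pdD: "pd X d f f' \<Longrightarrow> x \<in> X \<Longrightarrow>
    ((\<lambda>s. f (upd d x s)) has_real_derivative f' x) (at (co d x) within {s. upd d x s \<in> X})"
  by (auto simp: pd_def)

lemma pd_subset: "pd X d f f' \<Longrightarrow> Y \<subseteq> X \<Longrightarrow> pd Y d f f'"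
  unfolding pd_def by (blast intro: continuous_on_subset DERIV_subset)

lemma pd_const: "pd X d (\<lambda>x. c) (\<lambda>x. 0)"
  unfolding pd_def by auto

lemma pd_add: "pd X d f f' \<Longrightarrow> pd X d g g' \<Longrightarrow> pd X d (\<lambda>x. f x + g x) (\<lambda>x. f' x + g' x)"
  unfolding pd_def by (auto intro!: continuous_intros derivative_eq_intros)

lemma pd_diff: "pd X d f f' \<Longrightarrow> pd X d g g' \<Longrightarrow> pd X d (\<lambda>x. f x - g x) (\<lambda>x. f' x - g' x)"
  unfolding pd_def by (auto intro!: continuous_intros derivative_eq_intros)

lemma pd_mult: "pd X d f f' \<Longrightarrow> pd X d g g' \<Longrightarrow> pd X d (\<lambda>x. f x * g x) (\<lambda>x. f' x * g x + f x * g' x)"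
  unfolding pd_def by (auto intro!: continuous_intros derivative_eq_intros)

lemma pd_cmult: "pd X d f f' \<Longrightarrow> pd X d (\<lambda>x. c * f x) (\<lambda>x. c * f' x)"
  unfolding pd_def by (auto intro!: continuous_intros derivative_eq_intros)

lemma pd_fun_same:
  assumes "d < 3" "continuous_on (co d ` X) g'"
    and "\<And>s. s \<in> co d ` X \<Longrightarrow> (g has_real_derivative g' s) (at s)"
  shows "pd X d (\<lambda>x. g (co d x)) (\<lambda>x. g' (co d x))"
proof -
  have "continuous_on (co d ` X) g"
    using assms(3) by (meson DERIV_isCont continuous_at_imp_continuous_on)
  then have "continuous_on X (\<lambda>x. g (co d x))" "continuous_on X (\<lambda>x. g' (co d x))"
    using assms(2) by (auto intro!: continuous_on_compose2[OF _ continuous_on_co])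
  then show ?thesis
    using assms(1,3) unfolding pd_def by (auto intro: has_field_derivative_at_within)
qed

lemma pd_fun_other:
  assumes "d < 3" "k < 3" "k \<noteq> d" "continuous_on (co k ` X) g"
  shows "pd X d (\<lambda>x. g (co k x)) (\<lambda>x. 0)"
proof -
  have "continuous_on X (\<lambda>x. g (co k x))"
    using assms(4) by (auto intro!: continuous_on_compose2[OF _ continuous_on_co])
  then show ?thesis
    using assms(1-3) unfolding pd_def by auto
qed

lemma pd_cong:
  assumes "pd X d f f'" "\<And>x. x \<in> X \<Longrightarrow> f x = g x" "\<And>x. x \<in> X \<Longrightarrow> f' x = g' x"
  shows "pd X d g g'"
proof -
  have "((\<lambda>s. g (upd d x s)) has_real_derivative g' x) (at (co d x) within {s. upd d x s \<in> X})"
    if "x \<in> X" for x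
    using has_field_derivative_transform_within[OF pdD[OF assms(1) that], of 1 "\<lambda>s. g (upd d x s)"]
      assms(2,3) that by auto
  moreover have "continuous_on X g" "continuous_on X g'"
    using pdD1[OF assms(1)] pdD2[OF assms(1)] assms(2,3) by (auto cong: continuous_on_cong)
  ultimately show ?thesis
    by (auto simp: pd_def)
qed

abbreviation box3 :: "real \<Rightarrow> real \<Rightarrow> real \<Rightarrow> real \<Rightarrow> real \<Rightarrow> real \<Rightarrow> pt set" where
  "box3 a b c d e f \<equiv> cbox (a, c, e) (b, d, f)"

abbreviation window :: "real \<Rightarrow> real \<Rightarrow> real \<Rightarrow> real \<Rightarrow> pt set" where
  "window R1 R2 a l \<equiv> box3 R1 R2 0 (2 * pi) (a - l) (a + l)"

lemma mem_box3: "(r, \<theta>, z) \<in> box3 a b c d e f \<longleftrightarrow>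
    a \<le> r \<and> r \<le> b \<and> c \<le> \<theta> \<and> \<theta> \<le> d \<and> e \<le> z \<and> z \<le> f"
  by (auto simp: cbox_Pair_iff)

lemma mem_box3': "x \<in> box3 a b c d e f \<longleftrightarrow>
    a \<le> co 0 x \<and> co 0 x \<le> b \<and> c \<le> co 1 x \<and> co 1 x \<le> d \<and> e \<le> co 2 x \<and> co 2 x \<le> f"
  by (cases x) (auto simp: mem_box3 co_def)

lemma cont_box3_23:
  fixes f :: "pt \<Rightarrow> 'b::topological_space"
  assumes "continuous_on (box3 a b c d e g) f" "r \<in> {a..b}"
  shows "continuous_on (cbox (c, e) (d, g)) (\<lambda>y. f (r, y))"
  by (rule continuous_on_compose2[OF assms(1)]) (use assms(2) in \<open>auto intro!: continuous_intros simp: cbox_Pair_iff\<close>)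

lemma pd_line:
  assumes "pd (box3 a b c d e g) k f f'" "(r, \<theta>, z) \<in> box3 a b c d e g"
  shows "k = 0 \<Longrightarrow> ((\<lambda>s. f (s, \<theta>, z)) has_real_derivative f' (r, \<theta>, z)) (at r within {a..b})"
    "k = 1 \<Longrightarrow> ((\<lambda>s. f (r, s, z)) has_real_derivative f' (r, \<theta>, z)) (at \<theta> within {c..d})"
    "k = 2 \<Longrightarrow> ((\<lambda>s. f (r, \<theta>, s)) has_real_derivative f' (r, \<theta>, z)) (at z within {e..g})"
  using pdD[OF assms] assms(2)
  by (auto simp: upd_def co_def mem_box3 elim!: DERIV_subset)

lemma ftc_real:
  fixes f :: "real \<Rightarrow> real"
  assumes "a \<le> b" "\<And>x. x \<in> {a..b} \<Longrightarrow> (f has_real_derivative f' x) (at x within {a..b})"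
  shows "integral {a..b} f' = f b - f a"
  by (rule integral_unique[OF fundamental_theorem_of_calculus])
    (use assms in \<open>auto simp: has_real_derivative_iff_has_vector_derivative\<close>)

text \<open>Fubini with the radial integral innermost. The two variants that follow put the angular
  and the axial integral innermost, so that each partial derivative can be integrated along its own
  line.\<close>

lemma integral_box3_r:
  fixes f :: "pt \<Rightarrow> real"
  assumes "continuous_on (box3 a b c d e g) f"
  shows "integral (box3 a b c d e g) f = integral (cbox (c, e) (d, g)) (\<lambda>y. integral {a..b} (\<lambda>r. f (r, y)))"
proof -
  have "integral (box3 a b c d e g) f = integral (cbox a b) (\<lambda>r. integral (cbox (c, e) (d, g)) (\<lambda>y. f (r, y)))"
    by (rule integral_prod_continuous[OF assms])
  also have "\<dots> = integral (cbox (c, e) (d, g)) (\<lambda>y. integral (cbox a b) (\<lambda>r. f (r, y)))"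
    by (rule integral_swap_continuous) (use assms in simp)
  finally show ?thesis by simp
qed

lemma integral_box3_rz\<theta>:
  fixes f :: "pt \<Rightarrow> real"
  assumes "continuous_on (box3 a b c d e g) f"
  shows "integral (box3 a b c d e g) f =
    integral {a..b} (\<lambda>r. integral {e..g} (\<lambda>z. integral {c..d} (\<lambda>\<theta>. f (r, \<theta>, z))))"
proof -
  have "integral (box3 a b c d e g) f = integral (cbox a b) (\<lambda>r. integral (cbox (c, e) (d, g)) (\<lambda>y. f (r, y)))"
    by (rule integral_prod_continuous[OF assms])
  also have "\<dots> = integral (cbox a b) (\<lambda>r. integral {e..g} (\<lambda>z. integral {c..d} (\<lambda>\<theta>. f (r, \<theta>, z))))"
  proof (rule integral_cong)
    fix r assume r: "r \<in> cbox a b"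
    have 1: "continuous_on (cbox (c, e) (d, g)) (\<lambda>y. f (r, y))"
      by (rule cont_box3_23[OF assms]) (use r in auto)
    show "integral (cbox (c, e) (d, g)) (\<lambda>y. f (r, y)) = integral {e..g} (\<lambda>z. integral {c..d} (\<lambda>\<theta>. f (r, \<theta>, z)))"
      using integral_prod_continuous[OF 1] integral_swap_continuous[of c e d g "\<lambda>\<theta> z. f (r, \<theta>, z)"] 1
      by (simp add: case_prod_beta)
  qed
  finally show ?thesis by simp
qed

lemma integral_box3_r\<theta>z:
  fixes f :: "pt \<Rightarrow> real"
  assumes "continuous_on (box3 a b c d e g) f"
  shows "integral (box3 a b c d e g) f =
    integral {a..b} (\<lambda>r. integral {c..d} (\<lambda>\<theta>. integral {e..g} (\<lambda>z. f (r, \<theta>, z))))"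
proof -
  have "integral (box3 a b c d e g) f = integral (cbox a b) (\<lambda>r. integral (cbox (c, e) (d, g)) (\<lambda>y. f (r, y)))"
    by (rule integral_prod_continuous[OF assms])
  also have "\<dots> = integral (cbox a b) (\<lambda>r. integral {c..d} (\<lambda>\<theta>. integral {e..g} (\<lambda>z. f (r, \<theta>, z))))"
    by (rule integral_cong) (simp add: integral_prod_continuous[OF cont_box3_23[OF assms]])
  finally show ?thesis by simp
qed

text \<open>Divergence theorem for one direction. Asking only for equal values on opposite faces,
  here and in the two companions, covers zero boundary values and periodicity in the angle
  alike.\<close>

lemma integral_pd_0:
  assumes "pd (box3 a b c d e g) 0 f f'" "a \<le> b"
    and "\<And>\<theta> z. (b, \<theta>, z) \<in> box3 a b c d e g \<Longrightarrow> f (b, \<theta>, z) = f (a, \<theta>, z)"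
  shows "integral (box3 a b c d e g) f' = 0"
proof -
  have "integral {a..b} (\<lambda>r. f' (r, y)) = 0" if "y \<in> cbox (c, e) (d, g)" for y
  proof -
    obtain \<theta> z where y: "y = (\<theta>, z)" by (cases y)
    then have "integral {a..b} (\<lambda>r. f' (r, \<theta>, z)) = f (b, \<theta>, z) - f (a, \<theta>, z)"
      by (intro ftc_real pd_line(1)[OF assms(1)] assms(2)) (use that in \<open>auto simp: cbox_Pair_iff\<close>)
    then show ?thesis using assms(2,3) y that by (auto simp: cbox_Pair_iff)
  qed
  then show ?thesis
    using integral_box3_r[OF pdD2[OF assms(1)]] by (simp cong: integral_cong)
qed

lemma integral_pd_1:
  assumes "pd (box3 a b c d e g) 1 f f'" "c \<le> d"
    and "\<And>r z. (r, d, z) \<in> box3 a b c d e g \<Longrightarrow> f (r, d, z) = f (r, c, z)"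
  shows "integral (box3 a b c d e g) f' = 0"
proof -
  have "integral {c..d} (\<lambda>\<theta>. f' (r, \<theta>, z)) = 0" if "r \<in> {a..b}" "z \<in> {e..g}" for r z
  proof -
    have "integral {c..d} (\<lambda>\<theta>. f' (r, \<theta>, z)) = f (r, d, z) - f (r, c, z)"
      by (intro ftc_real pd_line(2)[OF assms(1)] assms(2)) (use that in \<open>auto simp: mem_box3\<close>)
    then show ?thesis using assms(2,3) that by (auto simp: mem_box3)
  qed
  then have "integral {a..b} (\<lambda>r. integral {e..g} (\<lambda>z. integral {c..d} (\<lambda>\<theta>. f' (r, \<theta>, z))))
      = integral {a..b} (\<lambda>r. integral {e..g} (\<lambda>z. 0))"
    by (intro integral_cong) auto
  then show ?thesis
    using integral_box3_rz\<theta>[OF pdD2[OF assms(1)]] by simp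
qed

lemma integral_pd_2:
  assumes "pd (box3 a b c d e g) 2 f f'" "e \<le> g"
    and "\<And>r \<theta>. (r, \<theta>, g) \<in> box3 a b c d e g \<Longrightarrow> f (r, \<theta>, g) = f (r, \<theta>, e)"
  shows "integral (box3 a b c d e g) f' = 0"
proof -
  have "integral {e..g} (\<lambda>z. f' (r, \<theta>, z)) = 0" if "r \<in> {a..b}" "\<theta> \<in> {c..d}" for r \<theta>
  proof -
    have "integral {e..g} (\<lambda>z. f' (r, \<theta>, z)) = f (r, \<theta>, g) - f (r, \<theta>, e)"
      by (intro ftc_real pd_line(3)[OF assms(1)] assms(2)) (use that in \<open>auto simp: mem_box3\<close>)
    then show ?thesis using assms(2,3) that by (auto simp: mem_box3)
  qed
  then have "integral {a..b} (\<lambda>r. integral {c..d} (\<lambda>\<theta>. integral {e..g} (\<lambda>z. f' (r, \<theta>, z))))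
      = integral {a..b} (\<lambda>r. integral {c..d} (\<lambda>\<theta>. 0))"
    by (intro integral_cong) auto
  then show ?thesis
    using integral_box3_r\<theta>z[OF pdD2[OF assms(1)]] by simp
qed

lemma pd_cong': "pd X d f f' \<Longrightarrow> (\<And>x. x \<in> X \<Longrightarrow> f' x = g' x) \<Longrightarrow> pd X d f g'"
  by (erule pd_cong) simp_all

lemmas pd_intros = pd_add pd_diff pd_mult pd_const

text \<open>Components of the gradient of \<open>u\<close> in the cylindrical frame; the extra terms for \<open>d = 1\<close>
  come from the \<open>\<theta>\<close>-derivatives of the frame vectors.\<close>

definition tens :: "real \<Rightarrow> (nat \<Rightarrow> real) \<Rightarrow> (nat \<Rightarrow> nat \<Rightarrow> real) \<Rightarrow> nat \<Rightarrow> nat \<Rightarrow> real" where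
  "tens r u du d i =
     (if d = 1 then (du 1 i + (if i = 0 then - u 1 else if i = 1 then u 0 else 0)) / r else du d i)"

lemma sum3: "(\<Sum>i<3. f i) = f 0 + f 1 + f (2::nat)"
  by (simp add: numeral_3_eq_3 numeral_2_eq_2 One_nat_def)

text \<open>Residuals of the momentum equations at a point; \<open>dv d i\<close> and \<open>d2v d i\<close> are the first and second
  derivative of component \<open>i\<close> along coordinate \<open>d\<close>.\<close>

definition res0 :: "real \<Rightarrow> real \<Rightarrow> (nat \<Rightarrow> real) \<Rightarrow> (nat \<Rightarrow> nat \<Rightarrow> real) \<Rightarrow> (nat \<Rightarrow> nat \<Rightarrow> real) \<Rightarrow> (nat \<Rightarrow> real) \<Rightarrow> real" where
  "res0 \<nu> r v dv d2v dp = v 0 * dv 0 0 + v 1 / r * dv 1 0 + v 2 * dv 2 0 - (v 1)\<^sup>2 / r + dp 0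
     - (\<nu> * (d2v 0 0 + 1 / r * dv 0 0 + 1 / r\<^sup>2 * d2v 1 0 + d2v 2 0 - 1 / r\<^sup>2 * v 0) - \<nu> * (2 / r\<^sup>2) * dv 1 1)"

definition res1 :: "real \<Rightarrow> real \<Rightarrow> (nat \<Rightarrow> real) \<Rightarrow> (nat \<Rightarrow> nat \<Rightarrow> real) \<Rightarrow> (nat \<Rightarrow> nat \<Rightarrow> real) \<Rightarrow> (nat \<Rightarrow> real) \<Rightarrow> real" where
  "res1 \<nu> r v dv d2v dp = v 0 * dv 0 1 + v 1 / r * dv 1 1 + v 2 * dv 2 1 + v 0 * v 1 / r + 1 / r * dp 1
     - (\<nu> * (d2v 0 1 + 1 / r * dv 0 1 + 1 / r\<^sup>2 * d2v 1 1 + d2v 2 1 - 1 / r\<^sup>2 * v 1) + \<nu> * (2 / r\<^sup>2) * dv 1 0)"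

definition res2 :: "real \<Rightarrow> real \<Rightarrow> (nat \<Rightarrow> real) \<Rightarrow> (nat \<Rightarrow> nat \<Rightarrow> real) \<Rightarrow> (nat \<Rightarrow> nat \<Rightarrow> real) \<Rightarrow> (nat \<Rightarrow> real) \<Rightarrow> real" where
  "res2 \<nu> r v dv d2v dp = v 0 * dv 0 2 + v 1 / r * dv 1 2 + v 2 * dv 2 2 + dp 2
     - \<nu> * (d2v 0 2 + 1 / r * dv 0 2 + 1 / r\<^sup>2 * d2v 1 2 + d2v 2 2)"

text \<open>With A_d = p w_d + sum over i of (v_d v_i - \<nu> (grad v)_di) w_i, the left side is the
  product-rule expansion of d_r (r A_r) + d_theta A_theta + r d_z A_z. It integrates to zero for
  admissible \<open>w\<close>, which turns the identity into the weak form.\<close>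

lemma weak_identity:
  fixes r :: real
  assumes r: "r \<noteq> 0"
    and e0: "res0 \<nu> r v dv d2v dp = 0" and e1: "res1 \<nu> r v dv d2v dp = 0" and e2: "res2 \<nu> r v dv d2v dp = 0"
    and dv: "v 0 + r * dv 0 0 + dv 1 1 + r * dv 2 2 = 0"
    and dw: "w 0 + r * dw 0 0 + dw 1 1 + r * dw 2 2 = 0"
  shows "(((v 0 * v 0 - \<nu> * dv 0 0) * w 0 + (v 0 * v 1 - \<nu> * dv 0 1) * w 1 + (v 0 * v 2 - \<nu> * dv 0 2) * w 2 + p * w 0)
     + r * ((dv 0 0 * v 0 + v 0 * dv 0 0 - \<nu> * d2v 0 0) * w 0 + (v 0 * v 0 - \<nu> * dv 0 0) * dw 0 0
          + (dv 0 0 * v 1 + v 0 * dv 0 1 - \<nu> * d2v 0 1) * w 1 + (v 0 * v 1 - \<nu> * dv 0 1) * dw 0 1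
          + (dv 0 0 * v 2 + v 0 * dv 0 2 - \<nu> * d2v 0 2) * w 2 + (v 0 * v 2 - \<nu> * dv 0 2) * dw 0 2
          + dp 0 * w 0 + p * dw 0 0))
   + ((dv 1 1 * v 0 + v 1 * dv 1 0 - \<nu> * (1/r) * (d2v 1 0 - dv 1 1)) * w 0 + (v 1 * v 0 - \<nu> * (1/r) * (dv 1 0 - v 1)) * dw 1 0
     + (dv 1 1 * v 1 + v 1 * dv 1 1 - \<nu> * (1/r) * (d2v 1 1 + dv 1 0)) * w 1 + (v 1 * v 1 - \<nu> * (1/r) * (dv 1 1 + v 0)) * dw 1 1
     + (dv 1 1 * v 2 + v 1 * dv 1 2 - \<nu> * (1/r) * d2v 1 2) * w 2 + (v 1 * v 2 - \<nu> * (1/r) * dv 1 2) * dw 1 2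
     + dp 1 * w 1 + p * dw 1 1)
   + r * ((dv 2 2 * v 0 + v 2 * dv 2 0 - \<nu> * d2v 2 0) * w 0 + (v 2 * v 0 - \<nu> * dv 2 0) * dw 2 0
     + (dv 2 2 * v 1 + v 2 * dv 2 1 - \<nu> * d2v 2 1) * w 1 + (v 2 * v 1 - \<nu> * dv 2 1) * dw 2 1
     + (dv 2 2 * v 2 + v 2 * dv 2 2 - \<nu> * d2v 2 2) * w 2 + (v 2 * v 2 - \<nu> * dv 2 2) * dw 2 2
     + dp 2 * w 2 + p * dw 2 2)
   = - (r * (\<Sum>d<3. \<Sum>i<3. (\<nu> * tens r v dv d i - v d * v i) * tens r w dw d i))" (is "?L = ?R")
proof -
  \<comment> \<open>The two sides differ by multiples of the equations only: the residuals are
    tested with \<open>w\<close>, the divergence of \<open>v\<close> appears because convection is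
    written in divergence form, and that of \<open>w\<close> is the factor of the pressure.\<close>
  have "?L - ?R = r * (w 0 * res0 \<nu> r v dv d2v dp + w 1 * res1 \<nu> r v dv d2v dp + w 2 * res2 \<nu> r v dv d2v dp)
      + (v 0 * w 0 + v 1 * w 1 + v 2 * w 2) * (v 0 + r * dv 0 0 + dv 1 1 + r * dv 2 2)
      + p * (w 0 + r * dw 0 0 + dw 1 1 + r * dw 2 2)"
    unfolding res0_def res1_def res2_def sum3 tens_def using r
    by (simp add: field_simps power2_eq_square)
  then show ?thesis using e0 e1 e2 dv dw by simp
qed

subsection \<open>Partial integrals\<close>

lemma upd_upd_same [simp]: "upd d (upd d x t) s = upd d x s"
  by (simp add: upd_def)

lemma co_upd_same [simp]: "co d (upd d x s) = s"
  by (simp add: upd_def co_def)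

lemma upd_commute: "d < 3 \<Longrightarrow> k < 3 \<Longrightarrow> k \<noteq> d \<Longrightarrow> upd k (upd d x t) s = upd d (upd k x s) t"
  by (auto simp: upd_def)

lemma continuous_on_upd [continuous_intros]:
  "continuous_on S f \<Longrightarrow> continuous_on S g \<Longrightarrow> continuous_on S (\<lambda>x. upd d (f x) (g x))"
  unfolding upd_def by (cases "d = 0"; cases "d = 1") (auto intro!: continuous_intros)

lemma integral_subst_unit:
  fixes f :: "real \<Rightarrow> real"
  assumes "l \<le> s" "continuous_on {l..s} f"
  shows "integral {l..s} f = (s - l) * integral {0..1} (\<lambda>t. f (l + t * (s - l)))"
proof -
  have sub: "(\<lambda>t. l + t * (s - l)) ` {0..1} \<subseteq> {l..s}"
  proof (intro image_subsetI)
    fix t :: real assume t: "t \<in> {0..1}"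
    have "t * (s - l) \<le> 1 * (s - l)" "0 \<le> t * (s - l)"
      using assms(1) t by (intro mult_right_mono mult_nonneg_nonneg; simp)+
    then show "l + t * (s - l) \<in> {l..s}" by simp
  qed
  have "((\<lambda>t. (s - l) *\<^sub>R f (l + t * (s - l))) has_integral
      integral {l + 0 * (s - l)..l + 1 * (s - l)} f) {0..1}"
    by (rule has_integral_substitution[of _ _ _ l s]) (use assms sub in \<open>auto intro!: derivative_eq_intros\<close>)
  then have "integral {0..1} (\<lambda>t. (s - l) * f (l + t * (s - l))) = integral {l..s} f"
    by (intro integral_unique) simp
  then show ?thesis by simp
qed

definition prim :: "nat \<Rightarrow> real \<Rightarrow> (pt \<Rightarrow> real) \<Rightarrow> pt \<Rightarrow> real" where
  "prim d l f x = integral {l..co d x} (\<lambda>s. f (upd d x s))"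

definition slice_int :: "nat \<Rightarrow> real \<Rightarrow> real \<Rightarrow> (pt \<Rightarrow> real) \<Rightarrow> pt \<Rightarrow> real" where
  "slice_int d l h f x = integral {l..h} (\<lambda>s. f (upd d x s))"

text \<open>All that primitives need of a box: each coordinate line through a point of
  \<open>X\<close> meets \<open>X\<close> in the same full interval. The lemmas below are then
  proved once for all three directions.\<close>

definition boxlike :: "pt set \<Rightarrow> (nat \<Rightarrow> real) \<Rightarrow> (nat \<Rightarrow> real) \<Rightarrow> bool" where
  "boxlike X L H \<longleftrightarrow> (\<forall>x\<in>X. \<forall>d<3. {s. upd d x s \<in> X} = {L d..H d})"

lemma boxlikeD: "boxlike X L H \<Longrightarrow> x \<in> X \<Longrightarrow> d < 3 \<Longrightarrow> {s. upd d x s \<in> X} = {L d..H d}"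
  by (simp add: boxlike_def)

lemma boxlike_mem: "boxlike X L H \<Longrightarrow> x \<in> X \<Longrightarrow> d < 3 \<Longrightarrow> upd d x s \<in> X \<longleftrightarrow> L d \<le> s \<and> s \<le> H d"
  using boxlikeD[of X L H x d] by auto

lemma boxlike_co: "boxlike X L H \<Longrightarrow> x \<in> X \<Longrightarrow> d < 3 \<Longrightarrow> L d \<le> co d x \<and> co d x \<le> H d"
  using boxlike_mem[of X L H x d "co d x"] by simp

lemma boxlike_box3:
  "boxlike (box3 a b c d e g) (\<lambda>k. if k = 0 then a else if k = 1 then c else e)
    (\<lambda>k. if k = 0 then b else if k = 1 then d else g)"
  unfolding boxlike_def mem_box3' less_Suc_eq numeral_3_eq_3
  by (auto simp: upd_def co_def One_nat_def split: if_splits)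

context
  fixes X :: "pt set" and L H :: "nat \<Rightarrow> real"
  assumes X: "boxlike X L H"
begin

lemma continuous_on_line:
  assumes "continuous_on X f" "x \<in> X" "d < 3"
  shows "continuous_on {L d..H d} (\<lambda>s. f (upd d x s) :: real)"
  by (rule continuous_on_compose2[OF assms(1)])
    (use boxlike_mem[OF X assms(2,3)] in \<open>auto intro!: continuous_intros\<close>)

text \<open>Rescaling to the unit interval moves the variable upper limit into the integrand, so
  that continuity of parameter integrals over a fixed domain applies.\<close>

lemma prim_eq_unit:
  assumes "continuous_on X f" "x \<in> X" "d < 3"
  shows "prim d (L d) f x =
    (co d x - L d) * integral (cbox 0 1) (\<lambda>t. f (upd d x (L d + t * (co d x - L d))))"
  unfolding prim_def cbox_interval
  by (rule integral_subst_unit)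
    (use boxlike_co[OF X assms(2,3)] in
      \<open>auto intro: continuous_on_subset[OF continuous_on_line[OF assms]]\<close>)

lemma upd_segment_mem:
  assumes "x \<in> X" "d < 3" "t \<in> {0..1}"
  shows "upd d x (L d + t * (co d x - L d)) \<in> X"
proof -
  have "t * (co d x - L d) \<le> 1 * (co d x - L d)" "0 \<le> t * (co d x - L d)"
    using boxlike_co[OF X assms(1,2)] assms(3) by (intro mult_right_mono mult_nonneg_nonneg; simp)+
  then show ?thesis
    using boxlike_mem[OF X assms(1,2)] boxlike_co[OF X assms(1,2)] by simp
qed

lemma continuous_on_prim:
  assumes f: "continuous_on X f" and d: "d < 3"
  shows "continuous_on X (prim d (L d) f)"
proof -
  have "continuous_on (X \<times> cbox 0 1) (\<lambda>y. f (upd d (fst y) (L d + snd y * (co d (fst y) - L d))))"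
    by (rule continuous_on_compose2[OF f])
      (auto intro!: continuous_intros continuous_on_compose2[OF continuous_on_co] upd_segment_mem d)
  then have "continuous_on X (\<lambda>x. (co d x - L d) *
      integral (cbox 0 1) (\<lambda>t. f (upd d x (L d + t * (co d x - L d)))))"
    by (intro continuous_intros integral_continuous_on_param) (simp add: case_prod_beta)
  then show ?thesis
    by (rule continuous_on_eq) (simp add: prim_eq_unit[OF f _ d])
qed

lemma pd_prim_same:
  assumes f: "continuous_on X f" and d: "d < 3"
  shows "pd X d (prim d (L d) f) f"
  unfolding pd_def
proof (intro conjI ballI continuous_on_prim assms)
  fix x assume x: "x \<in> X"
  have "((\<lambda>s. integral {L d..s} (\<lambda>t. f (upd d x t))) has_real_derivative f (upd d x (co d x)))
      (at (co d x) within {L d..H d})"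
    by (rule integral_has_real_derivative[OF continuous_on_line[OF f x d]])
      (use boxlike_co[OF X x d] in simp)
  then show "((\<lambda>s. prim d (L d) f (upd d x s)) has_real_derivative f x) (at (co d x) within {s. upd d x s \<in> X})"
    using d by (simp add: prim_def boxlikeD[OF X x d])
qed

lemma pd_prim_other:
  assumes f: "pd X k f f'" and d: "d < 3" and k: "k < 3" "k \<noteq> d"
  shows "pd X k (prim d (L d) f) (prim d (L d) f')"
  unfolding pd_def
proof (intro conjI ballI continuous_on_prim pdD1[OF f] pdD2[OF f] d)
  fix x assume x: "x \<in> X"
  let ?b = "co d x"
  have mem: "upd k (upd d x t) s \<in> X" if "s \<in> {L k..H k}" "t \<in> cbox (L d) ?b" for s t
    using that boxlike_mem[OF X x d] boxlike_co[OF X x d] boxlike_mem[OF X _ k(1), of "upd d x t"] by auto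
  have "((\<lambda>s. integral (cbox (L d) ?b) (\<lambda>t. f (upd k (upd d x t) s))) has_real_derivative
     integral (cbox (L d) ?b) (\<lambda>t. f' (upd k (upd d x t) (co k x)))) (at (co k x) within {L k..H k})"
  proof (rule leibniz_rule_field_derivative)
    fix s t assume st: "s \<in> {L k..H k}" "t \<in> cbox (L d) ?b"
    show "((\<lambda>s. f (upd k (upd d x t) s)) has_real_derivative f' (upd k (upd d x t) s)) (at s within {L k..H k})"
      using pdD[OF f mem[OF st]] boxlikeD[OF X mem[OF st] k(1)] k by simp
  next
    fix s assume s: "s \<in> {L k..H k}"
    show "(\<lambda>t. f (upd k (upd d x t) s)) integrable_on cbox (L d) ?b"
      by (intro integrable_continuous continuous_on_compose2[OF pdD1[OF f]] continuous_intros)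
        (use mem[OF s] in auto)
  next
    have "continuous_on ({L k..H k} \<times> cbox (L d) ?b) (\<lambda>y. f' (upd k (upd d x (snd y)) (fst y)))"
      by (intro continuous_on_compose2[OF pdD2[OF f]] continuous_intros) (use mem in auto)
    then show "continuous_on ({L k..H k} \<times> cbox (L d) ?b) (\<lambda>(s, t). f' (upd k (upd d x t) s))"
      by (simp add: case_prod_beta)
  qed (use boxlike_co[OF X x k(1)] in auto)
  then show "((\<lambda>s. prim d (L d) f (upd k x s)) has_real_derivative prim d (L d) f' x)
      (at (co k x) within {s. upd k x s \<in> X})"
    using d k by (simp add: prim_def boxlikeD[OF X x k(1)] upd_commute)
qed

lemma pd_slice_other:
  assumes f: "pd X k f f'" and "d < 3" "k < 3" "k \<noteq> d" and c: "c \<in> {L d..H d}"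
  shows "pd X k (\<lambda>x. f (upd d x c)) (\<lambda>x. f' (upd d x c))"
proof -
  have mem: "upd d x c \<in> X" if "x \<in> X" for x
    using boxlike_mem[OF X that \<open>d < 3\<close>] c by auto
  show ?thesis
    unfolding pd_def
  proof (intro conjI ballI)
    fix x assume x: "x \<in> X"
    show "((\<lambda>s. f (upd d (upd k x s) c)) has_real_derivative f' (upd d x c)) (at (co k x) within {s. upd k x s \<in> X})"
      using pdD[OF f mem[OF x]] assms(2-4) x mem[OF x]
      by (simp add: boxlikeD[OF X] upd_commute[of k d])
  qed (use mem in \<open>auto intro!: continuous_on_compose2[OF pdD1[OF f]] continuous_on_compose2[OF pdD2[OF f]] continuous_intros\<close>)
qed

lemma pd_slice_same:
  assumes f: "continuous_on X f" and d: "d < 3" and c: "c \<in> {L d..H d}"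
  shows "pd X d (\<lambda>x. f (upd d x c)) (\<lambda>x. 0)"
proof -
  have mem: "upd d x c \<in> X" if "x \<in> X" for x
    using boxlike_mem[OF X that d] c by auto
  have "continuous_on X (\<lambda>x. f (upd d x c))"
    by (intro continuous_on_compose2[OF f] continuous_intros) (use mem in auto)
  then show ?thesis by (auto simp: pd_def)
qed

lemma slice_int_prim: "slice_int d (L d) (H d) f = (\<lambda>x. prim d (L d) f (upd d x (H d)))"
  by (simp add: fun_eq_iff slice_int_def prim_def)

lemma upd_H_mem:
  assumes "x \<in> X" "d < 3"
  shows "upd d x (H d) \<in> X"
  using boxlike_mem[OF X assms] boxlike_co[OF X assms] by auto

lemma continuous_on_slice_int:
  assumes "continuous_on X f" "d < 3"
  shows "continuous_on X (slice_int d (L d) (H d) f)"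
proof -
  have "continuous_on X (\<lambda>x. prim d (L d) f (upd d x (H d)))"
    by (intro continuous_on_compose2[OF continuous_on_prim[OF assms]] continuous_intros image_subsetI)
      (rule upd_H_mem[OF _ assms(2)])
  then show ?thesis by (simp add: slice_int_prim)
qed

end

lemma square_integral_le:
  fixes f :: "real \<Rightarrow> real"
  assumes "l \<le> s" "s \<le> h" "continuous_on {l..h} f"
  shows "(integral {l..s} f)\<^sup>2 \<le> (h - l) * integral {l..h} (\<lambda>x. (f x)\<^sup>2)"
proof -
  have c: "continuous_on {l..s} f"
    using assms by (auto intro: continuous_on_subset)
  have i2: "(\<lambda>x. (f x)\<^sup>2) integrable_on {l..s}" "(\<lambda>x. (f x)\<^sup>2) integrable_on {l..h}"
    using assms(3) c by (auto intro!: integrable_continuous_real continuous_intros)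
  have i1: "f integrable_on {l..s}" by (rule integrable_continuous_real[OF c])
  have mono: "integral {l..s} (\<lambda>x. (f x)\<^sup>2) \<le> integral {l..h} (\<lambda>x. (f x)\<^sup>2)"
    by (rule integral_subset_le) (use assms i2 in auto)
  have nn: "0 \<le> integral {l..s} (\<lambda>x. (f x)\<^sup>2)"
    by (rule integral_nonneg[OF i2(1)]) simp
  have "(integral {l..s} f)\<^sup>2 \<le> (s - l) * integral {l..s} (\<lambda>x. (f x)\<^sup>2)"
  proof (cases "s = l")
    case False
    \<comment> \<open>The mean of \<open>f\<close>; integrating the square of \<open>f - m\<close>
      gives Cauchy-Schwarz against the constant function.\<close>
    define m where "m = integral {l..s} f / (s - l)"
    have "0 \<le> integral {l..s} (\<lambda>x. (f x)\<^sup>2 - 2 * m * f x + m\<^sup>2)"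
    proof (rule integral_nonneg)
      show "(\<lambda>x. (f x)\<^sup>2 - 2 * m * f x + m\<^sup>2) integrable_on {l..s}"
        using c by (auto intro!: integrable_continuous_real continuous_intros)
      show "0 \<le> (f x)\<^sup>2 - 2 * m * f x + m\<^sup>2" for x
        using zero_le_power2[of "f x - m"] by (simp add: power2_eq_square algebra_simps)
    qed
    also have "\<dots> = integral {l..s} (\<lambda>x. (f x)\<^sup>2) - 2 * m * integral {l..s} f + m\<^sup>2 * (s - l)"
    proof -
      have "(\<lambda>x. 2 * m * f x) integrable_on {l..s}"
        using c by (auto intro!: integrable_continuous_real continuous_intros)
      then show ?thesis
        using i2(1) assms(1) by (simp add: integral_add integral_diff integrable_diff integrable_const_ivl)
    qed
    also have "\<dots> = integral {l..s} (\<lambda>x. (f x)\<^sup>2) - (integral {l..s} f)\<^sup>2 / (s - l)"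
    proof -
      have "2 * (I / t) * I - (I / t)\<^sup>2 * t = I\<^sup>2 / t" if "t \<noteq> 0" for I t :: real
        using that by (simp add: field_simps power2_eq_square)
      from this[of "s - l" "integral {l..s} f"] show ?thesis
        using False by (simp add: m_def)
    qed
    finally show ?thesis
      using False assms(1) by (simp add: field_simps)
  qed simp
  also have "\<dots> \<le> (h - l) * integral {l..h} (\<lambda>x. (f x)\<^sup>2)"
    using assms mono nn by (intro mult_mono) auto
  finally show ?thesis .
qed

lemma integral_slice_int_0:
  fixes f :: "pt \<Rightarrow> real"
  assumes f: "continuous_on (box3 a b c d e g) f" and ab: "a \<le> b"
  shows "integral (box3 a b c d e g) (slice_int 0 a b f) = (b - a) * integral (box3 a b c d e g) f"
proof -
  have 1: "continuous_on (box3 a b c d e g) (slice_int 0 a b f)"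
    using continuous_on_slice_int[OF boxlike_box3 f, of 0] by simp
  show ?thesis
    unfolding integral_box3_r[OF 1] integral_box3_r[OF f]
    using ab by (simp add: slice_int_def upd_def)
qed

lemma integral_slice_int_1:
  fixes f :: "pt \<Rightarrow> real"
  assumes f: "continuous_on (box3 a b c d e g) f" and cd: "c \<le> d"
  shows "integral (box3 a b c d e g) (slice_int 1 c d f) = (d - c) * integral (box3 a b c d e g) f"
proof -
  have 1: "continuous_on (box3 a b c d e g) (slice_int 1 c d f)"
    using continuous_on_slice_int[OF boxlike_box3 f, of 1] by simp
  show ?thesis
    unfolding integral_box3_rz\<theta>[OF 1] integral_box3_rz\<theta>[OF f]
    using cd by (simp add: slice_int_def upd_def)
qed

subsection \<open>The local energy estimate\<close>

text \<open>The conditions under which all boundary terms and the pressure drop out. As in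
  \<open>weak_identity\<close>, the divergence is multiplied by r.\<close>

definition test_field ::
    "real \<Rightarrow> real \<Rightarrow> real \<Rightarrow> real \<Rightarrow> (nat \<Rightarrow> pt \<Rightarrow> real) \<Rightarrow> (nat \<Rightarrow> nat \<Rightarrow> pt \<Rightarrow> real) \<Rightarrow> bool" where
  "test_field R1 R2 A B w dw \<longleftrightarrow>
     (\<forall>d<3. \<forall>i<3. pd (box3 R1 R2 0 (2 * pi) A B) d (w i) (dw d i)) \<and>
     (\<forall>x\<in>box3 R1 R2 0 (2 * pi) A B. w 0 x + co 0 x * dw 0 0 x + dw 1 1 x + co 0 x * dw 2 2 x = 0) \<and>
     (\<forall>i<3. \<forall>r\<in>{R1..R2}. \<forall>z\<in>{A..B}. w i (r, 2 * pi, z) = w i (r, 0, z)) \<and>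
     (\<forall>i<3. \<forall>\<theta>\<in>{0..2 * pi}. \<forall>z\<in>{A..B}. w i (R1, \<theta>, z) = 0 \<and> w i (R2, \<theta>, z) = 0) \<and>
     (\<forall>i<3. \<forall>r\<in>{R1..R2}. \<forall>\<theta>\<in>{0..2 * pi}. w i (r, \<theta>, A) = 0 \<and> w i (r, \<theta>, B) = 0)"

text \<open>The factor \<open>co 0 x\<close> is the Jacobian of cylindrical coordinates. The
  pressure is absent since test fields are solenoidal.\<close>

definition weak_stokes ::
    "real \<Rightarrow> real \<Rightarrow> real \<Rightarrow> real \<Rightarrow> real \<Rightarrow> (nat \<Rightarrow> nat \<Rightarrow> pt \<Rightarrow> real) \<Rightarrow> (nat \<Rightarrow> nat \<Rightarrow> pt \<Rightarrow> real) \<Rightarrow> bool" where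
  "weak_stokes \<nu> R1 R2 A B g F \<longleftrightarrow>
     (\<forall>w dw. test_field R1 R2 A B w dw \<longrightarrow>
       integral (box3 R1 R2 0 (2 * pi) A B) (\<lambda>x. co 0 x * (\<Sum>d<3. \<Sum>i<3.
         (\<nu> * g d i x - F d i x) * tens (co 0 x) (\<lambda>i. w i x) (\<lambda>d i. dw d i x) d i)) = 0)"

definition grad :: "(nat \<Rightarrow> pt \<Rightarrow> real) \<Rightarrow> (nat \<Rightarrow> nat \<Rightarrow> pt \<Rightarrow> real) \<Rightarrow> nat \<Rightarrow> nat \<Rightarrow> pt \<Rightarrow> real" where
  "grad u du d i x = tens (co 0 x) (\<lambda>i. u i x) (\<lambda>d i. du d i x) d i"

section \<open>Cutoff along the axis and radial profile\<close>

definition cutoff :: "real \<Rightarrow> real \<Rightarrow> real \<Rightarrow> real" where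
  "cutoff a l z = (1 - ((z - a) / l)\<^sup>2)"

text \<open>The fourth power is chosen because the gradient of the corrector contains the first and
  second derivatives of the cutoff: both are then bounded by a multiple of the square of
  \<open>cutoff\<close>, which is the square root of \<open>eta\<close> and hence what Young's
  inequality can absorb.\<close>

definition eta :: "real \<Rightarrow> real \<Rightarrow> real \<Rightarrow> real" where
  "eta a l z = cutoff a l z ^ 4"

definition eta1 :: "real \<Rightarrow> real \<Rightarrow> real \<Rightarrow> real" where
  "eta1 a l z = - 8 * ((z - a) / l) / l * cutoff a l z ^ 3"

definition eta2 :: "real \<Rightarrow> real \<Rightarrow> real \<Rightarrow> real" where
  "eta2 a l z = (48 * ((z - a) / l)\<^sup>2 * (cutoff a l z)\<^sup>2 - 8 * cutoff a l z ^ 3) / l\<^sup>2"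

lemma DERIV_affine: "((\<lambda>r. (r - b) / k) has_real_derivative 1 / k) (at (r::real))"
  by (auto intro!: derivative_eq_intros DERIV_cdivide)

lemma DERIV_eta: "(eta a l has_real_derivative eta1 a l z) (at z)"
proof -
  have "((\<lambda>t. (1 - t\<^sup>2) ^ 4) has_real_derivative - 8 * t * (1 - t\<^sup>2) ^ 3) (at t)" for t :: real
    by (auto intro!: derivative_eq_intros)
  from DERIV_chain2[OF this DERIV_affine[of a l z]] show ?thesis
    by (simp add: eta_def[abs_def] eta1_def cutoff_def)
qed

lemma DERIV_eta1: "l > 0 \<Longrightarrow> (eta1 a l has_real_derivative eta2 a l z) (at z)"
proof -
  assume l: "l > 0"
  have "((\<lambda>t. - 8 * t / l * (1 - t\<^sup>2) ^ 3) has_real_derivative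
      (48 * t\<^sup>2 * (1 - t\<^sup>2)\<^sup>2 - 8 * (1 - t\<^sup>2) ^ 3) / l) (at t)" for t :: real
    using l by (auto intro!: derivative_eq_intros simp: power2_eq_square diff_divide_distrib)
  from DERIV_chain2[OF this DERIV_affine[of a l z]] show ?thesis
    using l by (simp add: eta1_def[abs_def] eta2_def cutoff_def power2_eq_square[of l])
qed

lemma cutoff_bounds:
  assumes "l > 0" "\<bar>z - a\<bar> \<le> l"
  shows "0 \<le> cutoff a l z" "cutoff a l z \<le> 1" "\<bar>(z - a) / l\<bar> \<le> 1"
proof -
  show *: "\<bar>(z - a) / l\<bar> \<le> 1" using assms by (simp add: abs_divide)
  show "0 \<le> cutoff a l z" "cutoff a l z \<le> 1"
    using * abs_square_le_1[of "(z - a) / l"] by (auto simp: cutoff_def)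
qed

text \<open>56 is 48 + 8, the sum of the coefficients in \<open>eta2\<close>. The factor 1 / l^2 of
  the second derivative is weakened to 1 / l by \<open>1 \<le> l\<close>, so that one bound serves
  both.\<close>

lemma eta_bounds:
  assumes "1 \<le> l" "\<bar>z - a\<bar> \<le> l"
  shows "\<bar>eta1 a l z\<bar> \<le> 56 / l * (cutoff a l z)\<^sup>2" "\<bar>eta2 a l z\<bar> \<le> 56 / l * (cutoff a l z)\<^sup>2"
proof -
  define c t where "c = cutoff a l z" and "t = (z - a) / l"
  have l: "l > 0" using assms by simp
  have c: "0 \<le> c" "c \<le> 1" and t: "\<bar>t\<bar> \<le> 1"
    using cutoff_bounds[OF l assms(2)] by (auto simp: c_def t_def)
  have c3: "c ^ 3 \<le> c\<^sup>2" "0 \<le> c ^ 3" using c power_decreasing[of 2 3 c] by auto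
  have "\<bar>eta1 a l z\<bar> = 8 / l * (\<bar>t\<bar> * c ^ 3)"
  proof -
    have "\<bar>- 8 * t / l * c ^ 3\<bar> = 8 / l * (\<bar>t\<bar> * c ^ 3)"
      using l c3 by (simp add: abs_mult abs_divide)
    then show ?thesis by (simp add: eta1_def c_def t_def)
  qed
  also have "\<dots> \<le> 8 / l * (1 * c\<^sup>2)"
    using l c3 t by (intro mult_left_mono mult_mono) auto
  also have "\<dots> \<le> 56 / l * c\<^sup>2"
    using l by (simp add: divide_right_mono)
  finally show "\<bar>eta1 a l z\<bar> \<le> 56 / l * (cutoff a l z)\<^sup>2" by (simp add: c_def)
  have t2: "t\<^sup>2 \<le> 1" using t abs_square_le_1 by blast
  have "\<bar>eta2 a l z\<bar> = \<bar>48 * (t\<^sup>2 * c\<^sup>2) - 8 * c ^ 3\<bar> / l\<^sup>2"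
    by (simp add: eta2_def c_def t_def abs_divide mult.assoc)
  also have "\<dots> \<le> (56 * c\<^sup>2) / l\<^sup>2"
  proof (intro divide_right_mono)
    have "t\<^sup>2 * c\<^sup>2 \<le> 1 * c\<^sup>2" "0 \<le> t\<^sup>2 * c\<^sup>2"
      using t2 by (intro mult_right_mono mult_nonneg_nonneg; simp)+
    then show "\<bar>48 * (t\<^sup>2 * c\<^sup>2) - 8 * c ^ 3\<bar> \<le> 56 * c\<^sup>2" using c3 by linarith
  qed simp
  also have "\<dots> \<le> (56 * c\<^sup>2) / l"
    using assms(1) l self_le_power[of l 2] by (intro divide_left_mono) auto
  finally show "\<bar>eta2 a l z\<bar> \<le> 56 / l * (cutoff a l z)\<^sup>2" by (simp add: c_def)
qed

lemma eta_ge_quarter: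
  assumes "l > 0" "\<bar>z - a\<bar> \<le> l / 2"
  shows "1 / 4 \<le> eta a l z"
proof -
  have "\<bar>(z - a) / l\<bar> \<le> 1 / 2" using assms by (simp add: abs_divide field_simps)
  then have "((z - a) / l)\<^sup>2 \<le> (1 / 2)\<^sup>2" using abs_le_square_iff[of "(z - a) / l" "1 / 2"] by simp
  then have "3 / 4 \<le> cutoff a l z" by (simp add: cutoff_def power2_eq_square)
  then have "(3 / 4) ^ 4 \<le> eta a l z" unfolding eta_def by (intro power_mono) auto
  then show ?thesis by (simp add: power_divide)
qed

text \<open>The cubic that rises from 0 at R1 to 1 at R2 with zero slope at both ends. The end
  values correct the radial flux field at R2, the zero slopes make the angular field vanish on both
  cylinders.\<close>

definition bump :: "real \<Rightarrow> real \<Rightarrow> real \<Rightarrow> real" where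
  "bump R1 R2 r = (let t = (r - R1) / (R2 - R1) in 3 * t\<^sup>2 - 2 * t ^ 3)"

definition bump1 :: "real \<Rightarrow> real \<Rightarrow> real \<Rightarrow> real" where
  "bump1 R1 R2 r = (let t = (r - R1) / (R2 - R1) in 6 * t * (1 - t) / (R2 - R1))"

definition bump2 :: "real \<Rightarrow> real \<Rightarrow> real \<Rightarrow> real" where
  "bump2 R1 R2 r = (let t = (r - R1) / (R2 - R1) in (6 - 12 * t) / (R2 - R1)\<^sup>2)"

lemma DERIV_bump: "(bump R1 R2 has_real_derivative bump1 R1 R2 r) (at r)"
proof -
  have "((\<lambda>t. 3 * t\<^sup>2 - 2 * t ^ 3) has_real_derivative 6 * t * (1 - t)) (at t)" for t :: real
    by (auto intro!: derivative_eq_intros simp: power2_eq_square algebra_simps)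
  from DERIV_chain2[OF this DERIV_affine[of R1 "R2 - R1" r]] show ?thesis
    by (simp add: bump_def[abs_def] bump1_def Let_def)
qed

lemma DERIV_bump1: "(bump1 R1 R2 has_real_derivative bump2 R1 R2 r) (at r)"
proof -
  have "((\<lambda>t. 6 * t * (1 - t) / k) has_real_derivative (6 - 12 * t) / k) (at t)" for t k :: real
    by (rule DERIV_cdivide) (auto intro!: derivative_eq_intros simp: algebra_simps)
  from DERIV_chain2[OF this DERIV_affine[of R1 "R2 - R1" r]] show ?thesis
    by (simp add: bump1_def[abs_def] bump2_def Let_def power2_eq_square)
qed

lemma bump_bounds:
  assumes "R1 < R2" "R1 \<le> r" "r \<le> R2" "1 / (R2 - R1) \<le> M"
  shows "\<bar>bump R1 R2 r\<bar> \<le> 1" "\<bar>bump1 R1 R2 r\<bar> \<le> 2 * M" "\<bar>bump2 R1 R2 r\<bar> \<le> 6 * M\<^sup>2"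
proof -
  define t k where "t = (r - R1) / (R2 - R1)" and "k = 1 / (R2 - R1)"
  have t: "0 \<le> t" "t \<le> 1" using assms by (auto simp: t_def field_simps)
  have k: "0 \<le> k" "k \<le> M" using assms by (auto simp: k_def)
  \<comment> \<open>Writing the profile and its complement to 1 as products of nonnegative factors
    shows that it stays between 0 and 1.\<close>
  have 1: "3 * t\<^sup>2 - 2 * t ^ 3 = t\<^sup>2 * (3 - 2 * t)" by (simp add: power2_eq_square power3_eq_cube algebra_simps)
  have 2: "1 - (3 * t\<^sup>2 - 2 * t ^ 3) = (1 - t)\<^sup>2 * (1 + 2 * t)"
    by (simp add: power2_eq_square power3_eq_cube algebra_simps)
  have "0 \<le> t\<^sup>2 * (3 - 2 * t)" "0 \<le> (1 - t)\<^sup>2 * (1 + 2 * t)" using t by auto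
  then show "\<bar>bump R1 R2 r\<bar> \<le> 1" unfolding bump_def Let_def t_def[symmetric] using 1 2 by linarith
  have "0 \<le> (2 * t - 1)\<^sup>2" by simp
  then have p: "6 * t * (1 - t) \<le> 2" by (simp add: power2_eq_square algebra_simps)
  have p0: "0 \<le> 6 * t * (1 - t)" using t by auto
  have "6 * t * (1 - t) * k \<le> 2 * M" "0 \<le> 6 * t * (1 - t) * k"
    using mult_mono[OF p k(2)] mult_nonneg_nonneg[OF p0 k(1)] k(1) by auto
  then show "\<bar>bump1 R1 R2 r\<bar> \<le> 2 * M" by (simp add: bump1_def Let_def t_def k_def)
  have "\<bar>6 - 12 * t\<bar> \<le> 6" using t by auto
  moreover have "k\<^sup>2 \<le> M\<^sup>2" using k by (intro power_mono)
  ultimately have "\<bar>6 - 12 * t\<bar> * k\<^sup>2 \<le> 6 * M\<^sup>2" by (intro mult_mono) auto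
  then show "\<bar>bump2 R1 R2 r\<bar> \<le> 6 * M\<^sup>2"
    by (simp add: bump2_def Let_def t_def k_def abs_divide power_divide)
qed

lemma bump_ends:
  assumes "R1 < R2"
  shows "bump R1 R2 R1 = 0" "bump R1 R2 R2 = 1" "bump1 R1 R2 R1 = 0" "bump1 R1 R2 R2 = 0"
  using assms by (auto simp: bump_def bump1_def Let_def)

text \<open>Young's inequality for one entry: \<open>y\<close> is the square root of the cutoff,
  \<open>g\<close> the entry of the velocity gradient, \<open>F\<close> that of the stress and
  \<open>R\<close> that of the gradient of the corrector. Since \<open>R\<close> carries a factor
  \<open>y\<close>, its product with \<open>g\<close> is absorbed by the term with
  \<open>y\<^sup>2 * g\<^sup>2\<close>.\<close>

lemma energy_pointwise:
  fixes \<nu> g F y R b :: real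
  assumes "\<nu> > 0" "0 \<le> y" "\<bar>R\<bar> \<le> y * b"
  shows "\<nu> / 2 * (y\<^sup>2 * g\<^sup>2) - 2 / \<nu> * (y\<^sup>2 * F\<^sup>2) - 5 / 4 * \<nu> * b\<^sup>2 \<le> (\<nu> * g - F) * (y\<^sup>2 * g + R)"
proof -
  \<comment> \<open>Divide the factor \<open>y\<close> out of \<open>R\<close>; where
    \<open>y\<close> vanishes the hypothesis forces \<open>R = 0\<close>.\<close>
  obtain s where s: "R = y * s" "\<bar>s\<bar> \<le> b \<or> y = 0 \<and> s = 0"
  proof (cases "y = 0")
    case False
    then have "y > 0" using assms(2) by simp
    then have "\<bar>R / y\<bar> \<le> b" using assms(3) by (simp add: abs_divide field_simps)
    then show ?thesis using that[of "R / y"] False by auto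
  qed (use that[of 0] assms in auto)
  then have sb: "s\<^sup>2 \<le> b\<^sup>2" using abs_le_square_iff[of s b] by auto
  \<comment> \<open>Each of the three squares takes up one cross term: \<open>g\<close> with
    \<open>F\<close>, \<open>g\<close> with \<open>s\<close>, and \<open>F\<close> with
    \<open>s\<close>.\<close>
  have "(\<nu> * g - F) * (y\<^sup>2 * g + y * s) - (\<nu> / 2 * (y\<^sup>2 * g\<^sup>2) - 2 / \<nu> * (y\<^sup>2 * F\<^sup>2) - 5 / 4 * \<nu> * s\<^sup>2)
      = \<nu> / 4 * (y * g - 2 * (y * F) / \<nu>)\<^sup>2 + \<nu> / 4 * (y * g + 2 * s)\<^sup>2 + 1 / \<nu> * (y * F - \<nu> * s / 2)\<^sup>2"
    using assms(1) by (simp add: field_simps power2_eq_square)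
  also have "\<dots> \<ge> 0" using assms(1) by auto
  finally have "\<nu> / 2 * (y\<^sup>2 * g\<^sup>2) - 2 / \<nu> * (y\<^sup>2 * F\<^sup>2) - 5 / 4 * \<nu> * s\<^sup>2 \<le> (\<nu> * g - F) * (y\<^sup>2 * g + R)"
    using s(1) by simp
  moreover have "5 / 4 * \<nu> * s\<^sup>2 \<le> 5 / 4 * \<nu> * b\<^sup>2"
    using sb assms(1) by (intro mult_left_mono) auto
  ultimately show ?thesis by linarith
qed

lemma prim_ftc:
  assumes X: "boxlike X L H" and h: "pd X d h h'" and x: "x \<in> X" and d: "d < 3"
  shows "prim d (L d) h' x = h x - h (upd d x (L d))"
proof -
  have "integral {L d..co d x} (\<lambda>s. h' (upd d x s)) = h (upd d x (co d x)) - h (upd d x (L d))"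
  proof (rule ftc_real)
    fix s assume s: "s \<in> {L d..co d x}"
    have m: "upd d x s \<in> X"
      using s boxlike_mem[OF X x d] boxlike_co[OF X x d] by auto
    show "((\<lambda>s. h (upd d x s)) has_real_derivative h' (upd d x s)) (at s within {L d..co d x})"
      using pdD[OF h m] boxlikeD[OF X m d] boxlike_co[OF X x d] by (auto elim!: DERIV_subset)
  qed (use boxlike_co[OF X x d] in simp)
  then show ?thesis by (simp add: prim_def)
qed

text \<open>Cauchy-Schwarz along a coordinate line. The square of the integrand is replaced by a
  majorant, so that all fluxes can later be measured by one common density.\<close>

lemma integral_line_square_le:
  assumes X: "boxlike X L H" and d: "d < 3" and f: "continuous_on X f" and g: "continuous_on X g"
    and le: "\<And>x. x \<in> X \<Longrightarrow> (f x)\<^sup>2 \<le> c * g x" and x: "x \<in> X" and s: "L d \<le> s" "s \<le> H d"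
  shows "(integral {L d..s} (\<lambda>t. f (upd d x t)))\<^sup>2 \<le> (H d - L d) * c * slice_int d (L d) (H d) g x"
proof -
  note cf = continuous_on_line[OF X f x d] and cg = continuous_on_line[OF X g x d]
  have "(integral {L d..s} (\<lambda>t. f (upd d x t)))\<^sup>2 \<le> (H d - L d) * integral {L d..H d} (\<lambda>t. (f (upd d x t))\<^sup>2)"
    by (rule square_integral_le[OF s cf])
  also have "\<dots> \<le> (H d - L d) * integral {L d..H d} (\<lambda>t. c * g (upd d x t))"
  proof (intro mult_left_mono integral_le integrable_continuous_real)
    fix t assume "t \<in> {L d..H d}"
    then show "(f (upd d x t))\<^sup>2 \<le> c * g (upd d x t)"
      using le boxlike_mem[OF X x d] by auto
  qed (use cf cg s in \<open>auto intro!: continuous_intros\<close>)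
  finally show ?thesis by (simp add: slice_int_def mult.assoc)
qed

lemma prim_square_le:
  assumes X: "boxlike X L H" and d: "d < 3" and "continuous_on X f" "continuous_on X g"
    and "\<And>x. x \<in> X \<Longrightarrow> (f x)\<^sup>2 \<le> c * g x" and x: "x \<in> X"
  shows "(prim d (L d) f x)\<^sup>2 \<le> (H d - L d) * c * slice_int d (L d) (H d) g x"
  unfolding prim_def using boxlike_co[OF X x d] by (intro integral_line_square_le[OF assms]) auto

lemma slice_int_square_le:
  assumes X: "boxlike X L H" and d: "d < 3" and "continuous_on X f" "continuous_on X g"
    and "\<And>x. x \<in> X \<Longrightarrow> (f x)\<^sup>2 \<le> c * g x" and x: "x \<in> X"
  shows "(slice_int d (L d) (H d) f x)\<^sup>2 \<le> (H d - L d) * c * slice_int d (L d) (H d) g x"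
  using integral_line_square_le[OF assms, of "H d"] boxlike_co[OF X x d] by (simp add: slice_int_def)

text \<open>A single number \<open>M\<close> dominates all geometric quantities, so that the
  constants below do not depend on the centre \<open>a\<close> of the window. The mean condition
  concerns the axial component, whose flux has to possess a periodic primitive in the angle.\<close>

locale stokes_window =
  fixes \<nu> R1 R2 M a l :: real
    and U :: "nat \<Rightarrow> pt \<Rightarrow> real" and dU F :: "nat \<Rightarrow> nat \<Rightarrow> pt \<Rightarrow> real"
  assumes nu: "\<nu> > 0" and R1: "0 < R1" and R12: "R1 < R2"
    and M: "1 \<le> M" "1 / R1 \<le> M" "R2 \<le> M" "1 / (R2 - R1) \<le> M" and l: "1 \<le> l"
    and U_pd: "\<And>d i. d < 3 \<Longrightarrow> i < 3 \<Longrightarrow> pd (window R1 R2 a l) d (U i) (dU d i)"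
    and U_div: "\<And>x. x \<in> window R1 R2 a l \<Longrightarrow>
        U 0 x + co 0 x * dU 0 0 x + dU 1 1 x + co 0 x * dU 2 2 x = 0"
    and U_bc: "\<And>i x. i < 3 \<Longrightarrow> x \<in> window R1 R2 a l \<Longrightarrow>
        co 0 x = R1 \<or> co 0 x = R2 \<Longrightarrow> U i x = 0"
    and U_per: "\<And>i x. i < 3 \<Longrightarrow> x \<in> window R1 R2 a l \<Longrightarrow>
        U i (upd 1 x (2 * pi)) = U i (upd 1 x 0)"
    and U_mean: "\<And>x. x \<in> window R1 R2 a l \<Longrightarrow> slice_int 1 0 (2 * pi) (U 2) x = 0"
    and F_cont: "\<And>d i. d < 3 \<Longrightarrow> i < 3 \<Longrightarrow> continuous_on (window R1 R2 a l) (F d i)"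
    and weak: "weak_stokes \<nu> R1 R2 (a - l) (a + l) (grad U dU) F"
begin

definition X where "X = window R1 R2 a l"
definition L :: "nat \<Rightarrow> real" where "L = (\<lambda>k. if k = 0 then R1 else if k = 1 then 0 else a - l)"
definition H :: "nat \<Rightarrow> real" where "H = (\<lambda>k. if k = 0 then R2 else if k = 1 then 2 * pi else a + l)"

lemma X: "boxlike X L H"
  unfolding X_def L_def H_def by (rule boxlike_box3)

lemma LH [simp]: "L 0 = R1" "L 1 = 0" "L 2 = a - l" "H 0 = R2" "H 1 = 2 * pi" "H 2 = a + l"
  by (auto simp: L_def H_def)

lemma M_pos: "0 < M" "0 \<le> M" using M(1) by auto

lemma co0_bounds:
  assumes "x \<in> X"
  shows "R1 \<le> co 0 x" "co 0 x \<le> R2" "0 < co 0 x" "co 0 x \<le> M" "1 / co 0 x \<le> M" "0 < 1 / co 0 x"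
proof -
  show *: "R1 \<le> co 0 x" "co 0 x \<le> R2" using boxlike_co[OF X assms, of 0] by auto
  then show "0 < co 0 x" "co 0 x \<le> M" "0 < 1 / co 0 x" using R1 M(3) by auto
  have "1 / co 0 x \<le> 1 / R1" using * R1 by (intro divide_left_mono) auto
  then show "1 / co 0 x \<le> M" using M(2) by simp
qed

lemma U_pd': "d < 3 \<Longrightarrow> i < 3 \<Longrightarrow> pd X d (U i) (dU d i)"
  using U_pd by (simp add: X_def)

lemma U_cont: "i < 3 \<Longrightarrow> continuous_on X (U i)"
  using pdD1[OF U_pd'[of 0 i]] by simp

lemma dU_cont: "d < 3 \<Longrightarrow> i < 3 \<Longrightarrow> continuous_on X (dU d i)"
  by (rule pdD2[OF U_pd'])

lemma pd_co0: "pd X 0 (co 0) (\<lambda>x. 1)" "pd X 1 (co 0) (\<lambda>x. 0)" "pd X 2 (co 0) (\<lambda>x. 0)"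
  using pd_fun_same[of 0 X "\<lambda>_. 1" "\<lambda>s. s"] pd_fun_other[of 1 0 X "\<lambda>s. s"] pd_fun_other[of 2 0 X "\<lambda>s. s"]
  by (auto simp: continuous_on_id)

text \<open>\<open>G\<close> is the flux of \<open>U\<close> through the annular sector between \<open>R1\<close> and \<open>r\<close>, \<open>q\<close> the one
  through the whole cross section, and \<open>Q\<close> a \<open>\<theta>\<close>-primitive of \<open>q\<close>. By incompressibility the
  \<open>z\<close>-derivatives of all three only involve \<open>U\<close> and its \<open>\<theta>\<close>-derivatives.\<close>

definition G where "G = prim 0 R1 (\<lambda>x. co 0 x * U 2 x)"
definition Gt where "Gt = prim 0 R1 (\<lambda>x. co 0 x * dU 1 2 x)"
definition J where "J = prim 0 R1 (dU 1 1)"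
definition q where "q = slice_int 0 R1 R2 (\<lambda>x. co 0 x * U 2 x)"
definition qt where "qt = slice_int 0 R1 R2 (\<lambda>x. co 0 x * dU 1 2 x)"
definition qJ where "qJ = slice_int 0 R1 R2 (dU 1 1)"
definition Q where "Q = prim 1 0 q"
definition QJ where "QJ = prim 1 0 qJ"

lemma rU_pd: "pd X 1 (\<lambda>x. co 0 x * U 2 x) (\<lambda>x. co 0 x * dU 1 2 x)"
    "pd X 2 (\<lambda>x. co 0 x * U 2 x) (\<lambda>x. co 0 x * dU 2 2 x)"
  using pd_mult[OF pd_co0(2) U_pd'[of 1 2]] pd_mult[OF pd_co0(3) U_pd'[of 2 2]] by auto

lemma rU_cont: "continuous_on X (\<lambda>x. co 0 x * U 2 x)"
  by (intro continuous_intros U_cont) auto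

text \<open>For the z-derivative, incompressibility gives r d_z U_z = -d_r (r U_r) - d_theta
  U_theta. This is integrated from R1, where U_r vanishes, so no derivative of \<open>U\<close>
  other than the angular one remains.\<close>

lemma G_pd: "pd X 0 G (\<lambda>x. co 0 x * U 2 x)" "pd X 1 G Gt" "pd X 2 G (\<lambda>x. - (co 0 x * U 0 x) - J x)"
proof -
  show "pd X 0 G (\<lambda>x. co 0 x * U 2 x)"
    using pd_prim_same[OF X rU_cont, of 0] by (simp add: G_def)
  show "pd X 1 G Gt"
    using pd_prim_other[OF X rU_pd(1), of 0] by (simp add: G_def Gt_def)
  have J: "pd X 0 J (dU 1 1)"
    using pd_prim_same[OF X dU_cont[of 1 1], of 0] by (simp add: J_def)
  have h: "pd X 0 (\<lambda>x. - (co 0 x * U 0 x) - J x) (\<lambda>x. co 0 x * dU 2 2 x)"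
  proof (rule pd_cong'[OF pd_cong[OF pd_diff[OF pd_cmult[OF pd_mult[OF pd_co0(1) U_pd'[of 0 0]], of "- 1"] J]]])
    show "- 1 * (1 * U 0 x + co 0 x * dU 0 0 x) - dU 1 1 x = co 0 x * dU 2 2 x" if "x \<in> X" for x
      using U_div[of x] that by (simp add: X_def)
  qed auto
  have 2: "pd X 2 G (prim 0 R1 (\<lambda>x. co 0 x * dU 2 2 x))"
    using pd_prim_other[OF X rU_pd(2), of 0] by (simp add: G_def)
  show "pd X 2 G (\<lambda>x. - (co 0 x * U 0 x) - J x)"
  proof (rule pd_cong'[OF 2])
    fix x assume x: "x \<in> X"
    have "upd 0 x R1 \<in> X" using boxlike_mem[OF X x, of 0 R1] R12 by simp
    then have "U 0 (upd 0 x R1) = 0" using U_bc[of 0 "upd 0 x R1"] by (simp add: X_def)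
    moreover have "J (upd 0 x R1) = 0" by (simp add: J_def prim_def)
    ultimately show "prim 0 R1 (\<lambda>x. co 0 x * dU 2 2 x) x = - (co 0 x * U 0 x) - J x"
      using prim_ftc[OF X h x] by simp
  qed
qed

lemma q_eq: "q = (\<lambda>x. G (upd 0 x R2))" and qt_eq: "qt = (\<lambda>x. Gt (upd 0 x R2))"
  and qJ_eq: "qJ = (\<lambda>x. J (upd 0 x R2))"
  using slice_int_prim[OF X, of 0] by (auto simp: q_def G_def qt_def Gt_def qJ_def J_def)

lemma q_pd: "pd X 0 q (\<lambda>x. 0)" "pd X 1 q qt" "pd X 2 q (\<lambda>x. - qJ x)"
proof -
  show "pd X 0 q (\<lambda>x. 0)"
    using pd_slice_same[OF X pdD1[OF G_pd(1)], of 0 R2] R12 by (simp add: q_eq)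
  show "pd X 1 q qt"
    using pd_slice_other[OF X G_pd(2), of 0 R2] R12 by (simp add: q_eq qt_eq)
  have 2: "pd X 2 q (\<lambda>x. - (co 0 (upd 0 x R2) * U 0 (upd 0 x R2)) - J (upd 0 x R2))"
    using pd_slice_other[OF X G_pd(3), of 0 R2] R12 by (simp add: q_eq)
  show "pd X 2 q (\<lambda>x. - qJ x)"
  proof (rule pd_cong'[OF 2])
    fix x assume x: "x \<in> X"
    have "upd 0 x R2 \<in> X" using boxlike_mem[OF X x, of 0 R2] R12 by simp
    then have "U 0 (upd 0 x R2) = 0" using U_bc[of 0 "upd 0 x R2"] by (simp add: X_def)
    then show "- (co 0 (upd 0 x R2) * U 0 (upd 0 x R2)) - J (upd 0 x R2) = - qJ x"
      by (simp add: qJ_eq)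
  qed
qed

lemma Q_pd: "pd X 0 Q (\<lambda>x. 0)" "pd X 1 Q q" "pd X 2 Q (\<lambda>x. - QJ x)"
proof -
  show "pd X 0 Q (\<lambda>x. 0)"
    by (rule pd_cong'[OF pd_prim_other[OF X q_pd(1), of 1, unfolded LH, folded Q_def]]) (auto simp: prim_def)
  show "pd X 1 Q q"
    using pd_prim_same[OF X pdD1[OF q_pd(1)], of 1] by (simp add: Q_def)
  show "pd X 2 Q (\<lambda>x. - QJ x)"
    by (rule pd_cong'[OF pd_prim_other[OF X q_pd(3), of 1, unfolded LH, folded Q_def]]) (auto simp: prim_def QJ_def)
qed

text \<open>By Fubini the value after a full turn is the radial integral of r times the angular mean
  of the axial component, which is zero. Hence the angular part of the corrector is single
  valued.\<close>

lemma Q_ends: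
  assumes "x \<in> X"
  shows "Q (upd 1 x 0) = 0" "Q (upd 1 x (2 * pi)) = 0"
proof -
  show "Q (upd 1 x 0) = 0" by (simp add: Q_def prim_def)
  have mem: "upd 1 (upd 0 x s) t \<in> X" if "s \<in> {R1..R2}" "t \<in> {0..2 * pi}" for s t
    using that boxlike_mem[OF X assms, of 0 s] boxlike_mem[OF X, of "upd 0 x s" 1 t] by simp
  have "continuous_on (cbox (0, R1) (2 * pi, R2)) (\<lambda>y. snd y * U 2 (upd 1 (upd 0 x (snd y)) (fst y)))"
    by (intro continuous_intros continuous_on_compose2[OF U_cont[of 2]] image_subsetI)
      (auto intro!: mem simp: cbox_Pair_iff)
  then have "integral (cbox 0 (2 * pi)) (\<lambda>t. integral (cbox R1 R2) (\<lambda>s. s * U 2 (upd 1 (upd 0 x s) t)))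
      = integral (cbox R1 R2) (\<lambda>s. integral (cbox 0 (2 * pi)) (\<lambda>t. s * U 2 (upd 1 (upd 0 x s) t)))"
    by (intro integral_swap_continuous) (simp add: case_prod_beta)
  also have "\<dots> = integral (cbox R1 R2) (\<lambda>s. 0)"
  proof (rule integral_cong)
    fix s assume "s \<in> cbox R1 R2"
    then have "upd 0 x s \<in> X" using boxlike_mem[OF X assms, of 0 s] by simp
    then show "integral (cbox 0 (2 * pi)) (\<lambda>t. s * U 2 (upd 1 (upd 0 x s) t)) = 0"
      using U_mean[of "upd 0 x s"] by (simp add: X_def slice_int_def)
  qed
  finally show "Q (upd 1 x (2 * pi)) = 0"
    by (simp add: Q_def prim_def q_def slice_int_def upd_commute[of 1 0])
qed

end

lemma less3_cases: "d < 3 \<Longrightarrow> (d = 0 \<Longrightarrow> P) \<Longrightarrow> (d = 1 \<Longrightarrow> P) \<Longrightarrow> (d = (2::nat) \<Longrightarrow> P) \<Longrightarrow> P"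
  by linarith

lemma abs_mult_le: "\<bar>a\<bar> \<le> A \<Longrightarrow> \<bar>b\<bar> \<le> B \<Longrightarrow> \<bar>a * b\<bar> \<le> A * (B::real)"
  unfolding abs_mult by (rule mult_mono) auto

context stokes_window
begin

abbreviation "\<eta> x \<equiv> eta a l (co 2 x)"
abbreviation "\<eta>1 x \<equiv> eta1 a l (co 2 x)"
abbreviation "\<eta>2 x \<equiv> eta2 a l (co 2 x)"
abbreviation "\<beta> x \<equiv> bump R1 R2 (co 0 x)"
abbreviation "\<beta>1 x \<equiv> bump1 R1 R2 (co 0 x)"
abbreviation "\<beta>2 x \<equiv> bump2 R1 R2 (co 0 x)"
abbreviation "k x \<equiv> 1 / co 0 x"

text \<open>The truncation \<open>\<eta> U\<close> has divergence \<open>\<eta>' U 2\<close>. The corrector removes it; its gradient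
  \<open>C\<close> contains no \<open>r\<close>- or \<open>z\<close>-derivatives of \<open>U\<close>.\<close>

definition W :: "nat \<Rightarrow> pt \<Rightarrow> real" where
  "W i x = (if i = 0 then \<eta> x * U 0 x - \<eta>1 x * k x * (G x - \<beta> x * q x)
     else if i = 1 then \<eta> x * U 1 x - \<beta>1 x * \<eta>1 x * Q x else \<eta> x * U 2 x)"

definition C :: "nat \<Rightarrow> nat \<Rightarrow> pt \<Rightarrow> real" where
  "C d i x =
    (if i = 0 then
       (if d = 0 then \<eta>1 x * (k x)\<^sup>2 * (G x - \<beta> x * q x) - \<eta>1 x * k x * (co 0 x * U 2 x - \<beta>1 x * q x)
        else if d = 1 then - (\<eta>1 x * k x * (Gt x - \<beta> x * qt x))
        else \<eta>1 x * U 0 x - \<eta>2 x * k x * (G x - \<beta> x * q x)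
           - \<eta>1 x * k x * (- (co 0 x * U 0 x) - J x + \<beta> x * qJ x))
     else if i = 1 then
       (if d = 0 then - (\<beta>2 x * \<eta>1 x * Q x)
        else if d = 1 then - (\<beta>1 x * \<eta>1 x * q x)
        else \<eta>1 x * U 1 x - \<beta>1 x * (\<eta>2 x * Q x - \<eta>1 x * QJ x))
     else (if d = 2 then \<eta>1 x * U 2 x else 0))"

definition dW where "dW d i x = \<eta> x * dU d i x + C d i x"

lemma eta_pd: "pd X 0 \<eta> (\<lambda>x. 0)" "pd X 1 \<eta> (\<lambda>x. 0)" "pd X 2 \<eta> \<eta>1"
  "pd X 0 \<eta>1 (\<lambda>x. 0)" "pd X 1 \<eta>1 (\<lambda>x. 0)" "pd X 2 \<eta>1 \<eta>2"
proof -
  have l0: "l > 0" using l by simp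
  have c: "continuous_on S (eta a l)" "continuous_on S (eta1 a l)" "continuous_on S (eta2 a l)" for S
    unfolding eta_def[abs_def] eta1_def[abs_def] eta2_def[abs_def] cutoff_def[abs_def]
    using l0 by (auto intro!: continuous_intros)
  show "pd X 0 \<eta> (\<lambda>x. 0)" "pd X 1 \<eta> (\<lambda>x. 0)" "pd X 2 \<eta> \<eta>1"
    "pd X 0 \<eta>1 (\<lambda>x. 0)" "pd X 1 \<eta>1 (\<lambda>x. 0)" "pd X 2 \<eta>1 \<eta>2"
    by (intro pd_fun_other pd_fun_same c DERIV_eta DERIV_eta1 l0; simp)+
qed

lemma bump_pd: "pd X 0 \<beta> \<beta>1" "pd X 1 \<beta> (\<lambda>x. 0)" "pd X 2 \<beta> (\<lambda>x. 0)"
  "pd X 0 \<beta>1 \<beta>2" "pd X 1 \<beta>1 (\<lambda>x. 0)" "pd X 2 \<beta>1 (\<lambda>x. 0)"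
proof -
  have c: "continuous_on S (bump R1 R2)" "continuous_on S (bump1 R1 R2)" "continuous_on S (bump2 R1 R2)" for S
    unfolding bump_def[abs_def] bump1_def[abs_def] bump2_def[abs_def] Let_def
    using R12 by (auto intro!: continuous_intros)
  show "pd X 0 \<beta> \<beta>1" "pd X 1 \<beta> (\<lambda>x. 0)" "pd X 2 \<beta> (\<lambda>x. 0)"
    "pd X 0 \<beta>1 \<beta>2" "pd X 1 \<beta>1 (\<lambda>x. 0)" "pd X 2 \<beta>1 (\<lambda>x. 0)"
    by (intro pd_fun_other pd_fun_same c DERIV_bump DERIV_bump1; simp)+
qed

lemma k_pd: "pd X 0 k (\<lambda>x. - (k x)\<^sup>2)" "pd X 1 k (\<lambda>x. 0)" "pd X 2 k (\<lambda>x. 0)"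
proof -
  have nz: "s \<noteq> 0" if "s \<in> co 0 ` X" for s using that co0_bounds(3) by force
  have c: "continuous_on (co 0 ` X) (\<lambda>s. 1 / s)" "continuous_on (co 0 ` X) (\<lambda>s. - (1 / s)\<^sup>2)"
    by (intro continuous_intros ballI nz; assumption)+
  have D: "((\<lambda>s. 1 / s) has_real_derivative - (1 / s)\<^sup>2) (at s)" if "s \<in> co 0 ` X" for s
    using nz[OF that] by (auto intro!: derivative_eq_intros simp: power2_eq_square)
  show "pd X 0 k (\<lambda>x. - (k x)\<^sup>2)" "pd X 1 k (\<lambda>x. 0)" "pd X 2 k (\<lambda>x. 0)"
    using pd_fun_same[OF _ c(2) D] pd_fun_other[OF _ _ _ c(1)] by auto
qed

lemmas W_intros = pd_add pd_diff pd_mult eta_pd bump_pd k_pd G_pd q_pd Q_pd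

lemma W_pd:
  assumes "d < 3" "i < 3"
  shows "pd X d (W i) (dW d i)"
proof -
  have r: "co 0 x \<noteq> 0" if "x \<in> X" for x using co0_bounds[OF that] by simp
  have W: "W 0 = (\<lambda>x. \<eta> x * U 0 x - \<eta>1 x * k x * (G x - \<beta> x * q x))"
    "W 1 = (\<lambda>x. \<eta> x * U 1 x - \<beta>1 x * \<eta>1 x * Q x)" "W 2 = (\<lambda>x. \<eta> x * U 2 x)"
    by (auto simp: W_def)
  have dW: "pd X 0 (W 0) (dW 0 0)" "pd X 1 (W 0) (dW 1 0)" "pd X 2 (W 0) (dW 2 0)"
    "pd X 0 (W 1) (dW 0 1)" "pd X 1 (W 1) (dW 1 1)" "pd X 2 (W 1) (dW 2 1)"
    "pd X 0 (W 2) (dW 0 2)" "pd X 1 (W 2) (dW 1 2)" "pd X 2 (W 2) (dW 2 2)"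
    unfolding W
    \<comment> \<open>The differentiation rules produce some derivative, and algebra then identifies
      it with \<open>dW\<close>.\<close>
    by (rule pd_cong', (rule W_intros | rule U_pd'; simp)+, simp add: dW_def C_def algebra_simps)+
  show ?thesis using assms dW by (elim less3_cases) simp_all
qed

lemma W_div: "x \<in> X \<Longrightarrow> W 0 x + co 0 x * dW 0 0 x + dW 1 1 x + co 0 x * dW 2 2 x = 0"
proof -
  assume x: "x \<in> X"
  have r: "co 0 x \<noteq> 0" using co0_bounds[OF x] by simp
  \<comment> \<open>The terms in \<open>\<eta>1\<close> cancel in pairs: the radial derivative of
    \<open>G\<close> against \<open>\<eta>1 x * U 2 x\<close>, and that of \<open>\<beta>\<close>
    times \<open>q\<close> against the angular derivative of \<open>Q\<close>.\<close>
  have "W 0 x + co 0 x * dW 0 0 x + dW 1 1 x + co 0 x * dW 2 2 x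
      = \<eta> x * (U 0 x + co 0 x * dU 0 0 x + dU 1 1 x + co 0 x * dU 2 2 x)"
    using r by (simp add: W_def dW_def C_def power2_eq_square field_simps)
  then show ?thesis using U_div[of x] x by (simp add: X_def)
qed

text \<open>At R1 both \<open>G\<close> and the profile vanish, at R2 the flux \<open>G\<close>
  equals \<open>q\<close> and the profile is 1, and the profile has zero slope at both ends. At the
  ends of the window the powers of the cutoff vanish. Periodicity of the angular component rests on
  \<open>Q_ends\<close>.\<close>

lemma test_field_W: "test_field R1 R2 (a - l) (a + l) W dW"
  unfolding test_field_def X_def[symmetric]
proof (intro conjI allI impI ballI)
  fix i :: nat and r z :: real assume i: "i < 3" and m: "r \<in> {R1..R2}" "z \<in> {a - l..a + l}"
  let ?x = "(r, 0, z)"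
  have x: "?x \<in> X" using m l by (simp add: X_def mem_box3)
  have u: "upd 1 ?x (2 * pi) = (r, 2 * pi, z)" "upd 1 ?x 0 = (r, 0, z)" by (auto simp: upd_def)
  have "q (r, 2 * pi, z) = q (r, 0, z)" "G (r, 2 * pi, z) = G (r, 0, z)"
  proof -
    have "U 2 (s, 2 * pi, z) = U 2 (s, 0, z)" if "s \<in> {R1..R2}" for s
      using U_per[of 2 "(s, 0, z)"] that m l by (simp add: X_def mem_box3 upd_def)
    then show "q (r, 2 * pi, z) = q (r, 0, z)" "G (r, 2 * pi, z) = G (r, 0, z)"
      using m by (auto simp: q_def G_def prim_def slice_int_def upd_def co_def intro!: integral_cong)
  qed
  moreover have "Q (r, 2 * pi, z) = Q (r, 0, z)" using Q_ends[OF x] u by simp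
  moreover have "U j (r, 2 * pi, z) = U j (r, 0, z)" if "j < 3" for j
    using U_per[of j ?x] x u that by (simp add: X_def)
  ultimately show "W i (r, 2 * pi, z) = W i (r, 0, z)"
    by (simp add: W_def co_def)
next
  fix i :: nat and \<theta> z :: real assume i: "i < 3" and m: "\<theta> \<in> {0..2 * pi}" "z \<in> {a - l..a + l}"
  have x: "(R1, \<theta>, z) \<in> X" "(R2, \<theta>, z) \<in> X" using m R12 by (auto simp: X_def mem_box3)
  have "U j (R1, \<theta>, z) = 0" "U j (R2, \<theta>, z) = 0" if "j < 3" for j
    using U_bc[of j "(R1, \<theta>, z)"] U_bc[of j "(R2, \<theta>, z)"] x that by (auto simp: X_def co_def)
  moreover have "G (R1, \<theta>, z) = 0" "G (R2, \<theta>, z) = q (R2, \<theta>, z)"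
    by (auto simp: q_eq G_def prim_def co_def upd_def)
  ultimately show "W i (R1, \<theta>, z) = 0" "W i (R2, \<theta>, z) = 0"
    using bump_ends[OF R12] by (auto simp: W_def co_def)
next
  fix i :: nat and r \<theta> :: real
  have "cutoff a l (a - l) = 0" "cutoff a l (a + l) = 0" using l by (auto simp: cutoff_def)
  then show "W i (r, \<theta>, a - l) = 0" "W i (r, \<theta>, a + l) = 0"
    by (auto simp: W_def eta_def eta1_def co_def)
qed (use W_pd W_div in auto)

section \<open>Pointwise size of the corrector\<close>

definition e where "e x = (\<Sum>i<3. (U i x)\<^sup>2 + (dU 1 i x)\<^sup>2)"
definition m where "m = slice_int 0 R1 R2 e"
definition \<mu> where "\<mu> = slice_int 1 0 (2 * pi) m"
text \<open>A common majorant for the squares of \<open>U\<close> and of all flux quantities. The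
  factor collects M^2 from the weight r, M from the width of the annulus, and 8 > 2 pi from the
  angular primitive. The fluxes are nonlocal, hence the line and sector integrals \<open>m\<close>
  and \<open>\<mu>\<close> next to the density \<open>e\<close>.\<close>

definition N2 where "N2 x = 8 * M ^ 3 * (e x + m x + \<mu> x)"
definition N where "N x = sqrt (N2 x)"

lemma e_cont: "continuous_on X e"
  unfolding e_def[abs_def] by (intro continuous_intros U_cont dU_cont) auto

lemma m_cont: "continuous_on X m"
  using continuous_on_slice_int[OF X e_cont, of 0] by (simp add: m_def)

lemma \<mu>_cont: "continuous_on X \<mu>"
  using continuous_on_slice_int[OF X m_cont, of 1] by (simp add: \<mu>_def)

lemma e_ge: "i < 3 \<Longrightarrow> (U i x)\<^sup>2 \<le> e x" "i < 3 \<Longrightarrow> (dU 1 i x)\<^sup>2 \<le> e x" "0 \<le> e x"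
proof -
  have "(U i x)\<^sup>2 + (dU 1 i x)\<^sup>2 \<le> e x" if "i < 3" for i
    unfolding e_def by (rule member_le_sum) (use that in auto)
  then show "i < 3 \<Longrightarrow> (U i x)\<^sup>2 \<le> e x" "i < 3 \<Longrightarrow> (dU 1 i x)\<^sup>2 \<le> e x"
    using zero_le_power2[of "U i x"] zero_le_power2[of "dU 1 i x"] by (smt (verit))+
  show "0 \<le> e x" unfolding e_def by (intro sum_nonneg) auto
qed

lemma m_nonneg: "x \<in> X \<Longrightarrow> 0 \<le> m x"
  unfolding m_def slice_int_def
  by (intro integral_nonneg integrable_continuous_real continuous_on_line[OF X e_cont, of _ 0, simplified] e_ge)

lemma \<mu>_nonneg: "x \<in> X \<Longrightarrow> 0 \<le> \<mu> x"
  unfolding \<mu>_def slice_int_def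
  by (intro integral_nonneg integrable_continuous_real continuous_on_line[OF X m_cont, of _ 1, simplified] m_nonneg)
    (use boxlike_mem[OF X, of x 1] in auto)

end

lemma abs_add_le: "\<bar>a\<bar> \<le> A \<Longrightarrow> \<bar>b\<bar> \<le> B \<Longrightarrow> \<bar>a + b\<bar> \<le> A + (B::real)"
  and abs_diff_le: "\<bar>a\<bar> \<le> A \<Longrightarrow> \<bar>b\<bar> \<le> B \<Longrightarrow> \<bar>a - b\<bar> \<le> A + (B::real)"
  by linarith+

context stokes_window
begin

lemma F_cont': "d < 3 \<Longrightarrow> i < 3 \<Longrightarrow> continuous_on X (F d i)"
  using F_cont by (simp add: X_def)

lemma abs_le_N: "x \<in> X \<Longrightarrow> (f x)\<^sup>2 \<le> N2 x \<Longrightarrow> \<bar>f x\<bar> \<le> N x"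
  using real_sqrt_le_mono[of "(f x)\<^sup>2" "N2 x"] by (simp add: N_def)

lemma M3: "1 \<le> M ^ 3" "M \<le> M\<^sup>2" "1 \<le> M\<^sup>2"
  using M(1) self_le_power[of M 2] by (auto simp: one_le_power)

lemma N2_ge:
  assumes "x \<in> X"
  shows "M ^ 3 * e x \<le> N2 x" "M ^ 3 * m x \<le> N2 x" "8 * M ^ 3 * \<mu> x \<le> N2 x"
proof -
  have "0 \<le> M ^ 3 * e x" "0 \<le> M ^ 3 * m x" "0 \<le> M ^ 3 * \<mu> x"
    using M3 M_pos e_ge(3) m_nonneg[OF assms] \<mu>_nonneg[OF assms] by auto
  moreover have "N2 x = 8 * (M ^ 3 * e x) + 8 * (M ^ 3 * m x) + 8 * (M ^ 3 * \<mu> x)"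
    by (simp add: N2_def distrib_left)
  ultimately show "M ^ 3 * e x \<le> N2 x" "M ^ 3 * m x \<le> N2 x" "8 * M ^ 3 * \<mu> x \<le> N2 x"
    by linarith+
qed

lemma integrand_square_le:
  assumes "x \<in> X"
  shows "(co 0 x * U 2 x)\<^sup>2 \<le> M\<^sup>2 * e x" "(co 0 x * dU 1 2 x)\<^sup>2 \<le> M\<^sup>2 * e x" "(dU 1 1 x)\<^sup>2 \<le> M\<^sup>2 * e x"
proof -
  have r: "(co 0 x)\<^sup>2 \<le> M\<^sup>2" using co0_bounds[OF assms] by (intro power_mono) auto
  show "(co 0 x * U 2 x)\<^sup>2 \<le> M\<^sup>2 * e x" "(co 0 x * dU 1 2 x)\<^sup>2 \<le> M\<^sup>2 * e x"
    unfolding power_mult_distrib by (intro mult_mono r e_ge; simp)+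
  have "1 * (dU 1 1 x)\<^sup>2 \<le> M\<^sup>2 * e x" using M3 e_ge by (intro mult_mono) auto
  then show "(dU 1 1 x)\<^sup>2 \<le> M\<^sup>2 * e x" by simp
qed

lemma width_le: "x \<in> X \<Longrightarrow> (R2 - R1) * M\<^sup>2 * m x \<le> M ^ 3 * m x"
  using R1 M m_nonneg M_pos
  by (intro mult_right_mono) (auto simp: power2_eq_square power3_eq_cube)

lemma prim_bounds:
  assumes x: "x \<in> X"
  shows "(G x)\<^sup>2 \<le> M ^ 3 * m x" "(Gt x)\<^sup>2 \<le> M ^ 3 * m x" "(J x)\<^sup>2 \<le> M ^ 3 * m x"
    "(q x)\<^sup>2 \<le> M ^ 3 * m x" "(qt x)\<^sup>2 \<le> M ^ 3 * m x" "(qJ x)\<^sup>2 \<le> M ^ 3 * m x"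
proof -
  have c: "continuous_on X (\<lambda>x. co 0 x * dU 1 2 x)" "continuous_on X (dU 1 1)"
    by (intro continuous_intros dU_cont; simp)+
  note p = prim_square_le[OF X _ _ e_cont _ x, of 0, simplified, folded m_def]
    and s = slice_int_square_le[OF X _ _ e_cont _ x, of 0, simplified, folded m_def]
  show "(G x)\<^sup>2 \<le> M ^ 3 * m x" "(Gt x)\<^sup>2 \<le> M ^ 3 * m x" "(J x)\<^sup>2 \<le> M ^ 3 * m x"
    unfolding G_def Gt_def J_def using p[OF rU_cont integrand_square_le(1)] p[OF c(1) integrand_square_le(2)]
      p[OF c(2) integrand_square_le(3)] width_le[OF x] by linarith+
  show "(q x)\<^sup>2 \<le> M ^ 3 * m x" "(qt x)\<^sup>2 \<le> M ^ 3 * m x" "(qJ x)\<^sup>2 \<le> M ^ 3 * m x"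
    unfolding q_def qt_def qJ_def using s[OF rU_cont integrand_square_le(1)] s[OF c(1) integrand_square_le(2)]
      s[OF c(2) integrand_square_le(3)] width_le[OF x] by linarith+
qed

lemma qJ_cont: "continuous_on X qJ"
  using pdD2[OF q_pd(3)] continuous_on_minus[of X "\<lambda>x. - qJ x"] by simp

text \<open>A second use of Cauchy-Schwarz, now over the full circle, whose length 2 pi is below
  8.\<close>

lemma Q_bounds:
  assumes x: "x \<in> X"
  shows "(Q x)\<^sup>2 \<le> 8 * M ^ 3 * \<mu> x" "(QJ x)\<^sup>2 \<le> 8 * M ^ 3 * \<mu> x"
proof -
  note p = prim_square_le[OF X _ _ m_cont _ x, of 1, simplified, folded \<mu>_def]
  have "2 * pi * M ^ 3 * \<mu> x \<le> 8 * M ^ 3 * \<mu> x"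
    using \<mu>_nonneg[OF x] M_pos pi_less_4 by (intro mult_right_mono) auto
  then show "(Q x)\<^sup>2 \<le> 8 * M ^ 3 * \<mu> x" "(QJ x)\<^sup>2 \<le> 8 * M ^ 3 * \<mu> x"
    unfolding Q_def QJ_def using p[OF pdD1[OF q_pd(1)] prim_bounds(4)] p[OF qJ_cont prim_bounds(6)] by linarith+
qed

lemma le_N:
  assumes x: "x \<in> X"
  shows "i < 3 \<Longrightarrow> \<bar>U i x\<bar> \<le> N x" "\<bar>G x\<bar> \<le> N x" "\<bar>Gt x\<bar> \<le> N x" "\<bar>J x\<bar> \<le> N x"
    "\<bar>q x\<bar> \<le> N x" "\<bar>qt x\<bar> \<le> N x" "\<bar>qJ x\<bar> \<le> N x" "\<bar>Q x\<bar> \<le> N x" "\<bar>QJ x\<bar> \<le> N x"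
proof -
  note ge = N2_ge[OF x]
  have "1 * (U i x)\<^sup>2 \<le> M ^ 3 * e x" if "i < 3"
    using that M3 M_pos by (intro mult_mono e_ge) auto
  then show "\<bar>U i x\<bar> \<le> N x" if "i < 3" using ge(1) that by (intro abs_le_N x) auto
  show "\<bar>G x\<bar> \<le> N x" "\<bar>Gt x\<bar> \<le> N x" "\<bar>J x\<bar> \<le> N x" "\<bar>q x\<bar> \<le> N x" "\<bar>qt x\<bar> \<le> N x" "\<bar>qJ x\<bar> \<le> N x"
    by (rule abs_le_N[OF x order.trans[OF _ ge(2)]]; rule prim_bounds[OF x])+
  show "\<bar>Q x\<bar> \<le> N x" "\<bar>QJ x\<bar> \<le> N x"
    by (rule abs_le_N[OF x order.trans[OF _ ge(3)]]; rule Q_bounds[OF x])+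
qed

text \<open>The corrector itself. \<open>C\<close> is not its derivative alone, since it also
  contains \<open>\<eta>1\<close> times \<open>U\<close> from the truncation. Thus
  \<open>grad S C\<close> is what remains of the gradient of \<open>W\<close> besides
  \<open>\<eta>\<close> times that of \<open>U\<close>.\<close>

definition S where "S i x = W i x - \<eta> x * U i x"

definition eps where "eps x = 56 / l * (cutoff a l (co 2 x))\<^sup>2"

text \<open>Every entry is a first or second derivative of the cutoff times quantities below
  \<open>N\<close>, with coefficients made of 1 / r <= M and of the derivatives of the profile, at
  most 2 M and 6 M^2. Since \<open>1 \<le> M\<close>, all of them fit under 6 M^2.\<close>

lemma corrector_bound:
  assumes x: "x \<in> X" and "d < 3" "i < 3"
  shows "\<bar>grad S C d i x\<bar> \<le> 6 * M\<^sup>2 * eps x * N x"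
proof -
  let ?g = "N x" and ?E = "eps x"
  have r: "0 < co 0 x" using co0_bounds[OF x] by simp
  have z: "\<bar>co 2 x - a\<bar> \<le> l" using boxlike_co[OF X x, of 2] by (simp add: abs_le_iff)
  have E: "\<bar>\<eta>1 x\<bar> \<le> ?E" "\<bar>\<eta>2 x\<bar> \<le> ?E" using eta_bounds[OF l z] by (auto simp: eps_def)
  have E0: "0 \<le> ?E" using l by (simp add: eps_def)
  have g0: "0 \<le> ?g" using le_N(2)[OF x] by linarith
  have k: "\<bar>k x\<bar> \<le> M" "\<bar>(k x)\<^sup>2\<bar> \<le> M\<^sup>2"
    using co0_bounds[OF x] by (auto intro!: power_mono)
  have b: "\<bar>\<beta> x\<bar> \<le> 1" "\<bar>\<beta>1 x\<bar> \<le> 2 * M" "\<bar>\<beta>2 x\<bar> \<le> 6 * M\<^sup>2"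
    using bump_bounds[OF R12 co0_bounds(1,2)[OF x] M(4)] by auto
  note n = le_N[OF x]
  have MM: "?g \<le> M * ?g" "M * ?g \<le> M\<^sup>2 * ?g" "?g \<le> M\<^sup>2 * ?g"
    using M M3 g0 by (auto intro: mult_right_mono simp: mult_le_cancel_right1)
  have P0: "0 \<le> M\<^sup>2 * ?g" and MMg: "M * (2 * M * ?g) = 2 * (M\<^sup>2 * ?g)" "M\<^sup>2 * (2 * ?g) = 2 * (M\<^sup>2 * ?g)"
    using g0 by (auto simp: power2_eq_square)
  have fin: "\<bar>A\<bar> \<le> 6 * M\<^sup>2 * ?E * ?g" if "\<bar>A\<bar> \<le> ?E * B" "B \<le> 6 * (M\<^sup>2 * ?g)" for A B
    using that(1) mult_left_mono[OF that(2) E0] by (simp add: mult_ac)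
  have G: "\<bar>G x - \<beta> x * q x\<bar> \<le> 2 * ?g" "\<bar>Gt x - \<beta> x * qt x\<bar> \<le> 2 * ?g" "\<bar>- J x + \<beta> x * qJ x\<bar> \<le> 2 * ?g"
    using abs_mult_le[OF b(1) n(5)] abs_mult_le[OF b(1) n(6)] abs_mult_le[OF b(1) n(7)] n(2-4) by linarith+
  have kG: "\<bar>k x * (G x - \<beta> x * q x)\<bar> \<le> M * (2 * ?g)" "\<bar>k x * (Gt x - \<beta> x * qt x)\<bar> \<le> M * (2 * ?g)"
    "\<bar>k x * (- J x + \<beta> x * qJ x)\<bar> \<le> M * (2 * ?g)" "\<bar>(k x)\<^sup>2 * (G x - \<beta> x * q x)\<bar> \<le> M\<^sup>2 * (2 * ?g)"
    by (intro abs_mult_le k G)+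
  have bq: "\<bar>\<beta>1 x * q x\<bar> \<le> 2 * M * ?g" "\<bar>\<beta>1 x * Q x\<bar> \<le> 2 * M * ?g" "\<bar>\<beta>1 x * QJ x\<bar> \<le> 2 * M * ?g"
    "\<bar>\<beta>2 x * Q x\<bar> \<le> 6 * M\<^sup>2 * ?g"
    by (intro abs_mult_le b n)+
  have kbq: "\<bar>k x * (\<beta>1 x * q x)\<bar> \<le> M * (2 * M * ?g)" by (intro abs_mult_le k bq)
  have U: "\<bar>U 0 x\<bar> \<le> ?g" "\<bar>U 1 x\<bar> \<le> ?g" "\<bar>U 2 x\<bar> \<le> ?g" by (intro n; simp)+
  have S: "S 0 x = - (\<eta>1 x * (k x * (G x - \<beta> x * q x)))" "S 1 x = - (\<eta>1 x * (\<beta>1 x * Q x))"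
    by (auto simp: S_def W_def)
  \<comment> \<open>The frame terms are merged here. In entry 2 0 the radial velocity occurs twice,
    once from the truncation and once from the z-derivative of \<open>G\<close>.\<close>
  have eq:
    "grad S C 0 0 x = \<eta>1 x * ((k x)\<^sup>2 * (G x - \<beta> x * q x) - (U 2 x - k x * (\<beta>1 x * q x)))"
    "grad S C 0 1 x = \<eta>1 x * (- (\<beta>2 x * Q x))" "grad S C 0 2 x = 0"
    "grad S C 1 0 x = \<eta>1 x * (k x * (- (k x * (Gt x - \<beta> x * qt x)) + \<beta>1 x * Q x))"
    "grad S C 1 1 x = \<eta>1 x * (k x * (- (\<beta>1 x * q x) - k x * (G x - \<beta> x * q x)))"
    "grad S C 1 2 x = 0"
    "grad S C 2 0 x = (\<eta>1 x * (2 * U 0 x - k x * (- J x + \<beta> x * qJ x))) - \<eta>2 x * (k x * (G x - \<beta> x * q x))"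
    "grad S C 2 1 x = \<eta>1 x * (U 1 x + \<beta>1 x * QJ x) - \<eta>2 x * (\<beta>1 x * Q x)"
    "grad S C 2 2 x = \<eta>1 x * U 2 x"
    using r unfolding grad_def tens_def S by (auto simp: C_def field_simps power2_eq_square)
  have "\<bar>grad S C 0 0 x\<bar> \<le> 6 * M\<^sup>2 * ?E * ?g"
  proof -
    have "M\<^sup>2 * (2 * ?g) + (?g + M * (2 * M * ?g)) \<le> 6 * (M\<^sup>2 * ?g)"
      unfolding MMg using MM(3) P0 by linarith
    then show ?thesis
      unfolding eq by (rule fin[OF abs_mult_le[OF E(1) abs_diff_le[OF kG(4) abs_diff_le[OF U(3) kbq]]]])
  qed
  moreover have "\<bar>grad S C 0 1 x\<bar> \<le> 6 * M\<^sup>2 * ?E * ?g"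
    unfolding eq by (rule fin[OF abs_mult_le[OF E(1), of _ "6 * M\<^sup>2 * ?g"]]) (use bq in simp_all)
  moreover have "\<bar>grad S C 1 0 x\<bar> \<le> 6 * M\<^sup>2 * ?E * ?g"
    unfolding eq
    by (rule fin[OF abs_mult_le[OF E(1) abs_mult_le[OF k(1) abs_add_le[OF _ bq(2)], of _ "M * (2 * ?g)"]]])
      (use kG(2) MM g0 in \<open>simp_all add: power2_eq_square algebra_simps\<close>)
  moreover have "\<bar>grad S C 1 1 x\<bar> \<le> 6 * M\<^sup>2 * ?E * ?g"
    unfolding eq
    by (rule fin[OF abs_mult_le[OF E(1) abs_mult_le[OF k(1) abs_diff_le[OF _ kG(1)], of _ "2 * M * ?g"]]])
      (use bq(1) MM g0 in \<open>simp_all add: power2_eq_square algebra_simps\<close>)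
  moreover have "\<bar>grad S C 2 0 x\<bar> \<le> 6 * M\<^sup>2 * ?E * ?g"
  proof -
    have "\<bar>2 * U 0 x - k x * (- J x + \<beta> x * qJ x)\<bar> \<le> 2 * ?g + M * (2 * ?g)"
      using U(1) kG(3) by linarith
    from abs_diff_le[OF abs_mult_le[OF E(1) this] abs_mult_le[OF E(2) kG(1)]]
    have "\<bar>grad S C 2 0 x\<bar> \<le> ?E * ((2 * ?g + M * (2 * ?g)) + M * (2 * ?g))"
      unfolding eq distrib_left[of ?E] .
    moreover have "(2 * ?g + M * (2 * ?g)) + M * (2 * ?g) \<le> 6 * (M\<^sup>2 * ?g)"
      using MM by simp
    ultimately show ?thesis by (rule fin)
  qed
  moreover have "\<bar>grad S C 2 1 x\<bar> \<le> 6 * M\<^sup>2 * ?E * ?g"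
  proof -
    have "(?g + 2 * M * ?g) + 2 * M * ?g \<le> 6 * (M\<^sup>2 * ?g)"
      using MM P0 by linarith
    moreover have "\<bar>grad S C 2 1 x\<bar> \<le> ?E * ((?g + 2 * M * ?g) + 2 * M * ?g)"
      using abs_diff_le[OF abs_mult_le[OF E(1) abs_add_le[OF U(2) bq(3)]] abs_mult_le[OF E(2) bq(2)]]
      unfolding eq distrib_left[of ?E] .
    ultimately show ?thesis by (rule fin[rotated])
  qed
  moreover have "\<bar>grad S C 2 2 x\<bar> \<le> 6 * M\<^sup>2 * ?E * ?g"
    unfolding eq by (rule fin[OF abs_mult_le[OF E(1) U(3)]]) (use MM(3) P0 in linarith)
  moreover have "\<bar>grad S C 0 2 x\<bar> \<le> 6 * M\<^sup>2 * ?E * ?g" "\<bar>grad S C 1 2 x\<bar> \<le> 6 * M\<^sup>2 * ?E * ?g"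
    using E0 g0 by (auto simp: eq(3,6))
  ultimately show ?thesis
    using assms(2,3) by (elim less3_cases) (simp_all only:)
qed

lemma grad_W: "grad W dW d i x = \<eta> x * grad U dU d i x + grad S C d i x"
  by (simp add: grad_def tens_def S_def dW_def algebra_simps add_divide_distrib diff_divide_distrib)

lemma grad_cont: "d < 3 \<Longrightarrow> i < 3 \<Longrightarrow> continuous_on X (grad U dU d i)"
proof -
  assume di: "d < 3" "i < 3"
  have nz: "co 0 x \<noteq> 0" if "x \<in> X" for x using co0_bounds[OF that] by simp
  have "continuous_on X (\<lambda>x. tens (co 0 x) (\<lambda>i. U i x) (\<lambda>d i. dU d i x) d i)"
    unfolding tens_def using di by (cases "d = 1"; cases "i = 0"; cases "i = 1")
      (auto intro!: continuous_intros U_cont dU_cont simp: nz)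
  then show ?thesis by (simp add: grad_def[abs_def])
qed

section \<open>The energy inequality in one window\<close>

definition normg where "normg x = (\<Sum>d<3. \<Sum>i<3. (grad U dU d i x)\<^sup>2)"
definition normF where "normF x = (\<Sum>d<3. \<Sum>i<3. (F d i x)\<^sup>2)"

lemma normg_cont: "continuous_on X normg" and normF_cont: "continuous_on X normF"
  unfolding normg_def[abs_def] normF_def[abs_def]
  by (auto intro!: continuous_intros grad_cont F_cont')

lemma N2_cont: "continuous_on X N2"
  unfolding N2_def[abs_def] by (intro continuous_intros e_cont m_cont \<mu>_cont)

lemma N2_nonneg: "x \<in> X \<Longrightarrow> 0 \<le> N2 x"
  unfolding N2_def using M_pos e_ge(3) m_nonneg \<mu>_nonneg by (intro mult_nonneg_nonneg add_nonneg_nonneg) auto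

text \<open>Sum of nine instances of \<open>energy_pointwise\<close>, so 45 / 4 is 9 times 5 / 4,
  and 336 is 6 * 56 from \<open>corrector_bound\<close> and the cutoff. The weight r is bounded
  below by 1 / M in the gradient term and above by M in the others.\<close>

lemma pointwise_energy:
  assumes x: "x \<in> X"
  shows "\<nu> / (2 * M) * (\<eta> x * normg x) - 2 * M / \<nu> * normF x - 45 / 4 * \<nu> * M * (336 * M\<^sup>2 / l)\<^sup>2 * N2 x
    \<le> co 0 x * (\<Sum>d<3. \<Sum>i<3. (\<nu> * grad U dU d i x - F d i x) * grad W dW d i x)"
proof -
  let ?b = "336 * M\<^sup>2 / l * N x" and ?y = "(cutoff a l (co 2 x))\<^sup>2"
  have z: "\<bar>co 2 x - a\<bar> \<le> l" using boxlike_co[OF X x, of 2] by (simp add: abs_le_iff)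
  have c: "0 \<le> cutoff a l (co 2 x)" "cutoff a l (co 2 x) \<le> 1" using cutoff_bounds[OF _ z] l by auto
  have y: "?y\<^sup>2 = \<eta> x" by (simp add: eta_def flip: power_mult)
  have eta1: "0 \<le> \<eta> x" "\<eta> x \<le> 1" using c by (auto simp: eta_def power_le_one)
  have b2: "?b\<^sup>2 = (336 * M\<^sup>2 / l)\<^sup>2 * N2 x"
    using N2_nonneg[OF x] by (simp add: N_def power_mult_distrib power_divide)
  have "\<nu> / 2 * (\<eta> x * (grad U dU d i x)\<^sup>2) - 2 / \<nu> * (\<eta> x * (F d i x)\<^sup>2) - 5 / 4 * \<nu> * ?b\<^sup>2
      \<le> (\<nu> * grad U dU d i x - F d i x) * grad W dW d i x" if "d < 3" "i < 3" for d i
    unfolding grad_W y[symmetric]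
    by (rule energy_pointwise[OF nu])
      (use corrector_bound[OF x that] in \<open>auto simp: eps_def mult_ac\<close>)
  then have "(\<Sum>d<3. \<Sum>i<3. \<nu> / 2 * (\<eta> x * (grad U dU d i x)\<^sup>2) - 2 / \<nu> * (\<eta> x * (F d i x)\<^sup>2) - 5 / 4 * \<nu> * ?b\<^sup>2)
      \<le> (\<Sum>d<3. \<Sum>i<3. (\<nu> * grad U dU d i x - F d i x) * grad W dW d i x)"
    by (intro sum_mono) auto
  moreover have "(\<Sum>d<3. \<Sum>i<3. \<nu> / 2 * (\<eta> x * (grad U dU d i x)\<^sup>2) - 2 / \<nu> * (\<eta> x * (F d i x)\<^sup>2) - 5 / 4 * \<nu> * ?b\<^sup>2)
      = \<nu> / 2 * (\<eta> x * normg x) - 2 / \<nu> * (\<eta> x * normF x) - 45 / 4 * \<nu> * ?b\<^sup>2"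
    unfolding normg_def normF_def sum3 by (simp add: algebra_simps)
  ultimately have le: "\<nu> / 2 * (\<eta> x * normg x) - 2 / \<nu> * (\<eta> x * normF x) - 45 / 4 * \<nu> * ?b\<^sup>2
      \<le> (\<Sum>d<3. \<Sum>i<3. (\<nu> * grad U dU d i x - F d i x) * grad W dW d i x)" by simp
  have nn: "0 \<le> normg x" "0 \<le> normF x" by (auto simp: normg_def normF_def intro!: sum_nonneg)
  note r = co0_bounds[OF x]
  have r1: "1 / M \<le> co 0 x" using r M_pos by (simp add: field_simps)
  have "1 / M * (\<nu> / 2 * (\<eta> x * normg x)) \<le> co 0 x * (\<nu> / 2 * (\<eta> x * normg x))"
    using r1 nu eta1 nn by (intro mult_right_mono) auto
  moreover have "co 0 x * (2 / \<nu> * (\<eta> x * normF x)) \<le> M * (2 / \<nu> * (1 * normF x))"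
    using r nu eta1 nn by (intro mult_mono mult_nonneg_nonneg) auto
  moreover have "co 0 x * (45 / 4 * \<nu> * ?b\<^sup>2) \<le> M * (45 / 4 * \<nu> * ?b\<^sup>2)"
    using r nu by (intro mult_right_mono) auto
  ultimately have "\<nu> / (2 * M) * (\<eta> x * normg x) - 2 * M / \<nu> * normF x - 45 / 4 * \<nu> * M * ?b\<^sup>2
      \<le> co 0 x * (\<nu> / 2 * (\<eta> x * normg x) - 2 / \<nu> * (\<eta> x * normF x) - 45 / 4 * \<nu> * ?b\<^sup>2)"
    by (simp add: right_diff_distrib mult_ac)
  also have "\<dots> \<le> co 0 x * (\<Sum>d<3. \<Sum>i<3. (\<nu> * grad U dU d i x - F d i x) * grad W dW d i x)"
    using le r by (intro mult_left_mono) auto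
  finally show ?thesis unfolding b2 by (simp add: mult_ac)
qed

text \<open>Partial integrals turn back into multiples of the integral of \<open>e\<close>: the
  factors 1, R2 - R1 and 2 pi (R2 - R1) are at most M, M and 8 M. They add up to 10 M, multiplied by
  the 8 M^3 of \<open>N2\<close>.\<close>

lemma integral_N2: "integral X N2 \<le> 80 * M ^ 4 * integral X e"
proof -
  have i: "e integrable_on X" "m integrable_on X" "\<mu> integrable_on X"
    using e_cont m_cont \<mu>_cont by (auto simp: X_def intro!: integrable_continuous)
  have I0: "0 \<le> integral X e" by (rule integral_nonneg[OF i(1)]) (rule e_ge)
  have m: "integral X m = (R2 - R1) * integral X e"
    unfolding m_def X_def using R12 e_cont by (intro integral_slice_int_0) (auto simp: X_def)
  have "integral X \<mu> = (2 * pi - 0) * integral X m"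
    unfolding \<mu>_def X_def using m_cont by (intro integral_slice_int_1) (auto simp: X_def)
  then have \<mu>: "integral X \<mu> = 2 * pi * (R2 - R1) * integral X e" by (simp add: m)
  have w: "0 \<le> R2 - R1" "R2 - R1 \<le> M" using R1 R12 M by auto
  have "(R2 - R1) * integral X e \<le> M * integral X e" using w I0 by (intro mult_right_mono)
  moreover have "2 * pi * (R2 - R1) * integral X e \<le> 8 * M * integral X e"
    using w I0 pi_less_4 by (intro mult_right_mono mult_mono) auto
  moreover have "integral X e \<le> M * integral X e" using M I0 by (simp add: mult_le_cancel_right1)
  ultimately have "integral X e + integral X m + integral X \<mu> \<le> 10 * M * integral X e"
    unfolding m \<mu> by (simp add: distrib_right)
  then have "8 * M ^ 3 * (integral X e + integral X m + integral X \<mu>) \<le> 8 * M ^ 3 * (10 * M * integral X e)"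
    using M_pos by (intro mult_left_mono) auto
  also have "8 * M ^ 3 * (integral X e + integral X m + integral X \<mu>) = integral X N2"
    unfolding N2_def[abs_def] using i by (simp add: integral_add integrable_add)
  finally show ?thesis by (simp add: power3_eq_cube power4_eq_xxxx mult_ac)
qed

lemma normg_nonneg: "0 \<le> normg x"
  by (auto simp: normg_def intro!: sum_nonneg)

lemma eta_normg_cont: "continuous_on X (\<lambda>x. \<eta> x * normg x)"
  by (intro continuous_intros normg_cont pdD1[OF eta_pd(1)])

lemma half_window_le:
  "1 / 4 * integral (window R1 R2 a (l / 2)) normg
   \<le> integral X (\<lambda>x. \<eta> x * normg x)"
proof -
  let ?Y = "window R1 R2 a (l / 2)"
  have YX: "?Y \<subseteq> X" using l unfolding X_def by (auto simp: mem_box3)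
  have le: "1 / 4 * normg x \<le> \<eta> x * normg x" if "x \<in> ?Y" for x
  proof -
    have z: "a - l / 2 \<le> co 2 x" "co 2 x \<le> a + l / 2" using that unfolding mem_box3' by blast+
    have "\<bar>co 2 x - a\<bar> \<le> l / 2" using z by linarith
    then have "1 / 4 \<le> \<eta> x" by (rule eta_ge_quarter[OF less_le_trans[OF zero_less_one l]])
    then show ?thesis by (rule mult_right_mono[OF _ normg_nonneg])
  qed
  have en: "\<forall>x\<in>X. 0 \<le> \<eta> x * normg x"
  proof
    fix x assume x: "x \<in> X"
    have "\<bar>co 2 x - a\<bar> \<le> l" using boxlike_co[OF X x, of 2] by (simp add: abs_le_iff)
    then have "0 \<le> cutoff a l (co 2 x)" using cutoff_bounds(1)[of l "co 2 x" a] l by simp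
    then have "0 \<le> \<eta> x" by (simp add: eta_def)
    then show "0 \<le> \<eta> x * normg x" by (intro mult_nonneg_nonneg normg_nonneg)
  qed
  have iX: "(\<lambda>x. \<eta> x * normg x) integrable_on X"
    using eta_normg_cont unfolding X_def by (rule integrable_continuous)
  have iY: "(\<lambda>x. \<eta> x * normg x) integrable_on ?Y"
    by (rule integrable_continuous[OF continuous_on_subset[OF eta_normg_cont YX]])
  have iN: "(\<lambda>x. 1 / 4 * normg x) integrable_on ?Y"
    by (rule integrable_continuous[OF continuous_on_mult[OF continuous_on_const continuous_on_subset[OF normg_cont YX]]])
  have "integral ?Y (\<lambda>x. 1 / 4 * normg x) \<le> integral ?Y (\<lambda>x. \<eta> x * normg x)"
    by (rule integral_le[OF iN iY le])
  also have "\<dots> \<le> integral X (\<lambda>x. \<eta> x * normg x)"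
    by (rule integral_subset_le[OF YX iY iX en])
  finally show ?thesis unfolding integral_mult_right .
qed

lemma local_energy_estimate:
  "integral (window R1 R2 a (l / 2)) normg
   \<le> 16 * M\<^sup>2 / \<nu>\<^sup>2 * integral X normF + 90 * M\<^sup>2 * (336 * M\<^sup>2)\<^sup>2 * (80 * M ^ 4) / l\<^sup>2 * integral X e"
proof -
  let ?c = "45 / 4 * \<nu> * M * (336 * M\<^sup>2 / l)\<^sup>2"
  note ec = eta_normg_cont
  have i: "(\<lambda>x. \<eta> x * normg x) integrable_on X" "normF integrable_on X" "N2 integrable_on X" "normg integrable_on X"
    using ec normF_cont N2_cont normg_cont by (auto simp: X_def intro!: integrable_continuous)
  have W_cont: "continuous_on X (W i)" if "i < 3" for i using pdD1[OF W_pd[of 0 i]] that by simp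
  have nz: "co 0 x \<noteq> 0" if "x \<in> X" for x using co0_bounds[OF that] by simp
  have gW: "continuous_on X (grad W dW d i)" if "d < 3" "i < 3" for d i
    unfolding grad_def[abs_def] tens_def using that by (cases "d = 1"; cases "i = 0"; cases "i = 1")
      (auto intro!: continuous_intros W_cont pdD2[OF W_pd] simp: nz)
  have cr: "continuous_on X (\<lambda>x. co 0 x * (\<Sum>d<3. \<Sum>i<3. (\<nu> * grad U dU d i x - F d i x) * grad W dW d i x))"
    by (auto intro!: continuous_intros gW grad_cont F_cont')
  have cl: "continuous_on X (\<lambda>x. \<nu> / (2 * M) * (\<eta> x * normg x) - 2 * M / \<nu> * normF x - ?c * N2 x)"
    by (intro continuous_on_diff continuous_on_mult[OF continuous_on_const] ec normF_cont N2_cont)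
  have "integral X (\<lambda>x. \<nu> / (2 * M) * (\<eta> x * normg x) - 2 * M / \<nu> * normF x - ?c * N2 x)
      \<le> integral X (\<lambda>x. co 0 x * (\<Sum>d<3. \<Sum>i<3. (\<nu> * grad U dU d i x - F d i x) * grad W dW d i x))"
    by (rule integral_le[OF integrable_continuous[OF cl[unfolded X_def], folded X_def]
        integrable_continuous[OF cr[unfolded X_def], folded X_def] pointwise_energy])
  also have "\<dots> = 0"
    using weak test_field_W unfolding weak_stokes_def X_def grad_def by blast
  finally have fin: "integral X (\<lambda>x. \<nu> / (2 * M) * (\<eta> x * normg x) - 2 * M / \<nu> * normF x - ?c * N2 x) \<le> 0" .
  have c: "(\<lambda>x. \<nu> / (2 * M) * (\<eta> x * normg x)) integrable_on X"
    "(\<lambda>x. 2 * M / \<nu> * normF x) integrable_on X" "(\<lambda>x. ?c * N2 x) integrable_on X"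
    by (rule integrable_on_mult_right, rule i)+
  from fin have "\<nu> / (2 * M) * integral X (\<lambda>x. \<eta> x * normg x) - 2 * M / \<nu> * integral X normF - ?c * integral X N2 \<le> 0"
    unfolding integral_diff[OF integrable_diff[OF c(1,2)] c(3)] integral_diff[OF c(1,2)] integral_mult_right .
  then have "\<nu> / (2 * M) * integral X (\<lambda>x. \<eta> x * normg x) \<le> 2 * M / \<nu> * integral X normF + ?c * integral X N2"
    by simp
  also have "\<dots> \<le> 2 * M / \<nu> * integral X normF + ?c * (80 * M ^ 4 * integral X e)"
    using integral_N2 nu M_pos by (intro add_left_mono mult_left_mono) auto
  \<comment> \<open>This factor turns the coefficient \<nu> / (2 M) into 4, which undoes the lower
    bound 1 / 4 of the cutoff on the half window.\<close>
  finally have "8 * M / \<nu> * (\<nu> / (2 * M) * integral X (\<lambda>x. \<eta> x * normg x))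
      \<le> 8 * M / \<nu> * (2 * M / \<nu> * integral X normF + ?c * (80 * M ^ 4 * integral X e))"
    using nu M_pos by (intro mult_left_mono) auto
  moreover have "8 * M / \<nu> * (\<nu> / (2 * M) * y) = 4 * y" for y
    using nu M_pos by simp
  moreover have "8 * M / \<nu> * (2 * M / \<nu> * y + 45 / 4 * \<nu> * M * (p / l)\<^sup>2 * (s * z))
      = 16 * M\<^sup>2 / \<nu>\<^sup>2 * y + 90 * M\<^sup>2 * p\<^sup>2 * s / l\<^sup>2 * z" for y p s z
    using nu by (simp add: distrib_left power2_eq_square)
  ultimately have *: "4 * integral X (\<lambda>x. \<eta> x * normg x)
      \<le> 16 * M\<^sup>2 / \<nu>\<^sup>2 * integral X normF + 90 * M\<^sup>2 * (336 * M\<^sup>2)\<^sup>2 * (80 * M ^ 4) / l\<^sup>2 * integral X e"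
    by (simp only:)
  have "p \<le> t" if "1 / 4 * p \<le> s" "4 * s \<le> t" for p s t :: real
    using that by linarith
  from this[OF half_window_le *] show ?thesis .
qed

end

subsection \<open>Uniformly local bounds\<close>

definition sq3 :: "(nat \<Rightarrow> pt \<Rightarrow> real) \<Rightarrow> pt \<Rightarrow> real" where
  "sq3 u x = (\<Sum>i<3. (u i x)\<^sup>2)"

definition sq9 :: "(nat \<Rightarrow> nat \<Rightarrow> pt \<Rightarrow> real) \<Rightarrow> pt \<Rightarrow> real" where
  "sq9 g x = (\<Sum>d<3. \<Sum>i<3. (g d i x)\<^sup>2)"

lemma sq3_nonneg: "0 \<le> sq3 u x" and sq9_nonneg: "0 \<le> sq9 g x"
  by (auto simp: sq3_def sq9_def intro!: sum_nonneg)

lemma continuous_on_sq3: "(\<And>i. i < 3 \<Longrightarrow> continuous_on X (u i)) \<Longrightarrow> continuous_on X (sq3 u)"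
  unfolding sq3_def[abs_def] by (intro continuous_intros) auto

lemma continuous_on_sq9:
  "(\<And>d i. d < 3 \<Longrightarrow> i < 3 \<Longrightarrow> continuous_on X (g d i)) \<Longrightarrow> continuous_on X (sq9 g)"
  unfolding sq9_def[abs_def] by (intro continuous_intros) auto

text \<open>The function is the radial primitive of its derivative, starting from the inner face
  where it vanishes. Cauchy-Schwarz along the radius and a further radial integration each cost one
  width.\<close>

lemma poincare_r:
  assumes u: "pd (box3 a b c d e g) 0 u u'" and ab: "a \<le> b" "b - a \<le> M"
    and bc: "\<And>x. x \<in> box3 a b c d e g \<Longrightarrow> co 0 x = a \<Longrightarrow> u x = 0"
  shows "integral (box3 a b c d e g) (\<lambda>x. (u x)\<^sup>2) \<le> M\<^sup>2 * integral (box3 a b c d e g) (\<lambda>x. (u' x)\<^sup>2)"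
proof -
  let ?X = "box3 a b c d e g"
  define L where "L = (\<lambda>k::nat. if k = 0 then a else if k = 1 then c else e)"
  define H where "H = (\<lambda>k::nat. if k = 0 then b else if k = 1 then d else g)"
  have X: "boxlike ?X L H" unfolding L_def H_def by (rule boxlike_box3)
  have LH: "L 0 = a" "H 0 = b" by (auto simp: L_def H_def)
  have c2: "continuous_on ?X (\<lambda>x. (u' x)\<^sup>2)" by (intro continuous_intros pdD2[OF u])
  have sc: "continuous_on ?X (slice_int 0 a b (\<lambda>x. (u' x)\<^sup>2))"
    using continuous_on_slice_int[OF X c2, of 0] LH by simp
  have le: "(u x)\<^sup>2 \<le> (b - a) * slice_int 0 a b (\<lambda>x. (u' x)\<^sup>2) x" if x: "x \<in> ?X" for x
  proof -
    have "upd 0 x a \<in> ?X" using boxlike_mem[OF X x, of 0 a] ab LH by simp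
    then have "prim 0 a u' x = u x"
      using prim_ftc[OF X u x] bc[of "upd 0 x a"] LH by simp
    then show ?thesis
      using prim_square_le[OF X _ pdD2[OF u] c2 _ x, of 0 1] LH by simp
  qed
  have "integral ?X (\<lambda>x. (u x)\<^sup>2) \<le> integral ?X (\<lambda>x. (b - a) * slice_int 0 a b (\<lambda>x. (u' x)\<^sup>2) x)"
    by (intro integral_le integrable_continuous continuous_intros pdD1[OF u] sc le)
  also have "\<dots> = (b - a)\<^sup>2 * integral ?X (\<lambda>x. (u' x)\<^sup>2)"
    by (simp add: integral_slice_int_0[OF c2 ab(1)] power2_eq_square[of "b - a"])
  also have "\<dots> \<le> M\<^sup>2 * integral ?X (\<lambda>x. (u' x)\<^sup>2)"
    using ab c2 by (intro mult_right_mono power_mono integral_nonneg integrable_continuous) auto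
  finally show ?thesis .
qed

lemma integral_box3_split:
  fixes f :: "pt \<Rightarrow> real"
  assumes f: "continuous_on (box3 a b c d e g) f" and m: "e \<le> m" "m \<le> g"
  shows "integral (box3 a b c d e g) f = integral (box3 a b c d e m) f + integral (box3 a b c d m g) f"
proof -
  have sub: "box3 a b c d e m \<subseteq> box3 a b c d e g" "box3 a b c d m g \<subseteq> box3 a b c d e g"
    using m by (auto simp: mem_box3)
  have "box3 a b c d e m \<inter> box3 a b c d m g \<subseteq> {x. x \<bullet> (0, 0, 1) = m}"
    by (auto simp: mem_box3)
  moreover have "negligible {x :: pt. x \<bullet> (0, 0, 1) = m}"
    by (rule negligible_standard_hyperplane) (auto simp: Basis_prod_def zero_prod_def)
  ultimately have n: "negligible (box3 a b c d e m \<inter> box3 a b c d m g)"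
    using negligible_subset by blast
  have un: "box3 a b c d e m \<union> box3 a b c d m g = box3 a b c d e g"
    using m by (auto simp: mem_box3)
  have "(f has_integral integral (box3 a b c d e m) f + integral (box3 a b c d m g) f)
      (box3 a b c d e m \<union> box3 a b c d m g)"
    using continuous_on_subset[OF f sub(1)] continuous_on_subset[OF f sub(2)] n
    by (intro has_integral_Un integrable_integral integrable_continuous)
  then show ?thesis unfolding un by (rule integral_unique)
qed

context stokes_window
begin

text \<open>Only the radial row of the gradient is used, because it carries no frame terms.\<close>

lemma sum_integrals_sq3:
  assumes "box3 R1 R2 0 (2 * pi) A B \<subseteq> X"
  shows "integral (box3 R1 R2 0 (2 * pi) A B) (sq3 U) \<le> M\<^sup>2 * integral (box3 R1 R2 0 (2 * pi) A B) (sq9 (grad U dU))"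
proof -
  let ?Y = "box3 R1 R2 0 (2 * pi) A B"
  note cU = continuous_on_subset[OF U_cont assms] and cdU = continuous_on_subset[OF dU_cont assms]
    and cg = continuous_on_subset[OF grad_cont assms]
  have iU: "(\<lambda>x. (U i x)\<^sup>2) integrable_on ?Y" if "i < 3" for i
    using that by (intro integrable_continuous continuous_intros cU)
  have idU: "(\<lambda>x. (dU 0 i x)\<^sup>2) integrable_on ?Y" if "i < 3" for i
    using that by (intro integrable_continuous continuous_intros cdU) auto
  have "integral ?Y (sq3 U) = (\<Sum>i<3. integral ?Y (\<lambda>x. (U i x)\<^sup>2))"
    unfolding sq3_def[abs_def] by (rule integral_sum) (use iU in auto)
  also have "\<dots> \<le> (\<Sum>i<3. M\<^sup>2 * integral ?Y (\<lambda>x. (dU 0 i x)\<^sup>2))"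
  proof (rule sum_mono)
    fix i :: nat assume i: "i \<in> {..<3}"
    show "integral ?Y (\<lambda>x. (U i x)\<^sup>2) \<le> M\<^sup>2 * integral ?Y (\<lambda>x. (dU 0 i x)\<^sup>2)"
    proof (rule poincare_r)
      show "pd ?Y 0 (U i) (dU 0 i)" using pd_subset[OF U_pd' assms] i by simp
      show "U i x = 0" if "x \<in> ?Y" "co 0 x = R1" for x
        using U_bc[of i x] that assms i by (auto simp: X_def)
    qed (use R12 R1 M in auto)
  qed
  also have "\<dots> = M\<^sup>2 * integral ?Y (\<lambda>x. \<Sum>i<3. (dU 0 i x)\<^sup>2)"
    by (subst integral_sum) (auto simp: idU sum_distrib_left)
  also have "\<dots> \<le> M\<^sup>2 * integral ?Y (sq9 (grad U dU))"
  proof (intro mult_left_mono integral_le)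
    show "(\<lambda>x. \<Sum>i<3. (dU 0 i x)\<^sup>2) integrable_on ?Y" using idU by (intro integrable_sum) auto
    show "sq9 (grad U dU) integrable_on ?Y" by (intro integrable_continuous continuous_on_sq9 cg)
    fix x
    have "(\<Sum>i<3. (dU 0 i x)\<^sup>2) = (\<Sum>i<3. (grad U dU 0 i x)\<^sup>2)" by (simp add: grad_def tens_def)
    also have "\<dots> \<le> sq9 (grad U dU) x"
      unfolding sq9_def by (rule member_le_sum) (auto intro: sum_nonneg)
    finally show "(\<Sum>i<3. (dU 0 i x)\<^sup>2) \<le> sq9 (grad U dU) x" .
  qed auto
  finally show ?thesis .
qed

lemma normg_eq: "normg = sq9 (grad U dU)" and normF_eq: "normF = sq9 F"
  by (auto simp: fun_eq_iff normg_def normF_def sq9_def)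

lemma e_eq: "e = (\<lambda>x. sq3 U x + sq3 (dU 1) x)"
  by (auto simp: fun_eq_iff e_def sq3_def sum.distrib)

text \<open>An angular derivative is r times a gradient entry up to a component of \<open>U\<close>.
  This gives the bound 3 |U|^2 + 2 M^2 |grad U|^2, and Poincare's inequality turns 3 |U|^2 into 3
  M^2 |grad U|^2.\<close>

lemma e_le_gradient: "integral X e \<le> 5 * M\<^sup>2 * integral X (sq9 (grad U dU))"
proof -
  have c: "continuous_on X (sq3 U)" "continuous_on X (sq9 (grad U dU))"
    by (intro continuous_on_sq3 continuous_on_sq9 U_cont grad_cont; assumption)+
  have le: "e x \<le> 3 * sq3 U x + 2 * M\<^sup>2 * sq9 (grad U dU) x" if x: "x \<in> X" for x
  proof -
    note r = co0_bounds[OF x]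
    have nz: "co 0 x \<noteq> 0" using r by simp
    have sq: "(co 0 x * g)\<^sup>2 \<le> M\<^sup>2 * g\<^sup>2" for g
      unfolding power_mult_distrib using r by (intro mult_right_mono power_mono) auto
    have two: "(p + s)\<^sup>2 \<le> 2 * p\<^sup>2 + 2 * s\<^sup>2" for p s :: real
      using zero_le_power2[of "p - s"] by (simp add: power2_eq_square algebra_simps)
    have "dU 1 0 x = co 0 x * grad U dU 1 0 x + U 1 x" "dU 1 1 x = co 0 x * grad U dU 1 1 x + - U 0 x"
      "dU 1 2 x = co 0 x * grad U dU 1 2 x + 0"
      using nz by (auto simp: grad_def tens_def)
    then have "(dU 1 0 x)\<^sup>2 \<le> 2 * (co 0 x * grad U dU 1 0 x)\<^sup>2 + 2 * (U 1 x)\<^sup>2"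
      "(dU 1 1 x)\<^sup>2 \<le> 2 * (co 0 x * grad U dU 1 1 x)\<^sup>2 + 2 * (- U 0 x)\<^sup>2"
      "(dU 1 2 x)\<^sup>2 \<le> 2 * (co 0 x * grad U dU 1 2 x)\<^sup>2 + 2 * 0\<^sup>2"
      using two by metis+
    then have "(dU 1 0 x)\<^sup>2 \<le> 2 * (M\<^sup>2 * (grad U dU 1 0 x)\<^sup>2) + 2 * (U 1 x)\<^sup>2"
      "(dU 1 1 x)\<^sup>2 \<le> 2 * (M\<^sup>2 * (grad U dU 1 1 x)\<^sup>2) + 2 * (U 0 x)\<^sup>2"
      "(dU 1 2 x)\<^sup>2 \<le> 2 * (M\<^sup>2 * (grad U dU 1 2 x)\<^sup>2)"
      using sq[of "grad U dU 1 0 x"] sq[of "grad U dU 1 1 x"] sq[of "grad U dU 1 2 x"]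
      unfolding power2_minus zero_power2 by linarith+
    then have "e x \<le> sq3 U x + 2 * sq3 U x + 2 * (M\<^sup>2 * (\<Sum>i<3. (grad U dU 1 i x)\<^sup>2))"
      unfolding e_eq sq3_def sum3 distrib_left using zero_le_power2[of "U 2 x"] by linarith
    also have "(\<Sum>i<3. (grad U dU 1 i x)\<^sup>2) \<le> sq9 (grad U dU) x"
      unfolding sq9_def by (rule member_le_sum[of 1]) (auto intro: sum_nonneg)
    finally show ?thesis by (simp add: mult_left_mono)
  qed
  have "integral X e \<le> integral X (\<lambda>x. 3 * sq3 U x + 2 * M\<^sup>2 * sq9 (grad U dU) x)"
    using c e_cont le unfolding X_def by (intro integral_le integrable_continuous continuous_intros) auto
  also have "\<dots> = 3 * integral X (sq3 U) + 2 * M\<^sup>2 * integral X (sq9 (grad U dU))"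
  proof -
    have "sq3 U integrable_on X" "sq9 (grad U dU) integrable_on X"
      using c unfolding X_def by (auto intro: integrable_continuous)
    then show ?thesis
      by (subst integral_add) (intro integrable_on_mult_right | simp)+
  qed
  also have "integral X (sq3 U) \<le> M\<^sup>2 * integral X (sq9 (grad U dU))"
    using sum_integrals_sq3[of "a - l" "a + l"] by (simp add: X_def)
  finally show ?thesis by simp
qed

end

section \<open>Absorption over all windows\<close>

definition const_F :: "real \<Rightarrow> real \<Rightarrow> real" where
  "const_F \<nu> M = 16 * M\<^sup>2 / \<nu>\<^sup>2"

definition const_e :: "real \<Rightarrow> real" where
  "const_e M = 90 * M\<^sup>2 * (336 * M\<^sup>2)\<^sup>2 * (80 * M ^ 4)"

lemma (in stokes_window) window_estimate:
  "integral (window R1 R2 a (l / 2)) (sq9 (grad U dU))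
     \<le> const_F \<nu> M * integral (window R1 R2 a l) (sq9 F)
       + const_e M / l\<^sup>2 * integral (window R1 R2 a l) (\<lambda>x. sq3 U x + sq3 (dU 1) x)"
  "integral (window R1 R2 a l) (\<lambda>x. sq3 U x + sq3 (dU 1) x)
     \<le> 5 * M\<^sup>2 * integral (window R1 R2 a l) (sq9 (grad U dU))"
  "integral (window R1 R2 a (l / 2)) (sq3 U)
     \<le> M\<^sup>2 * integral (window R1 R2 a (l / 2)) (sq9 (grad U dU))"
proof -
  have "window R1 R2 a (l / 2) \<subseteq> X" using l by (auto simp: X_def mem_box3)
  then show "integral (window R1 R2 a (l / 2)) (sq3 U)
     \<le> M\<^sup>2 * integral (window R1 R2 a (l / 2)) (sq9 (grad U dU))"
    by (rule sum_integrals_sq3)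
  show "integral (window R1 R2 a (l / 2)) (sq9 (grad U dU))
     \<le> const_F \<nu> M * integral (window R1 R2 a l) (sq9 F)
       + const_e M / l\<^sup>2 * integral (window R1 R2 a l) (\<lambda>x. sq3 U x + sq3 (dU 1) x)"
    using local_energy_estimate by (simp add: const_F_def const_e_def normg_eq normF_eq e_eq X_def)
  show "integral (window R1 R2 a l) (\<lambda>x. sq3 U x + sq3 (dU 1) x)
     \<le> 5 * M\<^sup>2 * integral (window R1 R2 a l) (sq9 (grad U dU))"
    using e_le_gradient by (simp add: e_eq X_def)
qed

lemma integral_window_halves:
  fixes f :: "pt \<Rightarrow> real"
  assumes "continuous_on (window R1 R2 a l) f" "0 \<le> l"
  shows "integral (window R1 R2 a l) f
    = integral (window R1 R2 (a - l / 2) (l / 2)) f + integral (window R1 R2 (a + l / 2) (l / 2)) f"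
proof -
  have "a - l / 2 - l / 2 = a - l" "a - l / 2 + l / 2 = a" "a + l / 2 - l / 2 = a" "a + l / 2 + l / 2 = a + l"
    by auto
  then show ?thesis
    unfolding \<open>a - l / 2 - l / 2 = a - l\<close> using integral_box3_split[OF assms(1), of a] assms(2)
    by (simp only:)
qed

text \<open>The bound \<open>B\<close> does not occur in the conclusion: it only ensures that the
  supremum of the local energies is finite, after which half of that supremum may be subtracted. The
  result is therefore stable when \<open>B\<close> blows up with the averaging length.\<close>

lemma uniform_estimate:
  assumes win: "\<And>a. stokes_window \<nu> R1 R2 M a l U dU F"
    and l: "20 * M\<^sup>2 * const_e M \<le> l\<^sup>2"
    and B: "\<And>a. integral (window R1 R2 a l) (\<lambda>x. sq3 U x + sq3 (dU 1) x) \<le> B"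
    and Fs: "\<And>a. integral (window R1 R2 a (l / 2)) (sq9 F) \<le> Fs"
  shows "integral (window R1 R2 c (l / 2)) (sq3 U) \<le> 4 * M\<^sup>2 * const_F \<nu> M * Fs"
proof -
  interpret stokes_window \<nu> R1 R2 M a l U dU F for a by (rule win)
  define I where "I a = integral (window R1 R2 a (l / 2)) (sq9 (grad U dU))" for a
  have KF: "0 \<le> const_F \<nu> M" and Ke: "0 \<le> const_e M"
    using M_pos by (auto simp: const_F_def const_e_def)
  have l0: "0 < l" using l by simp
  have g: "integral (window R1 R2 a l) (sq9 (grad U dU)) = I (a - l / 2) + I (a + l / 2)" for a
    unfolding I_def using grad_cont[of _ _ a] l0
    by (intro integral_window_halves continuous_on_sq9) (auto simp: X_def)
  have f: "integral (window R1 R2 a l) (sq9 F) \<le> 2 * Fs" for a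
    using integral_window_halves[OF continuous_on_sq9[OF F_cont]] l0 Fs[of "a - l / 2"] Fs[of "a + l / 2"] by simp
  have "I a \<le> const_F \<nu> M * (2 * Fs) + const_e M / l\<^sup>2 * B" for a
  proof -
    have "const_F \<nu> M * integral (window R1 R2 a l) (sq9 F) \<le> const_F \<nu> M * (2 * Fs)"
      using f KF by (intro mult_left_mono)
    moreover have "const_e M / l\<^sup>2 * integral (window R1 R2 a l) (\<lambda>x. sq3 U x + sq3 (dU 1) x) \<le> const_e M / l\<^sup>2 * B"
      using B Ke by (intro mult_left_mono) auto
    ultimately show ?thesis using window_estimate(1)[of a] unfolding I_def by linarith
  qed
  then have bdd: "bdd_above (range I)" by (intro bdd_aboveI2)
  define s where "s = (SUP a. I a)"
  have Is: "I a \<le> s" for a unfolding s_def by (rule cSUP_upper[OF _ bdd]) simp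
  have I0: "0 \<le> I a" for a unfolding I_def
    by (cases "sq9 (grad U dU) integrable_on window R1 R2 a (l / 2)")
      (auto intro: integral_nonneg sq9_nonneg simp: not_integrable_integral)
  have s0: "0 \<le> s" using I0[of 0] Is[of 0] by linarith
  have "I a \<le> 2 * const_F \<nu> M * Fs + s / 2" for a
  proof -
    have "integral (window R1 R2 a l) (\<lambda>x. sq3 U x + sq3 (dU 1) x) \<le> 5 * M\<^sup>2 * (2 * s)"
    proof -
      \<comment> \<open>A window of half-length \<open>l\<close> consists of two windows of
        half-length \<open>l / 2\<close>, each with energy at most \<open>s\<close>.\<close>
      have "5 * M\<^sup>2 * (I (a - l / 2) + I (a + l / 2)) \<le> 5 * M\<^sup>2 * (2 * s)"
        using Is[of "a - l / 2"] Is[of "a + l / 2"] by (intro mult_left_mono) auto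
      then show ?thesis using window_estimate(2)[of a] unfolding g by linarith
    qed
    then have "const_e M / l\<^sup>2 * integral (window R1 R2 a l) (\<lambda>x. sq3 U x + sq3 (dU 1) x)
        \<le> const_e M / l\<^sup>2 * (5 * M\<^sup>2 * (2 * s))"
      using Ke by (intro mult_left_mono) auto
    \<comment> \<open>The required size of \<open>l\<close> is read off here: 5 M^2 times 2 from the
      two halves, doubled so that the term becomes at most \<open>s / 2\<close>.\<close>
    also have "\<dots> = (20 * M\<^sup>2 * const_e M) * s / (2 * l\<^sup>2)" by simp
    also have "\<dots> \<le> l\<^sup>2 * s / (2 * l\<^sup>2)"
      by (intro divide_right_mono mult_right_mono s0 assms(2)) auto
    also have "\<dots> = s / 2" using l0 by simp
    finally have 1: "const_e M / l\<^sup>2 * integral (window R1 R2 a l) (\<lambda>x. sq3 U x + sq3 (dU 1) x) \<le> s / 2" .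
    have "const_F \<nu> M * integral (window R1 R2 a l) (sq9 F) \<le> const_F \<nu> M * (2 * Fs)"
      using f KF by (intro mult_left_mono)
    then show ?thesis using 1 window_estimate(1)[of a] unfolding I_def by linarith
  qed
  then have "s \<le> 2 * const_F \<nu> M * Fs + s / 2"
    unfolding s_def by (intro cSUP_least) auto
  then have "I c \<le> 4 * const_F \<nu> M * Fs" using Is[of c] by linarith
  then have "M\<^sup>2 * I c \<le> M\<^sup>2 * (4 * const_F \<nu> M * Fs)" by (intro mult_left_mono) auto
  also have "\<dots> = 4 * M\<^sup>2 * const_F \<nu> M * Fs" by simp
  finally have Ic: "M\<^sup>2 * I c \<le> 4 * M\<^sup>2 * const_F \<nu> M * Fs" .
  show ?thesis by (rule order.trans[OF window_estimate(3) Ic[unfolded I_def]])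
qed

subsection \<open>Rotations and averages over rotations\<close>

text \<open>The angle is not reduced modulo 2 pi. Functions live on the covering slab, rotations are
  translations of it, and periodicity is a separate condition.\<close>

definition slab :: "real \<Rightarrow> real \<Rightarrow> pt set" where
  "slab R1 R2 = {R1..R2} \<times> UNIV \<times> UNIV"

definition rot :: "real \<Rightarrow> pt \<Rightarrow> pt" where
  "rot s x = upd 1 x (co 1 x + s)"

lemma mem_slab: "x \<in> slab R1 R2 \<longleftrightarrow> R1 \<le> co 0 x \<and> co 0 x \<le> R2"
  by (cases x) (auto simp: slab_def co_def)

lemma co_rot [simp]: "co 0 (rot s x) = co 0 x" "co 1 (rot s x) = co 1 x + s" "co 2 (rot s x) = co 2 x"
  by (auto simp: rot_def co_def upd_def)

lemma rot_mem [simp]: "rot s x \<in> slab R1 R2 \<longleftrightarrow> x \<in> slab R1 R2"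
  by (simp add: mem_slab)

lemma upd_slab: "x \<in> slab R1 R2 \<Longrightarrow> {s. upd d x s \<in> slab R1 R2} = (if d = 0 then {R1..R2} else UNIV)"
  by (auto simp: mem_slab upd_def co_def)

lemma upd_rot: "upd 1 (rot s x) t = upd 1 x t" "d \<noteq> 1 \<Longrightarrow> upd d (rot s x) t = rot s (upd d x t)"
  by (auto simp: rot_def upd_def co_def)

lemma rot_upd: "rot s (upd 1 x t) = upd 1 x (t + s)"
  by (simp add: rot_def)

lemma rot_rot [simp]: "rot s (rot t x) = rot (t + s) x" and rot_0 [simp]: "rot 0 x = x"
  by (auto simp: rot_def add.assoc)

lemma continuous_on_rot [continuous_intros]:
  "continuous_on S f \<Longrightarrow> continuous_on S g \<Longrightarrow> continuous_on S (\<lambda>x. rot (f x) (g x))"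
  unfolding rot_def by (intro continuous_intros continuous_on_compose2[OF continuous_on_co[of UNIV]]) auto

lemma continuous_on_shift:
  "continuous_on (slab R1 R2) f \<Longrightarrow> continuous_on (slab R1 R2) (\<lambda>x. f (rot s x))"
  by (rule continuous_on_compose2[of "slab R1 R2" f]) (auto intro!: continuous_intros)

lemma pd_shift:
  assumes f: "pd (slab R1 R2) d f f'"
  shows "pd (slab R1 R2) d (\<lambda>x. f (rot s x)) (\<lambda>x. f' (rot s x))"
  unfolding pd_def
proof (intro conjI ballI continuous_on_shift pdD1[OF f] pdD2[OF f])
  fix x assume x: "x \<in> slab R1 R2"
  have D: "((\<lambda>t. f (upd d (rot s x) t)) has_real_derivative f' (rot s x))
      (at (co d (rot s x)) within {t. upd d (rot s x) t \<in> slab R1 R2})"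
    by (rule pdD[OF f]) (use x in simp)
  show "((\<lambda>t. f (rot s (upd d x t))) has_real_derivative f' (rot s x)) (at (co d x) within {t. upd d x t \<in> slab R1 R2})"
  proof (cases "d = 1")
    case True
    have "((\<lambda>t. f (upd 1 x (t + s))) has_real_derivative f' (rot s x)) (at (co 1 x))"
      using D x True by (simp add: DERIV_shift upd_slab upd_rot)
    then show ?thesis using True x by (simp add: upd_slab rot_upd)
  next
    case False
    then have "co d (rot s x) = co d x" by (simp add: co_def rot_def upd_def)
    then show ?thesis using D x False by (simp add: upd_slab upd_rot(2))
  qed
qed

text \<open>Averaging makes the \<open>\<theta>\<close>-derivative of a bounded function bounded
  (\<open>avg_derivative\<close> below), with a constant that blows up as \<open>h\<close> tends to \<open>0\<close>.\<close>

definition avg :: "real \<Rightarrow> (pt \<Rightarrow> real) \<Rightarrow> pt \<Rightarrow> real" where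
  "avg h f x = integral {0..1} (\<lambda>t. f (rot (h * t) x))"

lemma continuous_on_rot_line:
  fixes f :: "pt \<Rightarrow> real"
  assumes "continuous_on (slab R1 R2) f" "x \<in> slab R1 R2"
  shows "continuous_on S (\<lambda>t. f (rot (h * t) x))"
  by (rule continuous_on_compose2[OF assms(1)]) (use assms(2) in \<open>auto intro!: continuous_intros\<close>)

lemma continuous_on_avg:
  assumes f: "continuous_on (slab R1 R2) f"
  shows "continuous_on (slab R1 R2) (avg h f)"
proof -
  have "continuous_on (slab R1 R2 \<times> cbox 0 1) (\<lambda>y. f (rot (h * snd y) (fst y)))"
    by (rule continuous_on_compose2[OF f]) (auto intro!: continuous_intros)
  then have "continuous_on (slab R1 R2) (\<lambda>x. integral (cbox 0 1) (\<lambda>t. f (rot (h * t) x)))"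
    by (intro integral_continuous_on_param) (simp add: case_prod_beta)
  then show ?thesis by (simp add: avg_def[abs_def])
qed

lemma pd_avg:
  assumes f: "pd (slab R1 R2) d f f'"
  shows "pd (slab R1 R2) d (avg h f) (avg h f')"
  unfolding pd_def
proof (intro conjI ballI continuous_on_avg pdD1[OF f] pdD2[OF f])
  fix x assume x: "x \<in> slab R1 R2"
  define V where "V = {s. upd d x s \<in> slab R1 R2}"
  have V: "upd d x s \<in> slab R1 R2" if "s \<in> V" for s using that by (simp add: V_def)
  have V': "{t. upd d (upd d x s) t \<in> slab R1 R2} = V" if "s \<in> V" for s by (simp add: V_def)
  note ft = pd_shift[OF f]
  have "((\<lambda>s. integral (cbox 0 1) (\<lambda>t. f (rot (h * t) (upd d x s)))) has_real_derivative
      integral (cbox 0 1) (\<lambda>t. f' (rot (h * t) (upd d x (co d x))))) (at (co d x) within V)"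
  proof (rule leibniz_rule_field_derivative)
    fix s t :: real assume s: "s \<in> V"
    show "((\<lambda>s. f (rot (h * t) (upd d x s))) has_real_derivative f' (rot (h * t) (upd d x s))) (at s within V)"
      using pdD[OF ft V[OF s]] V'[OF s] by simp
  next
    fix s assume s: "s \<in> V"
    show "(\<lambda>t. f (rot (h * t) (upd d x s))) integrable_on cbox 0 1"
      by (intro integrable_continuous continuous_on_rot_line[OF pdD1[OF f] V[OF s]])
  next
    have "continuous_on (V \<times> cbox 0 1) (\<lambda>y. f' (rot (h * snd y) (upd d x (fst y))))"
      by (intro continuous_on_compose2[OF pdD2[OF f]] continuous_intros) (auto simp: V)
    then show "continuous_on (V \<times> cbox 0 1) (\<lambda>(s, t). f' (rot (h * t) (upd d x s)))"
      by (simp add: case_prod_beta)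
  next
    show "co d x \<in> V" using x by (simp add: V_def)
    show "convex V" unfolding V_def upd_slab[OF x] by simp
  qed
  then show "((\<lambda>s. avg h f (upd d x s)) has_real_derivative avg h f' x) (at (co d x) within {s. upd d x s \<in> slab R1 R2})"
    by (simp add: avg_def V_def)
qed

lemma avg_derivative:
  assumes f: "pd (slab R1 R2) 1 f f'" and x: "x \<in> slab R1 R2" and h: "h \<noteq> 0"
  shows "avg h f' x = (f (rot h x) - f x) / h"
proof -
  have "integral {0..1} (\<lambda>t. h * f' (rot (h * t) x)) = f (rot (h * 1) x) - f (rot (h * 0) x)"
  proof (rule ftc_real)
    fix t :: real
    have "((\<lambda>t. f (upd 1 x t)) has_real_derivative f' (rot (h * t) x)) (at (co 1 x + h * t))"
      using pdD[OF f, of "rot (h * t) x"] x by (simp add: upd_slab upd_rot)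
    moreover have "((\<lambda>t. co 1 x + h * t) has_real_derivative h) (at t)"
      by (auto intro!: derivative_eq_intros)
    ultimately have "((\<lambda>t. f (upd 1 x (co 1 x + h * t))) has_real_derivative f' (rot (h * t) x) * h) (at t)"
      by (rule DERIV_chain2[where f = "\<lambda>s. f (upd 1 x s)" and g = "\<lambda>t. co 1 x + h * t"])
    then show "((\<lambda>t. f (rot (h * t) x)) has_real_derivative h * f' (rot (h * t) x)) (at t within {0..1})"
      by (simp add: mult.commute[of h] has_field_derivative_at_within rot_def)
  qed auto
  then show ?thesis using h by (simp add: avg_def field_simps)
qed

lemma window_slab: "window R1 R2 a l \<subseteq> slab R1 R2"
  by (auto simp: mem_box3 mem_slab co_def rot_def upd_def)

lemma box3_slab: "box3 R1 R2 c d e g \<subseteq> slab R1 R2"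
  by (auto simp: mem_box3 mem_slab co_def rot_def upd_def)

text \<open>The primitive is based at 0, whence the restriction to nonnegative shifts, which later
  reappears in the signs of the rotation angle and the averaging length.\<close>

lemma periodic_integral:
  fixes f :: "real \<Rightarrow> real"
  assumes f: "continuous_on UNIV f" and periodic: "\<And>t. f (t + T) = f t" and T: "0 \<le> T" and s: "0 \<le> s"
  shows "integral {0..T} (\<lambda>t. f (t + s)) = integral {0..T} f"
proof -
  define P where "P x = integral {0..x} f" for x
  have c: "continuous_on S f" for S using f by (rule continuous_on_subset) simp
  have P: "(P has_real_derivative f x) (at x within {0..b})" if "0 \<le> x" "x \<le> b" for x b
    unfolding P_def[abs_def] by (rule integral_has_real_derivative[OF c]) (use that in auto)
  \<comment> \<open>The integral over one period starting at \<open>t\<close> has zero derivative in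
    \<open>t\<close>.\<close>
  have "((\<lambda>t. P (t + T) - P t) has_real_derivative 0) (at x within {0..s})" if "x \<in> {0..s}" for x
  proof -
    have "((\<lambda>t. t + T) has_real_derivative 1) (at x within {0..s})" by (auto intro!: derivative_eq_intros)
    moreover have "(P has_real_derivative f (x + T)) (at (x + T) within (\<lambda>t. t + T) ` {0..s})"
      using P[of "x + T" "s + T"] that T by (auto elim!: DERIV_subset)
    ultimately have "((\<lambda>t. P (t + T)) has_real_derivative f (x + T) * 1) (at x within {0..s})"
      using DERIV_image_chain[of P "f (x + T)" "\<lambda>t. t + T" x "{0..s}" 1] by (simp add: o_def)
    then show ?thesis using P[of x s] that periodic by (auto intro!: derivative_eq_intros)
  qed
  then obtain k where k: "\<And>x. x \<in> {0..s} \<Longrightarrow> P (x + T) - P x = k"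
    using has_field_derivative_zero_constant[of "{0..s}" "\<lambda>t. P (t + T) - P t"] by auto
  have eq: "P (s + T) - P s = P (0 + T) - P 0" using k[of s] k[of 0] s by simp
  have "integral {0..T} (\<lambda>t. f (t + s)) = P (T + s) - P (0 + s)"
  proof (rule ftc_real[OF T])
    fix x assume x: "x \<in> {0..T}"
    have "(P has_real_derivative f (x + s)) (at (x + s) within (\<lambda>t. t + s) ` {0..T})"
      using P[of "x + s" "T + s"] x s by (auto elim!: DERIV_subset)
    moreover have "((\<lambda>t. t + s) has_real_derivative 1) (at x within {0..T})" by (auto intro!: derivative_eq_intros)
    ultimately show "((\<lambda>t. P (t + s)) has_real_derivative f (x + s)) (at x within {0..T})"
      using DERIV_image_chain[of P "f (x + s)" "\<lambda>t. t + s" x "{0..T}" 1] by (simp add: o_def)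
  qed
  then show ?thesis using eq by (simp add: P_def add.commute)
qed

definition periodic :: "real \<Rightarrow> real \<Rightarrow> (pt \<Rightarrow> real) \<Rightarrow> bool" where
  "periodic R1 R2 f \<longleftrightarrow> (\<forall>x\<in>slab R1 R2. f (rot (2 * pi) x) = f x)"

lemma slice_int_shift:
  assumes f: "continuous_on (slab R1 R2) f" "periodic R1 R2 f" and x: "x \<in> slab R1 R2" and s: "0 \<le> s"
  shows "slice_int 1 0 (2 * pi) (\<lambda>x. f (rot s x)) x = slice_int 1 0 (2 * pi) f x"
proof -
  have m: "upd 1 x t \<in> slab R1 R2" for t using upd_slab[OF x, of 1] by auto
  have "integral {0..2 * pi} (\<lambda>t. f (upd 1 x (t + s))) = integral {0..2 * pi} (\<lambda>t. f (upd 1 x t))"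
  proof (rule periodic_integral)
    show "continuous_on UNIV (\<lambda>t. f (upd 1 x t))"
      by (rule continuous_on_compose2[OF f(1)]) (use m in \<open>auto intro!: continuous_intros\<close>)
    show "f (upd 1 x (t + 2 * pi)) = f (upd 1 x t)" for t
      using f(2) m[of t] by (auto simp: periodic_def rot_upd[symmetric])
  qed (use s in auto)
  then show ?thesis by (simp add: slice_int_def rot_upd)
qed

lemma integral_shift:
  assumes f: "continuous_on (slab R1 R2) f" "periodic R1 R2 f" and s: "0 \<le> s"
  shows "integral (window R1 R2 a l) (\<lambda>x. f (rot s x)) = integral (window R1 R2 a l) f"
proof -
  have c: "continuous_on (window R1 R2 a l) f" "continuous_on (window R1 R2 a l) (\<lambda>x. f (rot s x))"
    by (intro continuous_on_subset[OF _ window_slab] f(1) continuous_on_shift)+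
  have "integral {0..2 * pi} (\<lambda>\<theta>. f (rot s (r, \<theta>, z))) = integral {0..2 * pi} (\<lambda>\<theta>. f (r, \<theta>, z))"
    if "r \<in> {R1..R2}" for r z
    using slice_int_shift[OF f _ s, of "(r, 0, z)"] that
    by (simp add: slice_int_def upd_def mem_slab co_def)
  then show ?thesis
    unfolding integral_box3_rz\<theta>[OF c(1)] integral_box3_rz\<theta>[OF c(2)]
    by - (rule integral_cong, rule integral_cong, simp)
qed

text \<open>Jensen's inequality, obtained as Cauchy-Schwarz on an interval of length 1.\<close>

lemma avg_square_le:
  assumes f: "continuous_on (slab R1 R2) f" and x: "x \<in> slab R1 R2"
  shows "(avg h f x)\<^sup>2 \<le> avg h (\<lambda>x. (f x)\<^sup>2) x"
  using square_integral_le[of 0 1 1 "\<lambda>t. f (rot (h * t) x)"] continuous_on_rot_line[OF f x]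
  by (simp add: avg_def)

lemma integral_mult_avg:
  assumes f: "continuous_on (slab R1 R2) f" and g: "continuous_on (window R1 R2 a l) g"
  shows "integral (window R1 R2 a l) (\<lambda>x. g x * avg h f x)
    = integral {0..1} (\<lambda>t. integral (window R1 R2 a l) (\<lambda>x. g x * f (rot (h * t) x)))"
proof -
  have 1: "continuous_on (window R1 R2 a l \<times> cbox 0 1) (\<lambda>y. f (rot (h * snd y) (fst y)))"
    by (rule continuous_on_compose2[OF f])
      (auto intro!: continuous_intros simp: mem_box3 mem_slab co_def rot_def upd_def)
  have "continuous_on (window R1 R2 a l \<times> cbox 0 1) (\<lambda>y. g (fst y) * f (rot (h * snd y) (fst y)))"
    by (intro continuous_intros 1 continuous_on_compose2[OF g]) auto
  then have "continuous_on (cbox ((R1, 0, a - l), 0) ((R2, 2 * pi, a + l), 1)) (\<lambda>(x, t). g x * f (rot (h * t) x))"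
    by (simp add: cbox_Pair_eq case_prod_beta)
  from integral_swap_continuous[OF this]
  show ?thesis by (simp add: avg_def)
qed

lemma integral_sum9:
  fixes f :: "nat \<Rightarrow> nat \<Rightarrow> 'a::euclidean_space \<Rightarrow> real"
  assumes "\<And>d i. d < 3 \<Longrightarrow> i < 3 \<Longrightarrow> f d i integrable_on S"
  shows "integral S (\<lambda>x. \<Sum>d<3. \<Sum>i<3. f d i x) = (\<Sum>d<3. \<Sum>i<3. integral S (f d i))"
proof -
  have "(\<lambda>x. \<Sum>i<3. f d i x) integrable_on S" if "d < 3" for d
    by (intro integrable_sum) (use assms that in auto)
  then have "integral S (\<lambda>x. \<Sum>d<3. \<Sum>i<3. f d i x) = (\<Sum>d<3. integral S (\<lambda>x. \<Sum>i<3. f d i x))"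
    by (intro integral_sum) auto
  also have "\<dots> = (\<Sum>d<3. \<Sum>i<3. integral S (f d i))"
    by (intro sum.cong refl integral_sum) (use assms in auto)
  finally show ?thesis .
qed

text \<open>An identity that is linear in \<open>f\<close> and holds for each rotated copy passes to
  the average: Fubini exchanges the space integral with the integral over the angles.\<close>

lemma integral_sum9_avg:
  fixes f g :: "nat \<Rightarrow> nat \<Rightarrow> pt \<Rightarrow> real"
  assumes f: "\<And>d i. d < 3 \<Longrightarrow> i < 3 \<Longrightarrow> continuous_on (slab R1 R2) (f d i)"
    and g: "\<And>d i. d < 3 \<Longrightarrow> i < 3 \<Longrightarrow> continuous_on (window R1 R2 a l) (g d i)"
    and 0: "\<And>t. t \<in> {0..1} \<Longrightarrow>
      integral (window R1 R2 a l) (\<lambda>x. \<Sum>d<3. \<Sum>i<3. g d i x * f d i (rot (h * t) x)) = 0"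
  shows "integral (window R1 R2 a l) (\<lambda>x. \<Sum>d<3. \<Sum>i<3. g d i x * avg h (f d i) x) = 0"
proof -
  let ?X = "window R1 R2 a l"
  have ft: "continuous_on ?X (\<lambda>x. g d i x * f d i (rot s x))" if "d < 3" "i < 3" for d i s
    by (intro continuous_intros g that continuous_on_subset[OF _ window_slab] continuous_on_shift f)
  have ct: "continuous_on {0..1} (\<lambda>t. integral ?X (\<lambda>x. g d i x * f d i (rot (h * t) x)))" if di: "d < 3" "i < 3" for d i
  proof (rule integral_continuous_on_param)
    have "continuous_on ({0..1} \<times> ?X) (\<lambda>y. f d i (rot (h * fst y) (snd y)))"
      by (rule continuous_on_compose2[OF f[OF di]])
        (auto intro!: continuous_intros simp: mem_box3 mem_slab co_def rot_def upd_def)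
    then have "continuous_on ({0..1} \<times> ?X) (\<lambda>y. g d i (snd y) * f d i (rot (h * fst y) (snd y)))"
      by (intro continuous_intros continuous_on_compose2[OF g[OF di]]) auto
    then show "continuous_on ({0..1} \<times> ?X) (\<lambda>(t, x). g d i x * f d i (rot (h * t) x))"
      by (simp add: case_prod_beta)
  qed
  have "integral ?X (\<lambda>x. \<Sum>d<3. \<Sum>i<3. g d i x * avg h (f d i) x)
      = (\<Sum>d<3. \<Sum>i<3. integral ?X (\<lambda>x. g d i x * avg h (f d i) x))"
    by (intro integral_sum9 integrable_continuous continuous_intros g continuous_on_subset[OF _ window_slab]
        continuous_on_avg f)
  also have "\<dots> = (\<Sum>d<3. \<Sum>i<3. integral {0..1} (\<lambda>t. integral ?X (\<lambda>x. g d i x * f d i (rot (h * t) x))))"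
    by (intro sum.cong refl integral_mult_avg f g) auto
  also have "\<dots> = integral {0..1} (\<lambda>t. \<Sum>d<3. \<Sum>i<3. integral ?X (\<lambda>x. g d i x * f d i (rot (h * t) x)))"
    by (rule integral_sum9[symmetric]) (intro integrable_continuous_real ct)
  also have "\<dots> = integral {0..1::real} (\<lambda>t. 0)"
  proof (rule integral_cong)
    fix t :: real assume t: "t \<in> {0..1}"
    show "(\<Sum>d<3. \<Sum>i<3. integral ?X (\<lambda>x. g d i x * f d i (rot (h * t) x))) = 0"
      using 0[OF t] integral_sum9[of "\<lambda>d i x. g d i x * f d i (rot (h * t) x)" ?X] ft
      by (simp add: integrable_continuous)
  qed
  finally show ?thesis by simp
qed

lemma content_window: "measure lborel (window R1 R2 a l) = measure lborel (window R1 R2 0 l)"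
  by (cases "l \<ge> 0") (simp_all add: content_Pair)

lemma integral_window_le:
  assumes f: "continuous_on (window R1 R2 a l) f" and le: "\<And>x. x \<in> window R1 R2 a l \<Longrightarrow> f x \<le> c"
  shows "integral (window R1 R2 a l) f \<le> measure lborel (window R1 R2 0 l) * (c::real)"
proof -
  have "integral (window R1 R2 a l) f \<le> integral (window R1 R2 a l) (\<lambda>x. c)"
    by (intro integral_le integrable_continuous f continuous_intros le)
  also have "\<dots> = measure lborel (window R1 R2 a l) * c" by simp
  finally show ?thesis by (simp only: content_window[of R1 a l R2])
qed

subsection \<open>Small solutions are rotation invariant\<close>

lemma periodic_shift:
  assumes "periodic R1 R2 f"
  shows "periodic R1 R2 (\<lambda>x. f (rot s x))"
  unfolding periodic_def
proof
  fix x assume "x \<in> slab R1 R2"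
  then show "f (rot s (rot (2 * pi) x)) = f (rot s x)"
    using bspec[OF assms[unfolded periodic_def], of "rot s x"] by (simp add: add.commute)
qed

text \<open>The equations are required on the closed slab, so that integration by parts reaches the
  cylinders. Of the boundary values only rotation invariance is kept in \<open>v_bc\<close>; it
  makes differences of rotations vanish there.\<close>

locale ns_solution =
  fixes \<nu> R1 R2 K :: real and v :: "nat \<Rightarrow> pt \<Rightarrow> real" and dv d2v :: "nat \<Rightarrow> nat \<Rightarrow> pt \<Rightarrow> real"
    and p :: "pt \<Rightarrow> real" and dp :: "nat \<Rightarrow> pt \<Rightarrow> real"
  assumes nu: "\<nu> > 0" and R1: "0 < R1" and R12: "R1 < R2"
    and v_pd: "\<And>d i. d < 3 \<Longrightarrow> i < 3 \<Longrightarrow> pd (slab R1 R2) d (v i) (dv d i)"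
    and dv_pd: "\<And>d i. d < 3 \<Longrightarrow> i < 3 \<Longrightarrow> pd (slab R1 R2) d (dv d i) (d2v d i)"
    and p_pd: "\<And>d. d < 3 \<Longrightarrow> pd (slab R1 R2) d p (dp d)"
    and e0: "\<And>x. x \<in> slab R1 R2 \<Longrightarrow> res0 \<nu> (co 0 x) (\<lambda>i. v i x) (\<lambda>d i. dv d i x) (\<lambda>d i. d2v d i x) (\<lambda>d. dp d x) = 0"
    and e1: "\<And>x. x \<in> slab R1 R2 \<Longrightarrow> res1 \<nu> (co 0 x) (\<lambda>i. v i x) (\<lambda>d i. dv d i x) (\<lambda>d i. d2v d i x) (\<lambda>d. dp d x) = 0"
    and e2: "\<And>x. x \<in> slab R1 R2 \<Longrightarrow> res2 \<nu> (co 0 x) (\<lambda>i. v i x) (\<lambda>d i. dv d i x) (\<lambda>d i. d2v d i x) (\<lambda>d. dp d x) = 0"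
    and div_v: "\<And>x. x \<in> slab R1 R2 \<Longrightarrow> v 0 x + co 0 x * dv 0 0 x + dv 1 1 x + co 0 x * dv 2 2 x = 0"
    and v_per: "\<And>i. i < 3 \<Longrightarrow> periodic R1 R2 (v i)" and p_per: "periodic R1 R2 p"
    and v_bc: "\<And>i x s. i < 3 \<Longrightarrow> x \<in> slab R1 R2 \<Longrightarrow> co 0 x = R1 \<or> co 0 x = R2 \<Longrightarrow> v i (rot s x) = v i x"
    and v_le: "\<And>i x. i < 3 \<Longrightarrow> x \<in> slab R1 R2 \<Longrightarrow> \<bar>v i x\<bar> \<le> K"
begin

text \<open>In cylindrical components no coefficient of the system depends on the angle, so rotated
  solutions are again solutions.\<close>

lemma shifted:
  "ns_solution \<nu> R1 R2 K (\<lambda>i x. v i (rot s x)) (\<lambda>d i x. dv d i (rot s x)) (\<lambda>d i x. d2v d i (rot s x))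
     (\<lambda>x. p (rot s x)) (\<lambda>d x. dp d (rot s x))"
proof (rule ns_solution.intro, goal_cases)
  case (7 x) from e0[of "rot s x", unfolded rot_mem co_rot, OF this] show ?case .
next
  case (8 x) from e1[of "rot s x", unfolded rot_mem co_rot, OF this] show ?case .
next
  case (9 x) from e2[of "rot s x", unfolded rot_mem co_rot, OF this] show ?case .
next
  case (10 x) from div_v[of "rot s x", unfolded rot_mem co_rot, OF this] show ?case .
next
  case (11 i) then show ?case by (rule periodic_shift[OF v_per])
next
  case 12 show ?case by (rule periodic_shift[OF p_per])
next
  case (13 i x t)
  then show ?case using v_bc[of i x "t + s"] v_bc[of i x s] unfolding rot_rot by (simp only:)
next
  case (14 i x)
  then show ?case using v_le[of i "rot s x"] unfolding rot_mem by blast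
qed (rule nu R1 R12 | erule (1) pd_shift[OF v_pd] pd_shift[OF dv_pd] | erule pd_shift[OF p_pd])+

lemma v_cont: "i < 3 \<Longrightarrow> continuous_on (slab R1 R2) (v i)"
  using pdD1[OF v_pd[of 0 i]] by simp

lemma dv_cont: "d < 3 \<Longrightarrow> i < 3 \<Longrightarrow> continuous_on (slab R1 R2) (dv d i)"
  by (rule pdD2[OF v_pd])

text \<open>Needed for the faces at angles 0 and 2 pi, where viscous fluxes contain angular
  derivatives; uniqueness of derivatives transfers the periodicity.\<close>

lemma dv_per:
  assumes "i < 3"
  shows "periodic R1 R2 (dv 1 i)"
  unfolding periodic_def
proof
  fix x assume x: "x \<in> slab R1 R2"
  have "pd (slab R1 R2) 1 (v i) (\<lambda>x. dv 1 i (rot (2 * pi) x))"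
    using pd_cong[OF pd_shift[OF v_pd[of 1 i], of "2 * pi"], of "v i" "\<lambda>x. dv 1 i (rot (2 * pi) x)"] v_per[OF assms] assms
    by (auto simp: periodic_def)
  from pdD[OF this x] pdD[OF v_pd[of 1 i] x] assms show "dv 1 i (rot (2 * pi) x) = dv 1 i x"
    using x by (auto simp: upd_slab intro: DERIV_unique)
qed

text \<open>Convection enters as the divergence of the tensor v_d v_i, so testing puts all remaining
  derivatives on the test field and no derivative of \<open>v\<close> appears in the nonlinear
  part.\<close>

lemma weak_nonlinear:
  assumes w: "test_field R1 R2 A B w dw" and AB: "A \<le> B"
  shows "integral (box3 R1 R2 0 (2 * pi) A B) (\<lambda>x. co 0 x * (\<Sum>d<3. \<Sum>i<3.
      (\<nu> * grad v dv d i x - v d x * v i x) * tens (co 0 x) (\<lambda>i. w i x) (\<lambda>d i. dw d i x) d i)) = 0"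
proof -
  define X where "X = box3 R1 R2 0 (2 * pi) A B"
  have Xs: "x \<in> slab R1 R2" if "x \<in> X" for x using that box3_slab unfolding X_def by blast
  have 2: "rot (2 * pi) (r, 0, z) = (r, 2 * pi, z)" for r z by (simp add: rot_def upd_def co_def)
  have sub: "X \<subseteq> slab R1 R2" unfolding X_def by (rule box3_slab)
  have vX: "pd X d (v i) (dv d i)" and dvX: "pd X d (dv d i) (d2v d i)" if "d < 3" "i < 3" for d i
    using pd_subset[OF v_pd sub] pd_subset[OF dv_pd sub] that by auto
  have pX: "pd X d p (dp d)" if "d < 3" for d
    using pd_subset[OF p_pd sub] that by auto
  have wX: "pd X d (w i) (dw d i)" if "d < 3" "i < 3" for d i
    using w that unfolding test_field_def X_def by blast
  have div_w: "w 0 x + co 0 x * dw 0 0 x + dw 1 1 x + co 0 x * dw 2 2 x = 0" if "x \<in> X" for x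
    using w that unfolding test_field_def X_def by blast
  have per_v: "v i (r, 2 * pi, z) = v i (r, 0, z)" and per_dv: "dv 1 i (r, 2 * pi, z) = dv 1 i (r, 0, z)"
    if "i < 3" "(r, 0, z) \<in> X" for i r z
    using v_per[OF that(1)] dv_per[OF that(1)] Xs[OF that(2)] 2 unfolding periodic_def by metis+
  have per_p: "p (r, 2 * pi, z) = p (r, 0, z)" if "(r, 0, z) \<in> X" for r z
    using p_per Xs[OF that] 2 unfolding periodic_def by metis
  have per_w: "w i (r, 2 * pi, z) = w i (r, 0, z)" if "i < 3" "(r, 0, z) \<in> X" for i r z
    using w that unfolding test_field_def X_def by (auto simp: mem_box3)
  have bc_r: "w i (R1, \<theta>, z) = 0 \<and> w i (R2, \<theta>, z) = 0" if "i < 3" "(R1, \<theta>, z) \<in> X" for i \<theta> z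
    using w that unfolding test_field_def X_def by (auto simp: mem_box3)
  have bc_z: "w i (r, \<theta>, A) = 0 \<and> w i (r, \<theta>, B) = 0" if "i < 3" "(r, \<theta>, A) \<in> X" for i r \<theta>
    using w that unfolding test_field_def X_def by (auto simp: mem_box3)
  \<comment> \<open>The three fluxes of \<open>weak_identity\<close>: \<open>a\<close> and
    \<open>c\<close> carry the weight r. The primed functions below are their derivatives in r,
    theta and z by the product rule.\<close>
  define a where "a x = co 0 x * ((v 0 x * v 0 x - \<nu> * dv 0 0 x) * w 0 x + (v 0 x * v 1 x - \<nu> * dv 0 1 x) * w 1 x
      + (v 0 x * v 2 x - \<nu> * dv 0 2 x) * w 2 x + p x * w 0 x)" for x
  define b where "b x = (v 1 x * v 0 x - \<nu> * (1 / co 0 x) * (dv 1 0 x - v 1 x)) * w 0 x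
      + (v 1 x * v 1 x - \<nu> * (1 / co 0 x) * (dv 1 1 x + v 0 x)) * w 1 x
      + (v 1 x * v 2 x - \<nu> * (1 / co 0 x) * dv 1 2 x) * w 2 x + p x * w 1 x" for x
  define c where "c x = co 0 x * ((v 2 x * v 0 x - \<nu> * dv 2 0 x) * w 0 x + (v 2 x * v 1 x - \<nu> * dv 2 1 x) * w 1 x
      + (v 2 x * v 2 x - \<nu> * dv 2 2 x) * w 2 x + p x * w 2 x)" for x
  define a' where "a' x = ((v 0 x * v 0 x - \<nu> * dv 0 0 x) * w 0 x + (v 0 x * v 1 x - \<nu> * dv 0 1 x) * w 1 x
      + (v 0 x * v 2 x - \<nu> * dv 0 2 x) * w 2 x + p x * w 0 x)
     + co 0 x * ((dv 0 0 x * v 0 x + v 0 x * dv 0 0 x - \<nu> * d2v 0 0 x) * w 0 x + (v 0 x * v 0 x - \<nu> * dv 0 0 x) * dw 0 0 x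
          + (dv 0 0 x * v 1 x + v 0 x * dv 0 1 x - \<nu> * d2v 0 1 x) * w 1 x + (v 0 x * v 1 x - \<nu> * dv 0 1 x) * dw 0 1 x
          + (dv 0 0 x * v 2 x + v 0 x * dv 0 2 x - \<nu> * d2v 0 2 x) * w 2 x + (v 0 x * v 2 x - \<nu> * dv 0 2 x) * dw 0 2 x
          + dp 0 x * w 0 x + p x * dw 0 0 x)" for x
  define b' where "b' x = (dv 1 1 x * v 0 x + v 1 x * dv 1 0 x - \<nu> * (1 / co 0 x) * (d2v 1 0 x - dv 1 1 x)) * w 0 x
       + (v 1 x * v 0 x - \<nu> * (1 / co 0 x) * (dv 1 0 x - v 1 x)) * dw 1 0 x
     + (dv 1 1 x * v 1 x + v 1 x * dv 1 1 x - \<nu> * (1 / co 0 x) * (d2v 1 1 x + dv 1 0 x)) * w 1 x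
       + (v 1 x * v 1 x - \<nu> * (1 / co 0 x) * (dv 1 1 x + v 0 x)) * dw 1 1 x
     + (dv 1 1 x * v 2 x + v 1 x * dv 1 2 x - \<nu> * (1 / co 0 x) * d2v 1 2 x) * w 2 x
       + (v 1 x * v 2 x - \<nu> * (1 / co 0 x) * dv 1 2 x) * dw 1 2 x
     + dp 1 x * w 1 x + p x * dw 1 1 x" for x
  define c' where "c' x = co 0 x * ((dv 2 2 x * v 0 x + v 2 x * dv 2 0 x - \<nu> * d2v 2 0 x) * w 0 x + (v 2 x * v 0 x - \<nu> * dv 2 0 x) * dw 2 0 x
     + (dv 2 2 x * v 1 x + v 2 x * dv 2 1 x - \<nu> * d2v 2 1 x) * w 1 x + (v 2 x * v 1 x - \<nu> * dv 2 1 x) * dw 2 1 x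
     + (dv 2 2 x * v 2 x + v 2 x * dv 2 2 x - \<nu> * d2v 2 2 x) * w 2 x + (v 2 x * v 2 x - \<nu> * dv 2 2 x) * dw 2 2 x
     + dp 2 x * w 2 x + p x * dw 2 2 x)" for x
  have rpos: "co 0 x \<noteq> 0" if "x \<in> X" for x
    using Xs[OF that] R1 by (auto simp: mem_slab)
  have r0: "pd X 0 (\<lambda>x. co 0 x) (\<lambda>x. 1)"
    using pd_fun_same[of 0 X "\<lambda>_. 1" "\<lambda>s. s"] by simp
  have r2: "pd X 2 (\<lambda>x. co 0 x) (\<lambda>x. 0)"
    using pd_fun_other[of 2 0 X "\<lambda>s. s"] by simp
  have "continuous_on (co 0 ` X) (\<lambda>s. 1 / s)"
    by (intro continuous_intros ballI) (metis imageE rpos)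
  then have r1: "pd X 1 (\<lambda>x. 1 / co 0 x) (\<lambda>x. 0)"
    using pd_fun_other[of 1 0 X "\<lambda>s. 1 / s"] by simp
  note f = vX dvX pX wX r0 r1 r2
  have a: "pd X 0 a a'"
    unfolding a_def[abs_def]
    by (rule pd_cong', ((rule pd_intros | rule f; simp))+) (simp add: a'_def algebra_simps)
  have b: "pd X 1 b b'"
    unfolding b_def[abs_def]
    by (rule pd_cong', ((rule pd_intros | rule f; simp))+) (simp add: b'_def algebra_simps)
  have c: "pd X 2 c c'"
    unfolding c_def[abs_def]
    by (rule pd_cong', ((rule pd_intros | rule f; simp))+) (simp add: c'_def algebra_simps)
  have ia: "integral X a' = 0" and ib: "integral X b' = 0" and ic: "integral X c' = 0"
    using integral_pd_0[OF a[unfolded X_def]] integral_pd_1[OF b[unfolded X_def]] integral_pd_2[OF c[unfolded X_def]]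
      R12 AB bc_r bc_z per_v per_dv per_p per_w
    by (auto simp: X_def a_def b_def c_def mem_box3 co_def)
  have i: "a' integrable_on X" "b' integrable_on X" "c' integrable_on X"
    using pdD2[OF a] pdD2[OF b] pdD2[OF c] by (auto simp: X_def intro!: integrable_continuous)
  have "integral X (\<lambda>x. a' x + b' x + c' x) = 0"
    using i ia ib ic by (simp add: integral_add integrable_add)
  moreover have "a' x + b' x + c' x = - (co 0 x * (\<Sum>d<3. \<Sum>i<3.
      (\<nu> * tens (co 0 x) (\<lambda>i. v i x) (\<lambda>d i. dv d i x) d i - v d x * v i x) *
      tens (co 0 x) (\<lambda>i. w i x) (\<lambda>d i. dw d i x) d i))" if "x \<in> X" for x
    unfolding a'_def b'_def c'_def
    by (rule weak_identity[where v="\<lambda>i. v i x" and dv="\<lambda>d i. dv d i x" and d2v="\<lambda>d i. d2v d i x" and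
        w="\<lambda>i. w i x" and dw="\<lambda>d i. dw d i x" and p="p x" and dp="\<lambda>d. dp d x"])
      (use rpos[OF that] e0[OF Xs[OF that]] e1[OF Xs[OF that]] e2[OF Xs[OF that]] div_v[OF Xs[OF that]] div_w[OF that] in simp_all)
  ultimately show ?thesis
    unfolding X_def[symmetric] grad_def by (simp cong: integral_cong)
qed

lemma grad_v_cont: "d < 3 \<Longrightarrow> i < 3 \<Longrightarrow> continuous_on (slab R1 R2) (grad v dv d i)"
proof -
  assume di: "d < 3" "i < 3"
  have nz: "co 0 x \<noteq> 0" if "x \<in> slab R1 R2" for x using that R1 by (auto simp: mem_slab)
  have "continuous_on (slab R1 R2) (\<lambda>x. tens (co 0 x) (\<lambda>i. v i x) (\<lambda>d i. dv d i x) d i)"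
    unfolding tens_def using di by (cases "d = 1"; cases "i = 0"; cases "i = 1")
      (auto intro!: continuous_intros v_cont dv_cont simp: nz)
  then show ?thesis by (simp add: grad_def[abs_def])
qed

end

section \<open>The averaged difference of two rotated solutions\<close>

locale averaged_difference = ns_solution +
  fixes \<phi> h M :: real
  assumes \<phi>: "0 \<le> \<phi>" and h: "0 < h"
    and M: "1 \<le> M" "1 / R1 \<le> M" "R2 \<le> M" "1 / (R2 - R1) \<le> M"
begin

definition u where "u i x = v i (rot \<phi> x) - v i x"
definition du where "du d i x = dv d i (rot \<phi> x) - dv d i x"
definition f where "f d i x = v d (rot \<phi> x) * v i (rot \<phi> x) - v d x * v i x"
definition U where "U i = avg h (u i)"
text \<open>In the angular direction the difference quotient replaces the average of the derivative.
  They agree on the slab, but boundedness by a multiple of K / h is visible only in this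
  form.\<close>

definition dU where "dU d i = (if d = 1 then (\<lambda>x. (u i (rot h x) - u i x) / h) else avg h (du d i))"
definition F where "F d i = avg h (f d i)"

lemma u_pd: "d < 3 \<Longrightarrow> i < 3 \<Longrightarrow> pd (slab R1 R2) d (u i) (du d i)"
  unfolding u_def[abs_def] du_def[abs_def] by (intro pd_diff pd_shift v_pd)

lemma u_cont: "i < 3 \<Longrightarrow> continuous_on (slab R1 R2) (u i)"
  using pdD1[OF u_pd[of 0 i]] by simp

lemma f_cont: "d < 3 \<Longrightarrow> i < 3 \<Longrightarrow> continuous_on (slab R1 R2) (f d i)"
  unfolding f_def[abs_def] by (intro continuous_intros continuous_on_shift v_cont)

lemma dU_avg: "x \<in> slab R1 R2 \<Longrightarrow> i < 3 \<Longrightarrow> dU d i x = avg h (du d i) x"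
  using avg_derivative[OF u_pd[of 1 i], of x h] h by (simp add: dU_def)

lemma U_pd: "d < 3 \<Longrightarrow> i < 3 \<Longrightarrow> pd (slab R1 R2) d (U i) (dU d i)"
  unfolding U_def by (rule pd_cong'[OF pd_avg[OF u_pd]]) (auto simp: dU_avg)

lemma line_int: "continuous_on (slab R1 R2) g \<Longrightarrow> x \<in> slab R1 R2 \<Longrightarrow> (\<lambda>t. g (rot (h * t) x)) integrable_on {0..1}"
  for g :: "pt \<Rightarrow> real"
  by (intro integrable_continuous_real continuous_on_rot_line)

lemma U_div:
  assumes x: "x \<in> slab R1 R2"
  shows "U 0 x + co 0 x * dU 0 0 x + dU 1 1 x + co 0 x * dU 2 2 x = 0"
proof -
  note i = line_int[OF _ x]
  have c: "u 0 y + co 0 y * du 0 0 y + du 1 1 y + co 0 y * du 2 2 y = 0" if "y \<in> slab R1 R2" for y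
    using div_v[of y] div_v[of "rot \<phi> y"] that by (simp add: u_def du_def algebra_simps)
  have "0 = integral {0..1} (\<lambda>t. u 0 (rot (h * t) x) + co 0 x * du 0 0 (rot (h * t) x) + du 1 1 (rot (h * t) x)
      + co 0 x * du 2 2 (rot (h * t) x))"
    using c[of "rot (h * t) x" for t] x by simp
  also have "\<dots> = avg h (u 0) x + co 0 x * avg h (du 0 0) x + avg h (du 1 1) x + co 0 x * avg h (du 2 2) x"
    unfolding avg_def using i[OF u_cont[of 0]] i[OF pdD2[OF u_pd[of 0 0]]] i[OF pdD2[OF u_pd[of 1 1]]] i[OF pdD2[OF u_pd[of 2 2]]]
    by (simp add: integral_add integrable_add integrable_on_mult_right)
  finally show ?thesis using x by (simp add: dU_avg U_def)
qed

lemma v_per_shift: "i < 3 \<Longrightarrow> x \<in> slab R1 R2 \<Longrightarrow> v i (rot s (rot (2 * pi) x)) = v i (rot s x)"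
  using periodic_shift[OF v_per, of i s] unfolding periodic_def by blast

lemma u_per: "i < 3 \<Longrightarrow> periodic R1 R2 (u i)"
  unfolding periodic_def using v_per_shift[of i _ \<phi>] v_per_shift[of i _ 0] unfolding u_def rot_0 by simp

lemma f_per: "d < 3 \<Longrightarrow> i < 3 \<Longrightarrow> periodic R1 R2 (f d i)"
  unfolding periodic_def
  using v_per_shift[of i _ \<phi>] v_per_shift[of i _ 0] v_per_shift[of d _ \<phi>] v_per_shift[of d _ 0]
  unfolding f_def rot_0 by simp

text \<open>A rotation does not change the mean over the full circle, so the two terms of
  \<open>u\<close> cancel for every angle of the average; Fubini then handles the average
  itself.\<close>

lemma U_mean:
  assumes x: "x \<in> slab R1 R2" and i: "i < 3"
  shows "slice_int 1 0 (2 * pi) (U i) x = 0"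
proof -
  have m: "upd 1 x t \<in> slab R1 R2" for t using upd_slab[OF x, of 1] by auto
  have c: "continuous_on S (\<lambda>\<theta>. v i (rot s (upd 1 x \<theta>)))" for s S
    by (rule continuous_on_compose2[OF v_cont[OF i]]) (use m in \<open>auto intro!: continuous_intros\<close>)
  have "continuous_on (cbox (0, 0) (2 * pi, 1)) (\<lambda>y. u i (rot (h * snd y) (upd 1 x (fst y))))"
    by (rule continuous_on_compose2[OF u_cont[OF i]]) (use m in \<open>auto intro!: continuous_intros\<close>)
  then have "integral (cbox 0 (2 * pi)) (\<lambda>\<theta>. integral (cbox 0 1) (\<lambda>t. u i (rot (h * t) (upd 1 x \<theta>))))
      = integral (cbox 0 1) (\<lambda>t. integral (cbox 0 (2 * pi)) (\<lambda>\<theta>. u i (rot (h * t) (upd 1 x \<theta>))))"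
    by (intro integral_swap_continuous) (simp add: case_prod_beta)
  also have "\<dots> = integral (cbox (0::real) 1) (\<lambda>t. 0)"
  proof (rule integral_cong)
    fix t :: real assume t: "t \<in> cbox 0 1"
    have "integral {0..2 * pi} (\<lambda>\<theta>. u i (rot (h * t) (upd 1 x \<theta>)))
        = slice_int 1 0 (2 * pi) (\<lambda>x. v i (rot (h * t + \<phi>) x)) x - slice_int 1 0 (2 * pi) (\<lambda>x. v i (rot (h * t) x)) x"
      unfolding slice_int_def u_def
      by (subst integral_diff[symmetric]) (auto intro!: integrable_continuous_real c)
    also have "\<dots> = 0"
      using slice_int_shift[OF v_cont[OF i] v_per[OF i] x] t \<phi> h by simp
    finally show "integral (cbox 0 (2 * pi)) (\<lambda>\<theta>. u i (rot (h * t) (upd 1 x \<theta>))) = 0" by simp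
  qed
  finally show ?thesis by (simp add: slice_int_def U_def avg_def)
qed

text \<open>The frame gradient is linear with coefficients depending on r alone, so it commutes with
  rotations and averages. The quadratic stress is not linear in \<open>v\<close>, which is why
  \<open>F\<close> averages the difference of the two stresses.\<close>

lemma grad_avg:
  assumes x: "x \<in> slab R1 R2" and di: "d < 3" "i < 3"
  shows "\<nu> * grad U dU d i x - F d i x
    = avg h (\<lambda>x. (\<nu> * grad v dv d i (rot \<phi> x) - v d (rot \<phi> x) * v i (rot \<phi> x)) - (\<nu> * grad v dv d i x - v d x * v i x)) x"
proof -
  have nz: "co 0 x \<noteq> 0" using x R1 by (auto simp: mem_slab)
  note iu = line_int[OF u_cont x] and idu = line_int[OF pdD2[OF u_pd] x] and fi = line_int[OF f_cont x]
  have g: "grad v dv d i (rot (h * t + \<phi>) x) - grad v dv d i (rot (h * t) x)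
      = tens (co 0 x) (\<lambda>i. u i (rot (h * t) x)) (\<lambda>d i. du d i (rot (h * t) x)) d i" for t
    by (simp add: grad_def tens_def u_def du_def diff_divide_distrib add_divide_distrib)
  have "((\<lambda>t. u j (rot (h * t) x)) has_integral U j x) {0..1}" if "j < 3" for j
    using iu[OF that] by (simp add: U_def avg_def has_integral_integral)
  moreover have "((\<lambda>t. du d i (rot (h * t) x)) has_integral avg h (du d i) x) {0..1}"
    using idu[OF di] by (simp add: avg_def has_integral_integral)
  ultimately have t: "((\<lambda>t. tens (co 0 x) (\<lambda>i. u i (rot (h * t) x)) (\<lambda>d i. du d i (rot (h * t) x)) d i) has_integral
      tens (co 0 x) (\<lambda>i. U i x) (\<lambda>d i. avg h (du d i) x) d i) {0..1}"
    unfolding tens_def divide_inverse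
    by (cases "d = 1"; cases "i = 0"; cases "i = 1")
      (simp_all only: if_True if_False refl zero_neq_one add_0_right,
       (intro has_integral_mult_left has_integral_add has_integral_neg; simp)+)
  have "avg h (\<lambda>x. (\<nu> * grad v dv d i (rot \<phi> x) - v d (rot \<phi> x) * v i (rot \<phi> x)) - (\<nu> * grad v dv d i x - v d x * v i x)) x
      = integral {0..1} (\<lambda>t. \<nu> * tens (co 0 x) (\<lambda>i. u i (rot (h * t) x)) (\<lambda>d i. du d i (rot (h * t) x)) d i - f d i (rot (h * t) x))"
    unfolding avg_def g[symmetric] f_def by (simp add: algebra_simps)
  also have "\<dots> = \<nu> * tens (co 0 x) (\<lambda>i. U i x) (\<lambda>d i. avg h (du d i) x) d i - F d i x"
  proof -
    have "((\<lambda>t. f d i (rot (h * t) x)) has_integral F d i x) {0..1}"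
      using fi[OF di] by (simp add: F_def avg_def has_integral_integral)
    then show ?thesis by (intro integral_unique has_integral_diff has_integral_mult_right t)
  qed
  also have "tens (co 0 x) (\<lambda>i. U i x) (\<lambda>d i. avg h (du d i) x) d i = grad U dU d i x"
    using dU_avg[OF x] di by (simp add: grad_def tens_def)
  finally show ?thesis by simp
qed

text \<open>The same test field is used for the solutions rotated by \<open>h * t + \<phi>\<close>
  and by \<open>h * t\<close>. Each satisfies its weak identity without pressure; the difference is
  averaged over \<open>t\<close>.\<close>

lemma weak_linear: "0 \<le> l \<Longrightarrow> weak_stokes \<nu> R1 R2 (a - l) (a + l) (grad U dU) F"
  unfolding weak_stokes_def
proof (intro allI impI)
  fix w dw assume l: "0 \<le> l" and w: "test_field R1 R2 (a - l) (a + l) w dw"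
  define g where "g d i x = co 0 x * tens (co 0 x) (\<lambda>i. w i x) (\<lambda>d i. dw d i x) d i" for d i x
  define H where "H d i x = \<nu> * grad v dv d i x - v d x * v i x" for d i x
  let ?X = "window R1 R2 a l"
  have sl: "x \<in> ?X \<Longrightarrow> x \<in> slab R1 R2" for x using window_slab by blast
  have nz: "co 0 x \<noteq> 0" if "x \<in> ?X" for x using sl[OF that] R1 by (auto simp: mem_slab)
  have wc: "continuous_on ?X (w i)" "continuous_on ?X (dw d i)" if "d < 3" "i < 3" for d i
    using w that unfolding test_field_def by (meson pdD1 pdD2)+
  have gc: "continuous_on ?X (g d i)" if "d < 3" "i < 3" for d i
    unfolding g_def[abs_def] tens_def using that wc[OF that] wc(1)[of 0 0] wc(1)[of 0 1]
    by (cases "d = 1"; cases "i = 0"; cases "i = 1")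
      (auto intro!: continuous_intros simp: nz)
  have Hc: "continuous_on (slab R1 R2) (H d i)" if "d < 3" "i < 3" for d i
    unfolding H_def[abs_def] using that by (intro continuous_intros grad_v_cont v_cont)
  have 0: "integral ?X (\<lambda>x. \<Sum>d<3. \<Sum>i<3. g d i x * H d i (rot s x)) = 0" for s
  proof -
    interpret s: ns_solution \<nu> R1 R2 K "\<lambda>i x. v i (rot s x)" "\<lambda>d i x. dv d i (rot s x)" "\<lambda>d i x. d2v d i (rot s x)"
      "\<lambda>x. p (rot s x)" "\<lambda>d x. dp d (rot s x)" by (rule shifted)
    have "g d i x * H d i (rot s x) = co 0 x * ((\<nu> * grad (\<lambda>i x. v i (rot s x)) (\<lambda>d i x. dv d i (rot s x)) d i x
        - v d (rot s x) * v i (rot s x)) * tens (co 0 x) (\<lambda>i. w i x) (\<lambda>d i. dw d i x) d i)" for d i x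
      by (simp add: g_def H_def grad_def)
    then show ?thesis using s.weak_nonlinear[OF w] l by (simp add: sum_distrib_left)
  qed
  have "integral ?X (\<lambda>x. \<Sum>d<3. \<Sum>i<3. g d i x * avg h (\<lambda>x. H d i (rot \<phi> x) - H d i x) x) = 0"
  proof (rule integral_sum9_avg)
    fix t :: real
    have "(\<lambda>x. \<Sum>d<3. \<Sum>i<3. g d i x * H d i (rot s x)) integrable_on ?X" for s
      by (intro integrable_continuous continuous_intros gc continuous_on_subset[OF _ window_slab] continuous_on_shift Hc) auto
    then have "integral ?X (\<lambda>x. (\<Sum>d<3. \<Sum>i<3. g d i x * H d i (rot (h * t + \<phi>) x)) - (\<Sum>d<3. \<Sum>i<3. g d i x * H d i (rot (h * t) x))) = 0"
      by (simp add: integral_diff 0)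
    then show "integral ?X (\<lambda>x. \<Sum>d<3. \<Sum>i<3. g d i x * (H d i (rot \<phi> (rot (h * t) x)) - H d i (rot (h * t) x))) = 0"
      by (simp add: right_diff_distrib sum_subtractf)
  qed (intro continuous_intros continuous_on_shift Hc gc; assumption)+
  also have "integral ?X (\<lambda>x. \<Sum>d<3. \<Sum>i<3. g d i x * avg h (\<lambda>x. H d i (rot \<phi> x) - H d i x) x)
      = integral ?X (\<lambda>x. co 0 x * (\<Sum>d<3. \<Sum>i<3. (\<nu> * grad U dU d i x - F d i x) * tens (co 0 x) (\<lambda>i. w i x) (\<lambda>d i. dw d i x) d i))"
    by (intro integral_cong)
      (simp add: grad_avg[OF sl, folded H_def] g_def sum_distrib_left mult_ac cong: sum.cong_simp)
  finally show "integral ?X (\<lambda>x. co 0 x * (\<Sum>d<3. \<Sum>i<3. (\<nu> * grad U dU d i x - F d i x) * tens (co 0 x) (\<lambda>i. w i x) (\<lambda>d i. dw d i x) d i)) = 0" .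
qed

lemma averaged_stokes_window:
  assumes l: "1 \<le> l"
  shows "stokes_window \<nu> R1 R2 M a l U dU F"
proof
  let ?X = "window R1 R2 a l"
  have sl: "x \<in> ?X \<Longrightarrow> x \<in> slab R1 R2" for x using window_slab by blast
  show "pd ?X d (U i) (dU d i)" if "d < 3" "i < 3" for d i using pd_subset[OF U_pd window_slab] that .
  show "continuous_on ?X (F d i)" if "d < 3" "i < 3" for d i
    unfolding F_def by (intro continuous_on_subset[OF _ window_slab] continuous_on_avg f_cont that)
  show "weak_stokes \<nu> R1 R2 (a - l) (a + l) (grad U dU) F" by (rule weak_linear) (use l in simp)
  fix x assume x: "x \<in> ?X"
  show "U 0 x + co 0 x * dU 0 0 x + dU 1 1 x + co 0 x * dU 2 2 x = 0" by (rule U_div[OF sl[OF x]])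
  show "slice_int 1 0 (2 * pi) (U 2) x = 0" by (rule U_mean[OF sl[OF x]]) simp
  fix i :: nat assume i: "i < 3"
  show "U i x = 0" if "co 0 x = R1 \<or> co 0 x = R2"
  proof -
    have "u i (rot s x) = 0" for s
      using v_bc[OF i sl[OF x] that] by (simp add: u_def)
    then show ?thesis by (simp add: U_def avg_def)
  qed
  show "U i (upd 1 x (2 * pi)) = U i (upd 1 x 0)"
  proof -
    have m: "upd 1 x 0 \<in> slab R1 R2" using sl[OF x] by (simp add: mem_slab)
    have "u i (rot (h * t) (upd 1 x (2 * pi))) = u i (rot (h * t) (upd 1 x 0))" for t
      using bspec[OF periodic_shift[OF u_per[OF i], unfolded periodic_def] m, of "h * t"]
      by (simp add: rot_upd[of "2 * pi"])
    then show ?thesis by (simp add: U_def avg_def)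
  qed
qed (use nu R1 R12 M l in auto)

end

lemma integral_avg:
  assumes f: "continuous_on (slab R1 R2) f" "periodic R1 R2 f" and h: "0 \<le> h"
  shows "integral (window R1 R2 a l) (avg h f) = integral (window R1 R2 a l) f"
proof -
  have "integral {0..1} (\<lambda>t. integral (window R1 R2 a l) (\<lambda>x. f (rot (h * t) x)))
      = integral {0..1::real} (\<lambda>t. integral (window R1 R2 a l) f)"
  proof (rule integral_cong)
    fix t :: real assume "t \<in> {0..1}"
    then show "integral (window R1 R2 a l) (\<lambda>x. f (rot (h * t) x)) = integral (window R1 R2 a l) f"
      by (intro integral_shift f mult_nonneg_nonneg h) simp
  qed
  then show ?thesis
    using integral_mult_avg[OF f(1) continuous_on_const, of a l 1 h] by simp
qed

lemma avg_tendsto: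
  assumes f: "continuous_on (slab R1 R2) f" and x: "x \<in> slab R1 R2" and h: "h \<longlonglongrightarrow> 0"
  shows "(\<lambda>n. avg (h n) f x) \<longlonglongrightarrow> f x"
proof -
  have "continuous_on (UNIV \<times> cbox (0::real) 1) (\<lambda>y. f (rot (fst y * snd y) x))"
    by (rule continuous_on_compose2[OF f]) (auto intro!: continuous_intros simp: x)
  then have "continuous_on UNIV (\<lambda>h. integral (cbox (0::real) 1) (\<lambda>t. f (rot (h * t) x)))"
    by (intro integral_continuous_on_param) (simp add: case_prod_beta)
  then have "isCont (\<lambda>h. avg h f x) 0"
    by (simp add: avg_def continuous_on_eq_continuous_at)
  from isCont_tendsto_compose[OF this h] show ?thesis by (simp add: avg_def)
qed

lemma avg_abs_le:
  assumes f: "continuous_on (slab R1 R2) f" and x: "x \<in> slab R1 R2"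
    and le: "\<And>y. y \<in> slab R1 R2 \<Longrightarrow> \<bar>f y\<bar> \<le> c"
  shows "\<bar>avg h f x\<bar> \<le> c"
proof -
  have "norm (integral {0..1} (\<lambda>t. f (rot (h * t) x))) \<le> integral {0..1::real} (\<lambda>t. c)"
    by (rule integral_norm_bound_integral)
      (use le x continuous_on_rot_line[OF f x] in \<open>auto intro!: integrable_continuous_real\<close>)
  then show ?thesis by (simp add: avg_def)
qed

lemma square_le_of_abs: "\<bar>s\<bar> \<le> t \<Longrightarrow> s\<^sup>2 \<le> (t::real)\<^sup>2"
  using power_mono[of "\<bar>s\<bar>" t 2] by simp

lemma sq3_le:
  assumes "\<And>i. i < 3 \<Longrightarrow> \<bar>w i x\<bar> \<le> t"
  shows "sq3 w x \<le> 3 * t\<^sup>2"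
proof -
  have "sq3 w x \<le> (\<Sum>i<(3::nat). t\<^sup>2)"
    unfolding sq3_def by (rule sum_mono) (use assms in \<open>auto intro: square_le_of_abs\<close>)
  then show ?thesis by simp
qed

context averaged_difference
begin

lemma u_le: "i < 3 \<Longrightarrow> x \<in> slab R1 R2 \<Longrightarrow> \<bar>u i x\<bar> \<le> 2 * K"
  using v_le[of i x] v_le[of i "rot \<phi> x"] by (simp add: u_def)

lemma f_square_le:
  assumes x: "x \<in> slab R1 R2" and di: "d < 3" "i < 3"
  shows "(f d i x)\<^sup>2 \<le> 2 * K\<^sup>2 * ((u d x)\<^sup>2 + (u i x)\<^sup>2)"
proof -
  have sq: "(s * t)\<^sup>2 \<le> K\<^sup>2 * t\<^sup>2" if "\<bar>s\<bar> \<le> K" for s t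
    using square_le_of_abs[OF that] unfolding power_mult_distrib by (rule mult_right_mono) simp
  have two: "(s + t)\<^sup>2 \<le> 2 * s\<^sup>2 + 2 * t\<^sup>2" for s t :: real
    using zero_le_power2[of "s - t"] by (simp add: power2_eq_square algebra_simps)
  \<comment> \<open>The difference of two products is linear in \<open>u\<close> with coefficients
    bounded by \<open>K\<close>; this is where smallness of \<open>v\<close> acts.\<close>
  have "f d i x = v i (rot \<phi> x) * u d x + v d x * u i x"
    by (simp add: f_def u_def algebra_simps)
  then have "(f d i x)\<^sup>2 \<le> 2 * (v i (rot \<phi> x) * u d x)\<^sup>2 + 2 * (v d x * u i x)\<^sup>2"
    using two by simp
  also have "\<dots> \<le> 2 * (K\<^sup>2 * (u d x)\<^sup>2) + 2 * (K\<^sup>2 * (u i x)\<^sup>2)"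
    using x di by (intro add_mono mult_left_mono sq v_le) auto
  finally show ?thesis by (simp add: algebra_simps)
qed

lemma sq9_f_le:
  assumes x: "x \<in> slab R1 R2"
  shows "sq9 f x \<le> 12 * K\<^sup>2 * sq3 u x"
proof -
  have "sq9 f x \<le> (\<Sum>d<3. \<Sum>i<3. 2 * K\<^sup>2 * ((u d x)\<^sup>2 + (u i x)\<^sup>2))"
    unfolding sq9_def by (intro sum_mono f_square_le x) auto
  \<comment> \<open>Each of the two sums counts |u|^2 three times, so 2 K^2 * (3 + 3).\<close>
  also have "\<dots> = 12 * K\<^sup>2 * sq3 u x"
    unfolding sq3_def sum3 by (simp add: algebra_simps)
  finally show ?thesis .
qed

lemma sq3_u_cont: "continuous_on (slab R1 R2) (sq3 u)"
  by (intro continuous_on_sq3 u_cont)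

text \<open>By Jensen's inequality and the rotation invariance of window integrals averaging does
  not enlarge the forcing. The bound thus involves \<open>u\<close> itself and is independent of
  \<open>h\<close>.\<close>

lemma integral_F_le:
  "integral (window R1 R2 a l) (sq9 F) \<le> 12 * K\<^sup>2 * integral (window R1 R2 a l) (sq3 u)"
proof -
  let ?X = "window R1 R2 a l"
  have f2: "continuous_on (slab R1 R2) (\<lambda>x. (f d i x)\<^sup>2)" "periodic R1 R2 (\<lambda>x. (f d i x)\<^sup>2)" if "d < 3" "i < 3" for d i
    using f_cont[OF that] f_per[OF that] by (auto intro: continuous_on_power simp: periodic_def)
  have Fc: "continuous_on (slab R1 R2) (F d i)" if "d < 3" "i < 3" for d i
    unfolding F_def by (intro continuous_on_avg f_cont that)
  have int: "g integrable_on ?X" if "continuous_on (slab R1 R2) g" for g :: "pt \<Rightarrow> real"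
    by (intro integrable_continuous continuous_on_subset[OF that window_slab])
  have "integral ?X (sq9 F) = (\<Sum>d<3. \<Sum>i<3. integral ?X (\<lambda>x. (F d i x)\<^sup>2))"
    unfolding sq9_def[abs_def] by (rule integral_sum9) (intro int continuous_on_power Fc)
  also have "\<dots> \<le> (\<Sum>d<3. \<Sum>i<3. integral ?X (\<lambda>x. (f d i x)\<^sup>2))"
  proof (intro sum_mono)
    fix d i :: nat assume "d \<in> {..<3}" "i \<in> {..<3}"
    then have di: "d < 3" "i < 3" by auto
    have "integral ?X (\<lambda>x. (F d i x)\<^sup>2) \<le> integral ?X (avg h (\<lambda>x. (f d i x)\<^sup>2))"
    proof (rule integral_le)
      show "(\<lambda>x. (F d i x)\<^sup>2) integrable_on ?X" by (intro int continuous_on_power Fc di)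
      show "avg h (\<lambda>x. (f d i x)\<^sup>2) integrable_on ?X" by (intro int continuous_on_avg f2 di)
      fix x assume "x \<in> ?X"
      then have "x \<in> slab R1 R2" using window_slab by blast
      then show "(F d i x)\<^sup>2 \<le> avg h (\<lambda>x. (f d i x)\<^sup>2) x"
        unfolding F_def by (rule avg_square_le[OF f_cont[OF di]])
    qed
    also have "\<dots> = integral ?X (\<lambda>x. (f d i x)\<^sup>2)"
      using h by (intro integral_avg f2 di) simp
    finally show "integral ?X (\<lambda>x. (F d i x)\<^sup>2) \<le> integral ?X (\<lambda>x. (f d i x)\<^sup>2)" .
  qed
  also have "\<dots> = integral ?X (sq9 f)"
    unfolding sq9_def[abs_def] by (rule integral_sum9[symmetric]) (intro int f2)
  also have "\<dots> \<le> integral ?X (\<lambda>x. 12 * K\<^sup>2 * sq3 u x)"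
  proof (rule integral_le)
    show "sq9 f integrable_on ?X" by (intro int continuous_on_sq9 f_cont)
    show "(\<lambda>x. 12 * K\<^sup>2 * sq3 u x) integrable_on ?X" by (rule integrable_on_mult_right[OF int[OF sq3_u_cont]])
    fix x assume "x \<in> ?X"
    then show "sq9 f x \<le> 12 * K\<^sup>2 * sq3 u x" using sq9_f_le window_slab by blast
  qed
  finally show ?thesis by simp
qed

text \<open>The crude bound with 4 K / h serves only as the finite bound required by
  \<open>uniform_estimate\<close>. The final constant, 48 = 4 * 12, does not see
  \<open>h\<close>.\<close>

lemma averaged_estimate:
  assumes l: "1 \<le> l" "20 * M\<^sup>2 * const_e M \<le> l\<^sup>2"
    and Y: "\<And>a. integral (window R1 R2 a (l / 2)) (sq3 u) \<le> Y"
  shows "integral (window R1 R2 c (l / 2)) (sq3 (\<lambda>i. avg h (u i))) \<le> 48 * M\<^sup>2 * const_F \<nu> M * K\<^sup>2 * Y"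
proof -
  have "integral (window R1 R2 c (l / 2)) (sq3 U) \<le> 4 * M\<^sup>2 * const_F \<nu> M * (12 * K\<^sup>2 * Y)"
  proof (rule uniform_estimate[OF averaged_stokes_window[OF l(1)] l(2)])
    fix a
    have c: "continuous_on (slab R1 R2) (sq3 U)" "continuous_on (slab R1 R2) (sq3 (dU 1))"
      using pdD1[OF U_pd[of 0]] pdD2[OF U_pd[of 1]] by (auto intro!: continuous_on_sq3)
    show "integral (window R1 R2 a l) (\<lambda>x. sq3 U x + sq3 (dU 1) x)
        \<le> measure lborel (window R1 R2 0 l) * (3 * (2 * K)\<^sup>2 + 3 * (4 * K / h)\<^sup>2)"
    proof (rule integral_window_le)
      show "continuous_on (window R1 R2 a l) (\<lambda>x. sq3 U x + sq3 (dU 1) x)"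
        by (intro continuous_on_subset[OF _ window_slab] continuous_on_add c)
      fix x assume "x \<in> window R1 R2 a l"
      then have x: "x \<in> slab R1 R2" using window_slab by blast
      have "\<bar>U i x\<bar> \<le> 2 * K" if "i < 3" for i
        unfolding U_def by (rule avg_abs_le[OF u_cont[OF that] x u_le[OF that]])
      moreover have "\<bar>dU 1 i x\<bar> \<le> 4 * K / h" if "i < 3" for i
      proof -
        have "\<bar>u i (rot h x) - u i x\<bar> \<le> 4 * K"
          using u_le[OF that, of x] u_le[OF that, of "rot h x"] x by simp
        then show ?thesis using h by (simp add: dU_def abs_divide divide_right_mono)
      qed
      ultimately show "sq3 U x + sq3 (dU 1) x \<le> 3 * (2 * K)\<^sup>2 + 3 * (4 * K / h)\<^sup>2"
        by (intro add_mono sq3_le)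
    qed
    have "12 * K\<^sup>2 * integral (window R1 R2 a (l / 2)) (sq3 u) \<le> 12 * K\<^sup>2 * Y"
      using Y by (intro mult_left_mono) auto
    with integral_F_le show "integral (window R1 R2 a (l / 2)) (sq9 F) \<le> 12 * K\<^sup>2 * Y"
      by (rule order.trans)
  qed
  then show ?thesis by (simp add: U_def[abs_def] mult_ac)
qed

end

section \<open>Contraction for small solutions\<close>

context ns_solution
begin

text \<open>The angle of \<open>x\<close> is fixed to 0 so that \<open>x\<close> lies in a window,
  and \<open>\<phi>\<close> is nonnegative as the shift lemmas demand. Both restrictions are lifted
  in \<open>rotation_invariant\<close>.\<close>

lemma rotation_invariant_0:
  assumes M: "1 \<le> M" "1 / R1 \<le> M" "R2 \<le> M" "1 / (R2 - R1) \<le> M"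
    and small: "48 * M\<^sup>2 * const_F \<nu> M * K\<^sup>2 \<le> 1 / 2" and \<phi>: "0 \<le> \<phi>"
    and i: "i < 3" and x: "x \<in> slab R1 R2" "co 1 x = 0"
  shows "v i (rot \<phi> x) = v i x"
proof -
  define u where "u i x = v i (rot \<phi> x) - v i x" for i x
  \<comment> \<open>Any length at least 1 and at least the threshold will do, because then its
    square exceeds the threshold too.\<close>
  define l where "l = 1 + 20 * M\<^sup>2 * const_e M"
  have "0 \<le> 20 * M\<^sup>2 * const_e M" using M by (simp add: const_e_def)
  then have l: "1 \<le> l" "20 * M\<^sup>2 * const_e M \<le> l" by (auto simp: l_def)
  then have l2: "20 * M\<^sup>2 * const_e M \<le> l\<^sup>2" using self_le_power[of l 2] by simp
  \<comment> \<open>Only facts about \<open>u\<close> are taken from this instance, and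
    \<open>u\<close> does not involve the averaging length, so the value 1 is arbitrary.\<close>
  interpret A: averaged_difference \<nu> R1 R2 K v dv d2v p dp \<phi> 1 M
    by unfold_locales (use \<phi> M in auto)
  have Au: "A.u = u" by (simp add: fun_eq_iff A.u_def u_def)
  note u_cont = A.u_cont[unfolded Au] and u_le = A.u_le[unfolded Au]
  define I where "I a = integral (window R1 R2 a (l / 2)) (sq3 u)" for a
  have uc: "continuous_on (window R1 R2 a (l / 2)) (sq3 u)" for a
    by (intro continuous_on_sq3 continuous_on_subset[OF u_cont window_slab])
  have estimate: "integral (window R1 R2 c (l / 2)) (sq3 (\<lambda>i. avg h (u i))) \<le> 48 * M\<^sup>2 * const_F \<nu> M * K\<^sup>2 * Y"
    if h: "h > 0" and Y: "\<And>a. I a \<le> Y" for h Y c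
  proof -
    interpret B: averaged_difference \<nu> R1 R2 K v dv d2v p dp \<phi> h M
      by unfold_locales (use \<phi> h M in auto)
    have "B.u = u" by (simp add: fun_eq_iff B.u_def u_def)
    then show ?thesis using B.averaged_estimate[OF l(1) l2] Y by (simp add: I_def)
  qed
  have limit: "I c \<le> 48 * M\<^sup>2 * const_F \<nu> M * K\<^sup>2 * Y" if Y: "\<And>a. I a \<le> Y" for Y c
  proof -
    let ?X = "window R1 R2 c (l / 2)"
    let ?h = "\<lambda>n. inverse (real (Suc n))"
    have s: "y \<in> slab R1 R2" if "y \<in> ?X" for y using that window_slab by blast
    \<comment> \<open>The averages inherit the bound 2 K, which dominates the integrands on the
      bounded window, and they converge pointwise by continuity.\<close>
    have "(\<lambda>n. integral ?X (sq3 (\<lambda>i. avg (?h n) (u i)))) \<longlonglongrightarrow> integral ?X (sq3 u)"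
    proof (rule dominated_convergence(2)[where h = "\<lambda>x. 3 * (2 * K)\<^sup>2"])
      show "sq3 (\<lambda>i. avg (?h n) (u i)) integrable_on ?X" for n
        by (intro integrable_continuous continuous_on_sq3 continuous_on_subset[OF _ window_slab] continuous_on_avg u_cont)
      show "norm (sq3 (\<lambda>i. avg (?h n) (u i)) y) \<le> 3 * (2 * K)\<^sup>2" if "y \<in> ?X" for n y
        using sq3_le[of "\<lambda>i. avg (?h n) (u i)" y "2 * K"] avg_abs_le[OF u_cont s[OF that] u_le]
          sq3_nonneg[of "\<lambda>i. avg (?h n) (u i)" y] by (simp del: power_mult_distrib)
      show "(\<lambda>n. sq3 (\<lambda>i. avg (?h n) (u i)) y) \<longlonglongrightarrow> sq3 u y" if "y \<in> ?X" for y
        unfolding sq3_def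
        by (intro tendsto_sum tendsto_power avg_tendsto[OF u_cont s[OF that]] LIMSEQ_inverse_real_of_nat) auto
    qed (rule integrable_continuous, rule continuous_on_const)
    then show ?thesis
      unfolding I_def by (rule LIMSEQ_le_const2) (use estimate[OF _ Y] in auto)
  qed
  have "I a \<le> measure lborel (window R1 R2 0 (l / 2)) * (3 * (2 * K)\<^sup>2)" for a
    unfolding I_def using u_le window_slab by (intro integral_window_le uc sq3_le) blast
  then have bdd: "bdd_above (range I)" by (rule bdd_aboveI2)
  define s where "s = (SUP a. I a)"
  have Is: "I a \<le> s" for a unfolding s_def by (rule cSUP_upper[OF _ bdd]) simp
  have I0: "0 \<le> I a" for a unfolding I_def by (intro integral_nonneg integrable_continuous uc sq3_nonneg)
  have s0: "0 \<le> s" using I0[of 0] Is[of 0] by linarith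
  \<comment> \<open>Smallness makes the supremum of the local integrals at most half of itself, and
    it is finite because \<open>u\<close> is bounded.\<close>
  have "I a \<le> 1 / 2 * s" for a
    using limit[OF Is, of a] mult_right_mono[OF small s0] by linarith
  then have "s \<le> 1 / 2 * s" unfolding s_def by (intro cSUP_least) auto
  then have "I (co 2 x) = 0" using Is[of "co 2 x"] I0[of "co 2 x"] by linarith
  \<comment> \<open>A continuous nonnegative function with zero integral vanishes identically on a
    box with nonempty interior.\<close>
  moreover have "box (R1, 0, co 2 x - l / 2) (R2, 2 * pi, co 2 x + l / 2) \<noteq> {}"
    using R12 l by (auto simp: box_ne_empty Basis_prod_def)
  ultimately have "\<forall>y\<in>window R1 R2 (co 2 x) (l / 2). sq3 u y = 0"
    unfolding I_def by (subst (asm) integral_cbox_eq_0_iff[OF uc]) (auto intro: sq3_nonneg)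
  moreover have "x \<in> window R1 R2 (co 2 x) (l / 2)"
    using x l unfolding mem_box3' mem_slab by simp
  ultimately have "sq3 u x = 0" by blast
  then have "(u i x)\<^sup>2 = 0"
    unfolding sq3_def using i by (subst (asm) sum_nonneg_eq_0_iff) auto
  then show ?thesis by (simp add: u_def)
qed

text \<open>The special case is applied to the solution already rotated by \<open>t\<close>, which
  brings any starting angle to 0; a negative rotation is handled by exchanging the two
  points.\<close>

lemma rotation_invariant:
  assumes M: "1 \<le> M" "1 / R1 \<le> M" "R2 \<le> M" "1 / (R2 - R1) \<le> M"
    and small: "48 * M\<^sup>2 * const_F \<nu> M * K\<^sup>2 \<le> 1 / 2"
    and i: "i < 3" and x: "x \<in> slab R1 R2"
  shows "v i (rot s x) = v i x"
proof -
  have le: "v i (upd 1 x t) = v i (upd 1 x t')" if "t \<le> t'" for t t'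
  proof -
    interpret S: ns_solution \<nu> R1 R2 K "\<lambda>i x. v i (rot t x)" "\<lambda>d i x. dv d i (rot t x)" "\<lambda>d i x. d2v d i (rot t x)"
      "\<lambda>x. p (rot t x)" "\<lambda>d x. dp d (rot t x)" by (rule shifted)
    have "v i (rot t (rot (t' - t) (upd 1 x 0))) = v i (rot t (upd 1 x 0))"
      by (rule S.rotation_invariant_0[OF M small _ i]) (use that x in \<open>auto simp: mem_slab\<close>)
    then show ?thesis by (simp add: rot_upd)
  qed
  show ?thesis
    using le[of "co 1 x" "co 1 x + s"] le[of "co 1 x + s" "co 1 x"] unfolding rot_def upd_co by linarith
qed

end

subsection \<open>Smooth functions in cylindrical coordinates\<close>

lemma Ck_on_continuous: "Ck_on k S f \<Longrightarrow> continuous_on S f"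
  by (cases k) (auto intro: has_derivative_continuous_on)

lemma pd_of_has_derivative:
  assumes d: "d < 3" and g: "\<And>x. x \<in> S \<Longrightarrow> (g has_derivative g' x) (at x within S)"
    and c: "continuous_on S (\<lambda>x. g' x (upd d 0 1))"
  shows "pd S d g (\<lambda>x. g' x (upd d 0 1))"
  unfolding pd_def
proof (intro conjI ballI c)
  show "continuous_on S g" using g by (rule has_derivative_continuous_on)
  fix x assume x: "x \<in> S"
  let ?e = "upd d 0 1 :: pt"
  have line: "upd d x s = x + (s - co d x) *\<^sub>R ?e" for s
    using d by (cases x) (auto simp: upd_def co_def zero_prod_def)
  have "(upd d x has_derivative (\<lambda>t. t *\<^sub>R ?e)) (at (co d x) within {s. upd d x s \<in> S})"
    unfolding line[abs_def] by (auto intro!: derivative_eq_intros)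
  moreover have "(g has_derivative g' x) (at (upd d x (co d x)) within upd d x ` {s. upd d x s \<in> S})"
    unfolding upd_co by (rule has_derivative_subset[OF g[OF x]]) auto
  ultimately have "((\<lambda>s. g (upd d x s)) has_derivative (\<lambda>t. g' x (t *\<^sub>R ?e))) (at (co d x) within {s. upd d x s \<in> S})"
    by (rule has_derivative_in_compose)
  moreover have "g' x (t *\<^sub>R ?e) = g' x ?e * t" for t
    using linear_simps(5)[OF has_derivative_bounded_linear[OF g[OF x]]] by simp
  ultimately show "((\<lambda>s. g (upd d x s)) has_real_derivative g' x ?e) (at (co d x) within {s. upd d x s \<in> S})"
    by (simp add: has_field_derivative_def)
qed

lemma Ck_on_partials:
  assumes "Ck_on (Suc k) S (g :: pt \<Rightarrow> real)"
  obtains dg where "\<And>d. d < 3 \<Longrightarrow> pd S d g (dg d)" "\<And>d. Ck_on k S (dg d)"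
proof -
  obtain g' where g': "\<And>x. x \<in> S \<Longrightarrow> (g has_derivative g' x) (at x within S)" "\<And>h. Ck_on k S (\<lambda>x. g' x h)"
    using assms by auto
  show ?thesis
    using pd_of_has_derivative[OF _ g'(1) Ck_on_continuous[OF g'(2)]] g'(2)
    by (rule that[of "\<lambda>d x. g' x (upd d 0 1)"])
qed

definition unc :: "cyl_fun \<Rightarrow> pt \<Rightarrow> real" where
  "unc f x = f (co 0 x) (co 1 x) (co 2 x)"

lemma unc_simp [simp]: "unc f (r, \<theta>, z) = f r \<theta> z"
  by (simp add: unc_def co_def)

text \<open>Of the second derivatives only the pure ones are kept, since the cylindrical Laplacian
  contains no mixed ones.\<close>

lemma smooth_partials:
  assumes "smooth_up_to_boundary R1 R2 f"
  obtains df d2f where "\<And>d. d < 3 \<Longrightarrow> pd (slab R1 R2) d (unc f) (df d)"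
    "\<And>d. d < 3 \<Longrightarrow> pd (slab R1 R2) d (df d) (d2f d)"
proof -
  have eq: "(\<lambda>(r, \<theta>, z). f r \<theta> z) = unc f" by (auto simp: fun_eq_iff)
  have "Ck_on (Suc (Suc 0)) (slab R1 R2) (unc f)"
    using assms unfolding smooth_up_to_boundary_def smooth_on_def slab_def eq by blast
  then obtain df where df: "\<And>d. d < 3 \<Longrightarrow> pd (slab R1 R2) d (unc f) (df d)" "\<And>d. Ck_on (Suc 0) (slab R1 R2) (df d)"
    by (rule Ck_on_partials) blast
  have "\<exists>g. \<forall>k<3. pd (slab R1 R2) k (df d) (g k)" for d
    by (rule Ck_on_partials[OF df(2)[of d]]) blast
  then obtain g where g: "\<And>d k. k < 3 \<Longrightarrow> pd (slab R1 R2) k (df d) (g d k)" by metis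
  show ?thesis by (rule that[of df "\<lambda>d. g d d"]) (use df g in auto)
qed

text \<open>Agreement at interior radii suffices because \<open>deriv\<close> is local. This allows
  \<open>F\<close> to be itself a \<open>d_r\<close>, whose value is known only inside.\<close>

lemma d_r_eq:
  assumes g: "pd (slab R1 R2) 0 g g'" and F: "\<And>s. R1 < s \<Longrightarrow> s < R2 \<Longrightarrow> F s \<theta> z = g (s, \<theta>, z)"
    and r: "R1 < r" "r < R2"
  shows "d_r F r \<theta> z = g' (r, \<theta>, z)"
proof -
  have x: "(r, \<theta>, z) \<in> slab R1 R2" using r by (simp add: slab_def)
  have "((\<lambda>s. g (s, \<theta>, z)) has_real_derivative g' (r, \<theta>, z)) (at r within {R1..R2})"
    using pdD[OF g x] x by (simp add: upd_slab) (simp add: upd_def co_def)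
  then have D: "((\<lambda>s. g (s, \<theta>, z)) has_real_derivative g' (r, \<theta>, z)) (at r)"
    using r by (simp add: at_within_Icc_at)
  have ev: "\<forall>\<^sub>F s in nhds r. F s \<theta> z = g (s, \<theta>, z)"
  proof (rule eventually_mono)
    show "\<forall>\<^sub>F s in nhds r. s \<in> {R1<..<R2}"
      by (rule eventually_nhds_in_open) (use r in auto)
  qed (use F in simp)
  have "((\<lambda>s. F s \<theta> z) has_real_derivative g' (r, \<theta>, z)) (at r)"
    by (rule DERIV_cong_ev[OF refl ev refl, THEN iffD2, OF D])
  then show ?thesis unfolding d_r_def by (rule DERIV_imp_deriv)
qed

lemma d_theta_eq:
  assumes g: "pd (slab R1 R2) 1 g g'" and F: "\<And>s. F r s z = g (r, s, z)" and r: "R1 \<le> r" "r \<le> R2"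
  shows "d_theta F r \<theta> z = g' (r, \<theta>, z)"
proof -
  have x: "(r, \<theta>, z) \<in> slab R1 R2" using r by (simp add: slab_def)
  have "((\<lambda>s. g (r, s, z)) has_real_derivative g' (r, \<theta>, z)) (at \<theta>)"
    using pdD[OF g x] x by (simp add: upd_slab) (simp add: upd_def co_def)
  then show ?thesis unfolding d_theta_def F by (rule DERIV_imp_deriv)
qed

lemma d_z_eq:
  assumes g: "pd (slab R1 R2) 2 g g'" and F: "\<And>s. F r \<theta> s = g (r, \<theta>, s)" and r: "R1 \<le> r" "r \<le> R2"
  shows "d_z F r \<theta> z = g' (r, \<theta>, z)"
proof -
  have x: "(r, \<theta>, z) \<in> slab R1 R2" using r by (simp add: slab_def)
  have "((\<lambda>s. g (r, \<theta>, s)) has_real_derivative g' (r, \<theta>, z)) (at z)"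
    using pdD[OF g x] x by (simp add: upd_slab) (simp add: upd_def co_def)
  then show ?thesis unfolding d_z_def F by (rule DERIV_imp_deriv)
qed

text \<open>Carries the equations, which are given between the cylinders, to the cylinders by
  continuity in r.\<close>

lemma slab_closure_eq:
  fixes f g :: "pt \<Rightarrow> real"
  assumes R: "R1 < R2" and c: "continuous_on (slab R1 R2) f" "continuous_on (slab R1 R2) g"
    and eq: "\<And>r \<theta> z. R1 < r \<Longrightarrow> r < R2 \<Longrightarrow> f (r, \<theta>, z) = g (r, \<theta>, z)"
    and x: "x \<in> slab R1 R2"
  shows "f x = g x"
proof -
  obtain r \<theta> z where x': "x = (r, \<theta>, z)" "r \<in> {R1..R2}" using x by (auto simp: slab_def)
  have line: "continuous_on {R1..R2} (\<lambda>r. (r, \<theta>, z))" "(\<lambda>r. (r, \<theta>, z)) ` {R1..R2} \<subseteq> slab R1 R2"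
    by (auto intro!: continuous_intros simp: slab_def)
  have "closure {R1<..<R2} = {R1..R2}" using R by (rule closure_greaterThanLessThan)
  then have "continuous_on (closure {R1<..<R2}) (\<lambda>r. f (r, \<theta>, z) - g (r, \<theta>, z))"
    using continuous_on_diff[OF continuous_on_compose2[OF c(1) line] continuous_on_compose2[OF c(2) line]] by simp
  moreover have "f (s, \<theta>, z) - g (s, \<theta>, z) = 0" if "s \<in> {R1<..<R2}" for s
    using eq[of s \<theta> z] that by simp
  moreover have "r \<in> closure {R1<..<R2}"
    using x'(2) \<open>closure {R1<..<R2} = {R1..R2}\<close> by simp
  ultimately have "f (r, \<theta>, z) - g (r, \<theta>, z) = 0"
    by (rule continuous_constant_on_closure)
  then show ?thesis by (simp add: x')
qed

lemma pd_unique: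
  assumes R: "R1 < R2" and "pd (slab R1 R2) d f f'" "pd (slab R1 R2) d f f''" and x: "x \<in> slab R1 R2"
  shows "f' x = f'' x"
proof (rule has_field_derivative_unique[OF pdD[OF assms(2) x] pdD[OF assms(3) x]])
  show "at (co d x) within {s. upd d x s \<in> slab R1 R2} \<noteq> bot"
    using x R unfolding upd_slab[OF x] trivial_limit_within by (auto simp: mem_slab)
qed

lemma (in ns_solution) pressure_rotation_invariant:
  assumes inv: "\<And>i s x. i < 3 \<Longrightarrow> x \<in> slab R1 R2 \<Longrightarrow> v i (rot s x) = v i x" and x: "x \<in> slab R1 R2"
  shows "dp 1 x = 0"
proof -
  have dv: "dv d i (rot s y) = dv d i y" if di: "d < 3" "i < 3" and y: "y \<in> slab R1 R2" for d i s y
  proof -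
    have "pd (slab R1 R2) d (v i) (\<lambda>y. dv d i (rot s y))"
      by (rule pd_cong[OF pd_shift[OF v_pd[OF di]] inv[OF di(2)] refl])
    from pd_unique[OF R12 this v_pd[OF di] y] show ?thesis .
  qed
  have d2v: "d2v d i (rot s y) = d2v d i y" if di: "d < 3" "i < 3" and y: "y \<in> slab R1 R2" for d i s y
  proof -
    have "pd (slab R1 R2) d (dv d i) (\<lambda>y. d2v d i (rot s y))"
      by (rule pd_cong[OF pd_shift[OF dv_pd[OF di]] dv[OF di] refl])
    from pd_unique[OF R12 this dv_pd[OF di] y] show ?thesis .
  qed
  have "dp 1 (rot s x) = dp 1 x" for s
  proof -
    have r: "co 0 x \<noteq> 0" using x R1 by (auto simp: mem_slab)
    have eqs: "v 0 (rot s x) = v 0 x" "v 1 (rot s x) = v 1 x" "v 2 (rot s x) = v 2 x"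
      by (rule inv[OF _ x]; simp)+
    have deqs: "dv 0 1 (rot s x) = dv 0 1 x" "dv 1 1 (rot s x) = dv 1 1 x" "dv 2 1 (rot s x) = dv 2 1 x"
      "dv 1 0 (rot s x) = dv 1 0 x"
      by (rule dv[OF _ _ x]; simp)+
    have d2eqs: "d2v 0 1 (rot s x) = d2v 0 1 x" "d2v 1 1 (rot s x) = d2v 1 1 x" "d2v 2 1 (rot s x) = d2v 2 1 x"
      by (rule d2v[OF _ _ x]; simp)+
    have "1 / co 0 x * dp 1 (rot s x) = 1 / co 0 x * dp 1 x"
      using e1[of "rot s x", unfolded rot_mem co_rot res1_def eqs deqs d2eqs, OF x] e1[OF x, unfolded res1_def] by linarith
    with r show ?thesis by simp
  qed
  \<comment> \<open>The average over a full turn is computed in two ways: as the constant value, and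
    as the increment of \<open>p\<close> over one period.\<close>
  then have "avg (2 * pi) (dp 1) x = dp 1 x" by (simp add: avg_def)
  moreover have "avg (2 * pi) (dp 1) x = (p (rot (2 * pi) x) - p x) / (2 * pi)"
    by (rule avg_derivative[OF p_pd x]) auto
  ultimately show ?thesis using p_per x by (simp add: periodic_def)
qed

lemma partials_eq:
  assumes df: "\<forall>d<3. pd (slab R1 R2) d (unc f) (df d)" and d2f: "\<forall>d<3. pd (slab R1 R2) d (df d) (d2f d)"
    and r: "R1 < r" "r < R2"
  shows "d_r f r \<theta> z = df 0 (r, \<theta>, z)" "d_theta f r \<theta> z = df 1 (r, \<theta>, z)" "d_z f r \<theta> z = df 2 (r, \<theta>, z)"
    and "laplace f r \<theta> z = d2f 0 (r, \<theta>, z) + 1 / r * df 0 (r, \<theta>, z) + 1 / r\<^sup>2 * d2f 1 (r, \<theta>, z) + d2f 2 (r, \<theta>, z)"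
proof -
  have f: "pd (slab R1 R2) d (unc f) (df d)" "pd (slab R1 R2) d (df d) (d2f d)" if "d < 3" for d
    using df d2f that by auto
  have 0: "d_r f s \<phi> y = df 0 (s, \<phi>, y)" if "R1 < s" "s < R2" for s \<phi> y
    by (rule d_r_eq[OF f(1) _ that]) auto
  have 1: "d_theta f r \<phi> y = df 1 (r, \<phi>, y)" for \<phi> y
    by (rule d_theta_eq[OF f(1)]) (use r in auto)
  have 2: "d_z f r \<phi> y = df 2 (r, \<phi>, y)" for \<phi> y
    by (rule d_z_eq[OF f(1)]) (use r in auto)
  have 00: "d_r (d_r f) r \<theta> z = d2f 0 (r, \<theta>, z)"
    by (rule d_r_eq[OF f(2) 0 r]) auto
  have 11: "d_theta (d_theta f) r \<theta> z = d2f 1 (r, \<theta>, z)"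
    by (rule d_theta_eq[OF f(2)]) (use r 1 in auto)
  have 22: "d_z (d_z f) r \<theta> z = d2f 2 (r, \<theta>, z)"
    by (rule d_z_eq[OF f(2)]) (use r 2 in auto)
  show "d_r f r \<theta> z = df 0 (r, \<theta>, z)" "d_theta f r \<theta> z = df 1 (r, \<theta>, z)" "d_z f r \<theta> z = df 2 (r, \<theta>, z)"
    by (rule 0[OF r] 1 2)+
  show "laplace f r \<theta> z = d2f 0 (r, \<theta>, z) + 1 / r * df 0 (r, \<theta>, z) + 1 / r\<^sup>2 * d2f 1 (r, \<theta>, z) + d2f 2 (r, \<theta>, z)"
    unfolding laplace_def 00 11 22 0[OF r] ..
qed

section \<open>From the essential supremum to a pointwise bound\<close>

lemma cyl_nth: "cyl r \<theta> z $ 1 = r * cos \<theta>" "cyl r \<theta> z $ 2 = r * sin \<theta>" "cyl r \<theta> z $ 3 = z"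
  by (simp_all add: cyl_def)

lemma cyl_radius: "(cyl r \<theta> z $ 1)\<^sup>2 + (cyl r \<theta> z $ 2)\<^sup>2 = r\<^sup>2"
  using sin_cos_squared_add[of \<theta>] unfolding cyl_nth power_mult_distrib
  by (metis add.commute distrib_left mult.right_neutral)

lemma cyl_mem_Omega: "0 < R1 \<Longrightarrow> R1 < r \<Longrightarrow> r < R2 \<Longrightarrow> cyl r \<theta> z \<in> Omega R1 R2"
  by (simp add: Omega_def cyl_radius)

lemma open_Omega: "open (Omega R1 R2)"
  unfolding Omega_def by (intro open_Collect_conj open_Collect_less continuous_intros)

text \<open>Any angular range shorter than 2 pi would do; the bound 2 fits a strip of half-width
  1.\<close>

lemma cyl_inject:
  assumes eq: "cyl r \<theta> z = cyl r' \<theta>' z'" and r: "0 < r" "0 < r'" and near: "\<bar>\<theta> - \<theta>'\<bar> < 2"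
  shows "r = r' \<and> \<theta> = \<theta>' \<and> z = z'"
proof -
  have "r\<^sup>2 = r'\<^sup>2" using cyl_radius[of r \<theta> z] cyl_radius[of r' \<theta>' z'] eq by simp
  then have rr: "r = r'" using r power2_eq_iff_nonneg[of r r'] by simp
  have "r * cos \<theta> = r' * cos \<theta>'" "r * sin \<theta> = r' * sin \<theta>'" "z = z'"
    using eq cyl_nth[of r \<theta> z] cyl_nth[of r' \<theta>' z'] by simp_all
  then have z: "sin \<theta> = sin \<theta>' \<and> cos \<theta> = cos \<theta>'" "z = z'" using rr r by auto
  then obtain n :: int where n: "\<theta> = \<theta>' + 2 * pi * n" using sin_cos_eq_iff by blast
  have "n = 0"
  proof (rule ccontr)
    assume "n \<noteq> 0"
    then have "1 \<le> \<bar>real_of_int n\<bar>" by linarith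
    then have "2 * pi * 1 \<le> 2 * pi * \<bar>real_of_int n\<bar>" by (intro mult_left_mono) auto
    also have "\<dots> = \<bar>\<theta> - \<theta>'\<bar>" using n by (simp add: abs_mult)
    finally show False using near pi_ge_two by linarith
  qed
  then show ?thesis using rr z n by simp
qed

lemma norm_cyl_components:
  "(norm (a *\<^sub>R e_r \<theta> + b *\<^sub>R e_theta \<theta> + c *\<^sub>R e_z))\<^sup>2 = a\<^sup>2 + b\<^sup>2 + c\<^sup>2"
proof -
  have "(norm (a *\<^sub>R e_r \<theta> + b *\<^sub>R e_theta \<theta> + c *\<^sub>R e_z))\<^sup>2
      = (a * cos \<theta> - b * sin \<theta>)\<^sup>2 + (a * sin \<theta> + b * cos \<theta>)\<^sup>2 + c\<^sup>2"
    unfolding power2_norm_eq_inner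
    by (simp add: inner_vec_def sum_3 e_r_def e_theta_def e_z_def power2_eq_square)
  also have "\<dots> = (a\<^sup>2 + b\<^sup>2) * ((sin \<theta>)\<^sup>2 + (cos \<theta>)\<^sup>2) + c\<^sup>2"
    by algebra
  finally show ?thesis by simp
qed

lemma cyl_eq_sum_axis: "cyl r \<theta> z = (r * cos \<theta>) *\<^sub>R axis 1 1 + (r * sin \<theta>) *\<^sub>R axis 2 1 + z *\<^sub>R axis 3 1"
  by (simp add: vec_eq_iff forall_3 axis_def cyl_def)

text \<open>If the bound failed at one point, it would fail on an open set of cylindrical
  coordinates. Its image in space is open by invariance of domain, hence not a null set, against the
  essential supremum.\<close>

lemma Linf_norm_bound:
  assumes R: "0 < R1" "R1 < R2" and comp: "has_cyl_components R1 R2 v vr vt vz"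
    and cont: "continuous_on (slab R1 R2) (unc vr)" "continuous_on (slab R1 R2) (unc vt)" "continuous_on (slab R1 R2) (unc vz)"
    and Linf: "Linf_norm (Omega R1 R2) v < ereal C" and r: "R1 < r" "r < R2"
  shows "(vr r \<theta> z)\<^sup>2 + (vt r \<theta> z)\<^sup>2 + (vz r \<theta> z)\<^sup>2 \<le> C\<^sup>2"
proof (rule ccontr)
  assume big: "\<not> (vr r \<theta> z)\<^sup>2 + (vt r \<theta> z)\<^sup>2 + (vz r \<theta> z)\<^sup>2 \<le> C\<^sup>2"
  define V where "V x = (unc vr x)\<^sup>2 + (unc vt x)\<^sup>2 + (unc vz x)\<^sup>2" for x
  define T :: "real ^ 3 \<Rightarrow> pt" where "T y = (y $ 1, y $ 2, y $ 3)" for y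
  \<comment> \<open>The strip has angular width 2, which makes the coordinate map injective on
    it.\<close>
  define B :: "(real ^ 3) set" where "B = {y. R1 < y $ 1 \<and> y $ 1 < R2 \<and> \<theta> - 1 < y $ 2 \<and> y $ 2 < \<theta> + 1}"
  define W where "W = {y \<in> B. C\<^sup>2 < V (T y)}"
  define \<Phi> :: "real ^ 3 \<Rightarrow> real ^ 3" where "\<Phi> y = cyl (y $ 1) (y $ 2) (y $ 3)" for y
  have openB: "open B" unfolding B_def
    by (intro open_Collect_conj open_Collect_less continuous_intros)
  have "continuous_on B (\<lambda>y. V (T y))"
  proof (rule continuous_on_compose2[of "slab R1 R2" V B T])
    show "continuous_on (slab R1 R2) V"
      unfolding V_def[abs_def] by (intro continuous_intros cont)
    show "continuous_on B T" unfolding T_def[abs_def] by (intro continuous_intros)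
    show "T ` B \<subseteq> slab R1 R2" by (auto simp: B_def T_def slab_def)
  qed
  then have openW: "open W"
    using continuous_open_preimage[OF _ openB, of "\<lambda>y. V (T y)" "{C\<^sup>2<..}"]
    by (simp add: W_def Int_def vimage_def)
  have "continuous_on W \<Phi>"
    unfolding \<Phi>_def[abs_def] cyl_eq_sum_axis by (intro continuous_intros)
  moreover have "inj_on \<Phi> W"
  proof (rule inj_onI)
    fix x y assume xy: "x \<in> W" "y \<in> W" "\<Phi> x = \<Phi> y"
    then have "x $ 1 = y $ 1 \<and> x $ 2 = y $ 2 \<and> x $ 3 = y $ 3"
      using R by (intro cyl_inject) (auto simp: \<Phi>_def W_def B_def abs_less_iff)
    then show "x = y" by (simp add: vec_eq_iff forall_3)
  qed
  ultimately have "open (\<Phi> ` W)"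
    using invariance_of_domain openW by blast
  moreover have "(vector [r, \<theta>, z] :: real ^ 3) \<in> W"
    using r big by (simp add: W_def B_def V_def T_def)
  ultimately have pos: "\<not> negligible (\<Phi> ` W)"
    by (intro open_not_negligible) auto
  have large: "ereal C < ereal (norm (v x)) \<and> x \<in> Omega R1 R2" if "x \<in> \<Phi> ` W" for x
  proof -
    from that obtain y where y: "y \<in> W" "x = \<Phi> y" by blast
    then have yB: "R1 < y $ 1" "y $ 1 < R2" "C\<^sup>2 < V (T y)" by (auto simp: W_def B_def)
    have "(norm (v x))\<^sup>2 = V (T y)"
      using comp yB unfolding has_cyl_components_def y \<Phi>_def V_def T_def unc_simp
      by (simp add: norm_cyl_components)
    then have "C\<^sup>2 < (norm (v x))\<^sup>2" using yB by simp
    then have "C < norm (v x)" by (rule power_less_imp_less_base) simp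
    then show ?thesis using cyl_mem_Omega[OF R(1) yB(1,2)] y by (simp add: \<Phi>_def)
  qed
  have "AE x in lebesgue_on (Omega R1 R2). ereal (norm (v x)) \<le> Linf_norm (Omega R1 R2) v"
    unfolding Linf_norm_def by (rule esssup_AE)
  then have "AE x in lebesgue. x \<in> Omega R1 R2 \<longrightarrow> ereal (norm (v x)) \<le> Linf_norm (Omega R1 R2) v"
    using open_Omega by (subst (asm) AE_restrict_space_iff) auto
  moreover have "x \<notin> \<Phi> ` W" if "x \<in> Omega R1 R2 \<longrightarrow> ereal (norm (v x)) \<le> Linf_norm (Omega R1 R2) v" for x
    using that large[of x] Linf by (meson leD less_trans less_le_trans)
  ultimately have "AE x in lebesgue. x \<notin> \<Phi> ` W"
    by (rule eventually_mono)
  then have "\<Phi> ` W \<in> null_sets lebesgue"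
    using \<open>open (\<Phi> ` W)\<close> by (subst AE_iff_null_sets) auto
  then show False using pos by (simp add: negligible_iff_null_sets)
qed

lemma periodic_unc: "theta_periodic R1 R2 f \<Longrightarrow> periodic R1 R2 (unc f)"
  by (auto simp: theta_periodic_def periodic_def slab_def unc_def co_def rot_def upd_def)

theorem theorem1p2:
  fixes \<nu> R1 R2 :: real
  assumes "\<nu> > 0" and "0 < R1" and "R1 < R2"
  shows "\<exists>C2 > 0. \<forall>(\<omega>1::real) (\<omega>2::real) (v :: real ^ 3 \<Rightarrow> real ^ 3)
           (vr :: cyl_fun) (vt :: cyl_fun) (vz :: cyl_fun) (p :: cyl_fun).
     has_cyl_components R1 R2 v vr vt vz \<longrightarrow>
     (\<forall>f \<in> {vr, vt, vz, p}. theta_periodic R1 R2 f \<and> smooth_up_to_boundary R1 R2 f) \<longrightarrow>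
     stationary_NS \<nu> R1 R2 vr vt vz p \<longrightarrow>
     boundary_conditions R1 R2 \<omega>1 \<omega>2 vr vt vz \<longrightarrow>
     max (R1 * \<bar>\<omega>1\<bar>) (R2 * \<bar>\<omega>2\<bar>) < C2 \<longrightarrow>
     Linf_norm (Omega R1 R2) v < ereal C2 \<longrightarrow>
     (\<forall>r \<theta> z. R1 < r \<and> r < R2 \<longrightarrow>
        d_theta vr r \<theta> z = 0 \<and> d_theta vt r \<theta> z = 0 \<and> d_theta vz r \<theta> z = 0 \<and>
        d_theta p r \<theta> z = 0)"
proof -
  note R = assms(2,3)
  \<comment> \<open>All summands are positive, so the sum dominates each of them.\<close>
  define M where "M = 1 + 1 / R1 + R2 + 1 / (R2 - R1)"
  \<comment> \<open>With this value the contraction factor is 48 * 16 / 1600 = 0.48; any divisor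
    with square at least 1536 would serve in place of 40.\<close>
  define K where "K = \<nu> / (40 * M\<^sup>2)"
  have M: "1 \<le> M" "1 / R1 \<le> M" "R2 \<le> M" "1 / (R2 - R1) \<le> M"
    using R by (auto simp: M_def)
  have K0: "0 < K" using assms(1) M by (simp add: K_def)
  have small: "48 * M\<^sup>2 * const_F \<nu> M * K\<^sup>2 \<le> 1 / 2"
    using assms(1) M by (simp add: const_F_def K_def power2_eq_square)
  show ?thesis
  proof (rule exI[of _ K], rule conjI[OF K0], intro allI impI)
    fix \<omega>1 \<omega>2 :: real and v vr vt vz p
    fix r \<theta> z :: real
    assume comp: "has_cyl_components R1 R2 v vr vt vz"
      and reg: "\<forall>f \<in> {vr, vt, vz, p}. theta_periodic R1 R2 f \<and> smooth_up_to_boundary R1 R2 f"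
      and NS: "stationary_NS \<nu> R1 R2 vr vt vz p"
      and bc: "boundary_conditions R1 R2 \<omega>1 \<omega>2 vr vt vz"
      and bdry: "max (R1 * \<bar>\<omega>1\<bar>) (R2 * \<bar>\<omega>2\<bar>) < K"
      and Linf: "Linf_norm (Omega R1 R2) v < ereal K"
      and r: "R1 < r \<and> r < R2"
    have sm: "smooth_up_to_boundary R1 R2 vr" "smooth_up_to_boundary R1 R2 vt"
      "smooth_up_to_boundary R1 R2 vz" "smooth_up_to_boundary R1 R2 p"
      and pr: "periodic R1 R2 (unc vr)" "periodic R1 R2 (unc vt)" "periodic R1 R2 (unc vz)" "periodic R1 R2 (unc p)"
      using reg periodic_unc by auto
    obtain dr d2r where vr: "\<And>d. d < 3 \<Longrightarrow> pd (slab R1 R2) d (unc vr) (dr d)" "\<And>d. d < 3 \<Longrightarrow> pd (slab R1 R2) d (dr d) (d2r d)"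
      using smooth_partials[OF sm(1)] by blast
    obtain dt d2t where vt: "\<And>d. d < 3 \<Longrightarrow> pd (slab R1 R2) d (unc vt) (dt d)" "\<And>d. d < 3 \<Longrightarrow> pd (slab R1 R2) d (dt d) (d2t d)"
      using smooth_partials[OF sm(2)] by blast
    obtain dz d2z where vz: "\<And>d. d < 3 \<Longrightarrow> pd (slab R1 R2) d (unc vz) (dz d)" "\<And>d. d < 3 \<Longrightarrow> pd (slab R1 R2) d (dz d) (d2z d)"
      using smooth_partials[OF sm(3)] by blast
    obtain dp d2p where p: "\<And>d. d < 3 \<Longrightarrow> pd (slab R1 R2) d (unc p) (dp d)" "\<And>d. d < 3 \<Longrightarrow> pd (slab R1 R2) d (dp d) (d2p d)"
      using smooth_partials[OF sm(4)] by blast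
    have all: "\<forall>d<3. pd (slab R1 R2) d (unc vr) (dr d)" "\<forall>d<3. pd (slab R1 R2) d (dr d) (d2r d)"
      "\<forall>d<3. pd (slab R1 R2) d (unc vt) (dt d)" "\<forall>d<3. pd (slab R1 R2) d (dt d) (d2t d)"
      "\<forall>d<3. pd (slab R1 R2) d (unc vz) (dz d)" "\<forall>d<3. pd (slab R1 R2) d (dz d) (d2z d)"
      "\<forall>d<3. pd (slab R1 R2) d (unc p) (dp d)" "\<forall>d<3. pd (slab R1 R2) d (dp d) (d2p d)"
      using vr vt vz p by blast+
    note eqs = partials_eq[OF all(1,2)] partials_eq[OF all(3,4)] partials_eq[OF all(5,6)] partials_eq[OF all(7,8)]
    define u where "u i = (if i = 0 then unc vr else if i = 1 then unc vt else unc vz)" for i :: nat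
    define du where "du d i = (if i = 0 then dr d else if i = 1 then dt d else dz d)" for d i :: nat
    define d2u where "d2u d i = (if i = 0 then d2r d else if i = 1 then d2t d else d2z d)" for d i :: nat
    have c0: "continuous_on (slab R1 R2) (unc f)" if "\<And>d. d < 3 \<Longrightarrow> pd (slab R1 R2) d (unc f) (df d)" for f df
      using pdD1[OF that[of 0]] by simp
    have c: "continuous_on (slab R1 R2) (unc vr)" "continuous_on (slab R1 R2) (unc vt)" "continuous_on (slab R1 R2) (unc vz)"
      by (rule c0[OF vr(1)] c0[OF vt(1)] c0[OF vz(1)]; assumption)+
    have cd: "continuous_on (slab R1 R2) (dr d)" "continuous_on (slab R1 R2) (dt d)" "continuous_on (slab R1 R2) (dz d)"
      "continuous_on (slab R1 R2) (dp d)" "continuous_on (slab R1 R2) (d2r d)" "continuous_on (slab R1 R2) (d2t d)"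
      "continuous_on (slab R1 R2) (d2z d)" if "d < 3" for d
      using pdD2[OF vr(1)] pdD2[OF vt(1)] pdD2[OF vz(1)] pdD2[OF p(1)] pdD2[OF vr(2)] pdD2[OF vt(2)] pdD2[OF vz(2)] that by auto
    have nz: "\<forall>x\<in>slab R1 R2. co 0 x \<noteq> 0" "\<forall>x\<in>slab R1 R2. (co 0 x)\<^sup>2 \<noteq> 0"
      using R by (auto simp: mem_slab)
    have rvr: "d_r (\<lambda>s \<phi> y. s * vr s \<phi> y) s \<phi> y = vr s \<phi> y + s * dr 0 (s, \<phi>, y)" if "R1 < s" "s < R2" for s \<phi> y
    proof -
      have "pd (slab R1 R2) 0 (\<lambda>x. co 0 x * unc vr x) (\<lambda>x. 1 * unc vr x + co 0 x * dr 0 x)"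
        using pd_fun_same[of 0 "slab R1 R2" "\<lambda>_. 1" "\<lambda>s. s"] by (intro pd_mult vr) auto
      from d_r_eq[OF this _ that, of "\<lambda>s \<phi> y. s * vr s \<phi> y" \<phi> y] show ?thesis
        by (simp add: co_def)
    qed
    note NS' = NS[unfolded stationary_NS_def advect_def, rule_format]
    have ineq: "\<bar>u i y\<bar> \<le> K" if i: "i < 3" and y: "y \<in> slab R1 R2" for i y
    proof -
      obtain s \<phi> t where y': "y = (s, \<phi>, t)" "R1 \<le> s" "s \<le> R2" using y by (auto simp: slab_def)
      have "(vr s \<phi> t)\<^sup>2 + (vt s \<phi> t)\<^sup>2 + (vz s \<phi> t)\<^sup>2 \<le> K\<^sup>2"
      proof (cases "R1 < s \<and> s < R2")
        case True
        then show ?thesis using Linf_norm_bound[OF R comp c Linf] by blast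
      next
        case False
        then have s: "s = R1 \<or> s = R2" using y' by auto
        \<comment> \<open>On the cylinders the velocity is purely angular, and its size is the speed
          of the cylinder.\<close>
        have "\<bar>R1 * \<omega>1\<bar> \<le> K" "\<bar>R2 * \<omega>2\<bar> \<le> K" using bdry R by (auto simp: abs_mult)
        from square_le_of_abs[OF this(1)] square_le_of_abs[OF this(2)] s bc show ?thesis
          unfolding boundary_conditions_def by auto
      qed
      then have "(vr s \<phi> t)\<^sup>2 \<le> K\<^sup>2" "(vt s \<phi> t)\<^sup>2 \<le> K\<^sup>2" "(vz s \<phi> t)\<^sup>2 \<le> K\<^sup>2"
        using zero_le_power2[of "vr s \<phi> t"] zero_le_power2[of "vt s \<phi> t"] zero_le_power2[of "vz s \<phi> t"]
        by linarith+
      then have "(u i y)\<^sup>2 \<le> K\<^sup>2" by (simp add: u_def y')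
      then show ?thesis using K0 abs_le_square_iff[of "u i y" K] by simp
    qed
    interpret ns_solution \<nu> R1 R2 K u du d2u "unc p" dp
    proof (rule ns_solution.intro, goal_cases)
      case (4 d i) then show ?case unfolding u_def du_def using vr vt vz by auto
    next
      case (5 d i) then show ?case unfolding du_def d2u_def using vr vt vz by auto
    next
      \<comment> \<open>Here and in the next three cases the given equation holds for interior radii
        and is extended to the closed slab.\<close>
      case (7 x)
      show ?case
      proof (rule slab_closure_eq[OF R(2) _ _ _ 7, where
          f = "\<lambda>x. res0 \<nu> (co 0 x) (\<lambda>i. u i x) (\<lambda>d i. du d i x) (\<lambda>d i. d2u d i x) (\<lambda>d. dp d x)" and g = "\<lambda>x. 0"], goal_cases)
        case (3 s \<phi> y)
        then show ?case using NS'[of s \<phi> y] eqs[OF 3] by (simp add: res0_def u_def du_def d2u_def co_def)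
      qed (unfold res0_def u_def du_def d2u_def, auto intro!: continuous_intros c cd simp: nz)
    next
      case (8 x)
      show ?case
      proof (rule slab_closure_eq[OF R(2) _ _ _ 8, where
          f = "\<lambda>x. res1 \<nu> (co 0 x) (\<lambda>i. u i x) (\<lambda>d i. du d i x) (\<lambda>d i. d2u d i x) (\<lambda>d. dp d x)" and g = "\<lambda>x. 0"], goal_cases)
        case (3 s \<phi> y)
        then show ?case using NS'[of s \<phi> y] eqs[OF 3] by (simp add: res1_def u_def du_def d2u_def co_def)
      qed (unfold res1_def u_def du_def d2u_def, auto intro!: continuous_intros c cd simp: nz)
    next
      case (9 x)
      show ?case
      proof (rule slab_closure_eq[OF R(2) _ _ _ 9, where
          f = "\<lambda>x. res2 \<nu> (co 0 x) (\<lambda>i. u i x) (\<lambda>d i. du d i x) (\<lambda>d i. d2u d i x) (\<lambda>d. dp d x)" and g = "\<lambda>x. 0"], goal_cases)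
        case (3 s \<phi> y)
        then show ?case using NS'[of s \<phi> y] eqs[OF 3] by (simp add: res2_def u_def du_def d2u_def co_def)
      qed (unfold res2_def u_def du_def d2u_def, auto intro!: continuous_intros c cd simp: nz)
    next
      case (10 x)
      show ?case
      proof (rule slab_closure_eq[OF R(2) _ _ _ 10, where
          f = "\<lambda>x. u 0 x + co 0 x * du 0 0 x + du 1 1 x + co 0 x * du 2 2 x" and g = "\<lambda>x. 0"], goal_cases)
        case (3 s \<phi> y)
        have "1 / s * (vr s \<phi> y + s * dr 0 (s, \<phi>, y)) + 1 / s * dt 1 (s, \<phi>, y) + dz 2 (s, \<phi>, y) = 0"
          using NS'[of s \<phi> y] 3 eqs[OF 3] rvr[OF 3] by simp
        \<comment> \<open>Multiplying by the radius brings the divergence into the form without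
          denominators used by \<open>ns_solution\<close>.\<close>
        then have "s * (1 / s * (vr s \<phi> y + s * dr 0 (s, \<phi>, y)) + 1 / s * dt 1 (s, \<phi>, y) + dz 2 (s, \<phi>, y)) = 0"
          by simp
        then show ?case using R 3 by (simp add: u_def du_def co_def distrib_left)
      qed (unfold u_def du_def d2u_def, auto intro!: continuous_intros c cd)
    next
      case 11 then show ?case unfolding u_def using pr by auto
    next
      case (13 i y s)
      then show ?case
        using bc unfolding boundary_conditions_def u_def unc_def co_rot by auto
    next
      case 14 then show ?case by (rule ineq)
    qed (rule assms(1) R pr | erule p)+
    have inv: "u i (rot s x) = u i x" if "i < 3" "x \<in> slab R1 R2" for i s x
      by (rule rotation_invariant[OF M small that])
    have x: "(r, \<theta>, z) \<in> slab R1 R2" using r by (simp add: slab_def)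
    have const: "d_theta f r \<theta> z = 0" if "\<And>s. unc f (rot s (r, 0, z)) = unc f (r, 0, z)" for f
    proof -
      have "(\<lambda>s. f r s z) = (\<lambda>s. f r 0 z)" using that by (simp add: rot_def upd_def co_def fun_eq_iff)
      then show ?thesis by (simp add: d_theta_def)
    qed
    have x0: "(r, 0, z) \<in> slab R1 R2" using r by (simp add: slab_def)
    have "d_theta vr r \<theta> z = 0" "d_theta vt r \<theta> z = 0" "d_theta vz r \<theta> z = 0"
      using inv[OF _ x0, of 0] inv[OF _ x0, of 1] inv[OF _ x0, of 2] by (auto intro!: const simp: u_def)
    moreover have "d_theta p r \<theta> z = 0"
      using pressure_rotation_invariant[OF inv x] eqs(14) r by simp
    ultimately show "d_theta vr r \<theta> z = 0 \<and> d_theta vt r \<theta> z = 0 \<and> d_theta vz r \<theta> z = 0 \<and> d_theta p r \<theta> z = 0"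
      by blast
  qed
qed
end
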